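(* Given a matrix-weighted graph $G=(V,E)$ all of whose edge weights have rank $1$, one can, using a number of arithmetic operations over $\mathbb{R}$ polynomial in the size of the graph, find a No-Lone-YY basis for $G$ or otherwise determine that no such basis exists.
   Context: A matrix-weighted graph is a graph $G=(V,E)$ where each edge $(u,v)$ carries a real $3\times3$ matrix $\beta_{uv}$, with $\beta_{vu}=\beta_{uv}^{\sf T}$. A basis assignment $B=\{b_u\}$ assigns to each vertex $u$ an ordered orthonormal basis $b_u=(e_1^u,e_2^u,e_3^u)$ of $\mathbb{R}^3$. A No-Lone-YY (NLY) basis is a basis assignment such that (i) for every edge $(u,v)$ and every $i\in\{1,2,3\}$ there is $\sigma\in\mathbb{R}$ with $\beta_{uv}e_i^v=\pm\sigma e_i^u$ and $\beta_{uv}^{\sf T}e_i^u=\pm\sigma e_i^v$ (equivalently, with $O_u=(e_1^u,e_2^u,e_3^u)$, the matrix $O_u^{\sf T}\beta_{uv}O_v$ is diagonal), and (ii) for every edge $(u,v)$ with $\mathrm{rank}\,\beta_{uv}=1$, $\beta_{uv}e_2^v=0$ and $\beta_{uv}^{\sf T}e_2^u=0$. *)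

theory Defs
  imports "HOL-Analysis.Analysis"
begin

text \<open>A matrix-weighted graph on vertex set V = {0..<n} is given by a list of
  edges (u, v, B) meaning an edge {u,v} with weight beta_uv = B and
  beta_vu = transpose B.\<close>

type_synonym mwgraph_edges = "(nat \<times> nat \<times> (real^3^3)) list"

definition mw_graph :: "nat \<Rightarrow> mwgraph_edges \<Rightarrow> bool" where
  "mw_graph n es \<longleftrightarrow>
     (\<forall>(u, v, B) \<in> set es. u < n \<and> v < n \<and> u \<noteq> v) \<and>
     distinct (map (\<lambda>(u, v, B). {u, v}) es)"

definition all_rank_one :: "mwgraph_edges \<Rightarrow> bool" where
  "all_rank_one es \<longleftrightarrow> (\<forall>(u, v, B) \<in> set es. rank B = 1)"

text \<open>A basis assignment: Ob u is the matrix whose j-th column is e_j^u;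
  it is an ordered orthonormal basis iff Ob u is an orthogonal matrix.\<close>

definition bvec :: "(nat \<Rightarrow> real^3^3) \<Rightarrow> nat \<Rightarrow> 3 \<Rightarrow> real^3" where
  "bvec Ob u i = column i (Ob u)"

definition basis_assignment :: "nat \<Rightarrow> (nat \<Rightarrow> real^3^3) \<Rightarrow> bool" where
  "basis_assignment n Ob \<longleftrightarrow> (\<forall>u<n. orthogonal_matrix (Ob u))"

definition NLY_basis :: "nat \<Rightarrow> mwgraph_edges \<Rightarrow> (nat \<Rightarrow> real^3^3) \<Rightarrow> bool" where
  "NLY_basis n es Ob \<longleftrightarrow>
     basis_assignment n Ob \<and>
     (\<forall>(u, v, B) \<in> set es. \<forall>i::3. \<exists>\<sigma>::real.
        (B *v bvec Ob v i = \<sigma> *\<^sub>R bvec Ob u i \<or> B *v bvec Ob v i = (- \<sigma>) *\<^sub>R bvec Ob u i) \<and>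
        (transpose B *v bvec Ob u i = \<sigma> *\<^sub>R bvec Ob v i \<or>
         transpose B *v bvec Ob u i = (- \<sigma>) *\<^sub>R bvec Ob v i)) \<and>
     (\<forall>(u, v, B) \<in> set es. rank B = 1 \<longrightarrow>
        B *v bvec Ob v 2 = 0 \<and> transpose B *v bvec Ob u 2 = 0)"

text \<open>Integer registers I (for indices/addressing; only +, - and constants) and
  real registers R (exact arithmetic +, -, *, /, sqrt; comparisons).  Every
  instruction costs one step.\<close>

datatype instr =
    IConst nat int
  | IAdd nat nat nat
  | ISub nat nat nat
  | ILoad nat nat
  | IStore nat nat
  | RConst nat real
  | RAdd nat nat nat
  | RSub nat nat nat
  | RMul nat nat nat
  | RDiv nat nat nat
  | RSqrt nat nat
  | RLoad nat nat
  | RStore nat nat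
  | IJmpLe nat nat nat
  | RJmpLe nat nat nat
  | Jmp nat
  | Halt

type_synonym ram_state = "nat \<times> (nat \<Rightarrow> int) \<times> (nat \<Rightarrow> real)"

definition halted :: "instr list \<Rightarrow> ram_state \<Rightarrow> bool" where
  "halted P s \<longleftrightarrow> (case s of (pc, _, _) \<Rightarrow> pc \<ge> length P \<or> P ! pc = Halt)"

fun exec_instr :: "instr \<Rightarrow> ram_state \<Rightarrow> ram_state" where
  "exec_instr (IConst a c) (pc, I, R) = (Suc pc, I(a := c), R)"
| "exec_instr (IAdd a b c) (pc, I, R) = (Suc pc, I(a := I b + I c), R)"
| "exec_instr (ISub a b c) (pc, I, R) = (Suc pc, I(a := I b - I c), R)"
| "exec_instr (ILoad a b) (pc, I, R) = (Suc pc, I(a := I (nat (I b))), R)"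
| "exec_instr (IStore a b) (pc, I, R) = (Suc pc, I(nat (I a) := I b), R)"
| "exec_instr (RConst a c) (pc, I, R) = (Suc pc, I, R(a := c))"
| "exec_instr (RAdd a b c) (pc, I, R) = (Suc pc, I, R(a := R b + R c))"
| "exec_instr (RSub a b c) (pc, I, R) = (Suc pc, I, R(a := R b - R c))"
| "exec_instr (RMul a b c) (pc, I, R) = (Suc pc, I, R(a := R b * R c))"
| "exec_instr (RDiv a b c) (pc, I, R) = (Suc pc, I, R(a := R b / R c))"
| "exec_instr (RSqrt a b) (pc, I, R) = (Suc pc, I, R(a := sqrt (R b)))"
| "exec_instr (RLoad a b) (pc, I, R) = (Suc pc, I, R(a := R (nat (I b))))"
| "exec_instr (RStore a b) (pc, I, R) = (Suc pc, I, R(nat (I a) := R b))"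
| "exec_instr (IJmpLe a b l) (pc, I, R) = ((if I a \<le> I b then l else Suc pc), I, R)"
| "exec_instr (RJmpLe a b l) (pc, I, R) = ((if R a \<le> R b then l else Suc pc), I, R)"
| "exec_instr (Jmp l) (pc, I, R) = (l, I, R)"
| "exec_instr Halt s = s"

definition ram_step :: "instr list \<Rightarrow> ram_state \<Rightarrow> ram_state" where
  "ram_step P s = (if halted P s then s else exec_instr (P ! fst s) s)"

definition ix3 :: "nat \<Rightarrow> 3" where
  "ix3 i = (if i = 0 then 1 else if i = 1 then 2 else 3)"

text \<open>Input: I[0] = n, I[1] = m = number of edges, I[2+2k], I[3+2k] = endpoints
  of edge k; R[9k+3i+j] = entry (i,j) of the weight of edge k (0-based i,j).\<close>

definition init_state :: "nat \<Rightarrow> mwgraph_edges \<Rightarrow> ram_state" where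
  "init_state n es =
     (0,
      (\<lambda>r. if r = 0 then int n
           else if r = 1 then int (length es)
           else if r < 2 + 2 * length es then
             (if even r then int (fst (es ! ((r - 2) div 2)))
              else int (fst (snd (es ! ((r - 2) div 2)))))
           else 0),
      (\<lambda>r. if r < 9 * length es then
             snd (snd (es ! (r div 9))) $ ix3 ((r mod 9) div 3) $ ix3 (r mod 3)
           else 0))"

text \<open>Output: I[0] = 1 means "basis found", with the basis matrix of vertex u
  stored as R[9u+3i+j] = entry (i,j) of Ob u (column j is e_(j+1)^u);
  I[0] = 0 means "no NLY basis exists".\<close>

definition decode_basis :: "ram_state \<Rightarrow> nat \<Rightarrow> real^3^3" where
  "decode_basis s u =
     (\<chi> i j. (snd (snd s)) (9 * u + 3 * (if i = 1 then 0 else if i = 2 then 1 else 2)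
                                  + (if j = 1 then 0 else if j = 2 then 1 else 2)))"

definition correct_output :: "nat \<Rightarrow> mwgraph_edges \<Rightarrow> ram_state \<Rightarrow> bool" where
  "correct_output n es s \<longleftrightarrow>
     (fst (snd s) 0 = 1 \<and> NLY_basis n es (decode_basis s)) \<or>
     (fst (snd s) 0 = 0 \<and> \<not> (\<exists>Ob. NLY_basis n es Ob))"

end

theory Submission
  imports Defs
begin

text \<open>An edge weight of rank 1 is \<open>c a b\<^sup>T\<close> with unit vectors \<open>a\<close>, \<open>b\<close>, and diagonality together with
  the condition on second basis vectors says precisely that, up to signs, \<open>a\<close> and \<open>b\<close> are both the
  first or both the third basis vector at their ends.  So an NLY basis is a two-labelling of the
  edges in which any two half-edges at a common vertex have parallel directions if their labels
  agree and orthogonal directions otherwise; a pair of directions that is neither parallel nor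
  orthogonal excludes a basis, and all remaining pairs impose equations and inequations between labels
  that a union-find with signs solves.  Conversely a labelling prescribes at most two orthogonal unit
  vectors per vertex, which are completed to an orthonormal basis.

  The random access program is obtained from a structured while-free language with variables,
  expressions, arrays and bounded loops, by a compiler proved correct with a polynomial time bound.\<close>

section \<open>A structured language and its compilation\<close>

text \<open>The condition on second basis vectors leaves two candidates instead of three for each
  direction, and this makes the search free of backtracking: at a vertex one label determines all
  others, so the only failures are a bad angle and a class forced to equal its own negative. If
  neither occurs, the signs of the final nonzero integers already form an admissible labelling and
  nothing has to be guessed.

  The machine shapes the rest. A fixed instruction list names only finitely many registers, and a
  large input fills all of them, so free space must be created before anything can be computed. The
  integer bank cannot multiply, hence addresses are built by additions. The only comparison is
  \<open>\<le>\<close>, so tests for zero, parallelism and orthogonality become inequalities whose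
  opposite side is known. Square roots serve only to normalise: the edge directions and the vectors
  that complete a basis. As every loop is bounded by the input size, the exponent of the time bound
  is the nesting depth of loops, a syntactic quantity.\<close>

definition steps :: "instr list \<Rightarrow> ram_state \<Rightarrow> nat \<Rightarrow> ram_state \<Rightarrow> bool" where
  "steps P s T s' \<longleftrightarrow> (\<exists>t\<le>T. (ram_step P ^^ t) s = s')"

lemma steps_refl: "steps P s T s"
  unfolding steps_def by (rule exI[of _ 0]) simp

lemma steps_trans:
  assumes "steps P s T s'" "steps P s' T' s''"
  shows "steps P s (T + T') s''"
proof -
  obtain t t' where "t \<le> T" "(ram_step P ^^ t) s = s'" "t' \<le> T'" "(ram_step P ^^ t') s' = s''"
    using assms unfolding steps_def by blast
  then show ?thesis
    unfolding steps_def by (intro exI[of _ "t' + t"]) (simp add: funpow_add)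
qed

text \<open>Working with an upper bound instead of an exact count allows a conditional to be charged
  for both branches and a loop for its largest possible number of rounds.\<close>

lemma steps_mono: "steps P s T s' \<Longrightarrow> T \<le> T' \<Longrightarrow> steps P s T' s'"
  unfolding steps_def using le_trans by blast

fun code_at :: "instr list \<Rightarrow> nat \<Rightarrow> instr list \<Rightarrow> bool" where
  "code_at P p [] \<longleftrightarrow> True"
| "code_at P p (c # cs) \<longleftrightarrow> p < length P \<and> P ! p = c \<and> code_at P (Suc p) cs"

lemma code_at_append: "code_at P p (cs @ ds) \<longleftrightarrow> code_at P p cs \<and> code_at P (p + length cs) ds"
  by (induction cs arbitrary: p) auto

lemma code_at_self: "code_at (as @ cs @ bs) (length as) cs"
proof (induction cs arbitrary: as)
  case (Cons c cs)
  from Cons[of "as @ [c]"] show ?case by simp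
qed simp

lemma steps_instr:
  assumes "p < length P" "P ! p = c" "c \<noteq> Halt" "steps P (exec_instr c (p, I, R)) T s'"
  shows "steps P (p, I, R) (Suc T) s'"
proof -
  have "ram_step P (p, I, R) = exec_instr c (p, I, R)"
    using assms by (simp add: ram_step_def halted_def)
  then have "steps P (p, I, R) 1 (exec_instr c (p, I, R))"
    unfolding steps_def by (intro exI[of _ 1]) simp
  from steps_trans[OF this assms(4)] show ?thesis by simp
qed

fun straight :: "instr \<Rightarrow> bool" where
  "straight (IJmpLe a b l) = False"
| "straight (RJmpLe a b l) = False"
| "straight (Jmp l) = False"
| "straight Halt = False"
| "straight c = True"

lemma exec_straight:
  "straight c \<Longrightarrow> exec_instr c (p, I, R) = (Suc p, snd (exec_instr c (0, I, R)))"
  by (cases c) auto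

text \<open>The program counter 0 is a dummy: a straight instruction only increments it. A jump-free
  block can therefore be evaluated on the memory alone.\<close>

abbreviation exec_block :: "instr list \<Rightarrow> (nat \<Rightarrow> int) \<times> (nat \<Rightarrow> real) \<Rightarrow> (nat \<Rightarrow> int) \<times> (nat \<Rightarrow> real)" where
  "exec_block cs \<equiv> fold (\<lambda>c s. snd (exec_instr c (0, s))) cs"

lemma steps_block:
  assumes "code_at P p cs" "list_all straight cs"
  shows "steps P (p, I, R) (length cs) (p + length cs, exec_block cs (I, R))"
  using assms
proof (induction cs arbitrary: p I R)
  case Nil
  show ?case by (simp add: steps_refl)
next
  case (Cons c cs)
  obtain I' R' where e: "snd (exec_instr c (0, I, R)) = (I', R')" by fastforce
  have "exec_instr c (p, I, R) = (Suc p, I', R')"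
    using Cons.prems exec_straight[of c p I R] e by simp
  moreover have "steps P (Suc p, I', R') (length cs) (Suc p + length cs, exec_block cs (I', R'))"
    using Cons.IH[of "Suc p" I' R'] Cons.prems by simp
  moreover have "c \<noteq> Halt" using Cons.prems by auto
  ultimately have "steps P (p, I, R) (Suc (length cs)) (Suc p + length cs, exec_block cs (I', R'))"
    using Cons.prems steps_instr[of p P c I R "length cs"] by simp
  then show ?case by (simp add: e)
qed

section \<open>Syntax and semantics of the structured language\<close>

datatype iexp =
    IV nat
  | IC int
  | IPlus iexp iexp
  | IMinus iexp iexp
  | IArr nat iexp

datatype rexp =
    RV nat
  | RC real
  | RPlus rexp rexp
  | RMinus rexp rexp
  | RTimes rexp rexp
  | RDivide rexp rexp
  | RRoot rexp
  | RArr nat iexp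

datatype cmd =
    Skip
  | IAsg nat iexp
  | RAsg nat rexp
  | ISet nat iexp iexp
  | RSet nat iexp rexp
  | Seq cmd cmd
  | IfI iexp iexp cmd cmd
  | IfR rexp rexp cmd cmd
  | For nat nat cmd

record hstate =
  ivar :: "nat \<Rightarrow> int"
  rvar :: "nat \<Rightarrow> real"
  iarr :: "nat \<Rightarrow> nat \<Rightarrow> int"
  rarr :: "nat \<Rightarrow> nat \<Rightarrow> real"

primrec ieval :: "iexp \<Rightarrow> hstate \<Rightarrow> int" where
  "ieval (IV x) s = ivar s x"
| "ieval (IC c) s = c"
| "ieval (IPlus e f) s = ieval e s + ieval f s"
| "ieval (IMinus e f) s = ieval e s - ieval f s"
| "ieval (IArr a e) s = iarr s a (nat (ieval e s))"

primrec reval :: "rexp \<Rightarrow> hstate \<Rightarrow> real" where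
  "reval (RV x) s = rvar s x"
| "reval (RC c) s = c"
| "reval (RPlus e f) s = reval e s + reval f s"
| "reval (RMinus e f) s = reval e s - reval f s"
| "reval (RTimes e f) s = reval e s * reval f s"
| "reval (RDivide e f) s = reval e s / reval f s"
| "reval (RRoot e) s = sqrt (reval e s)"
| "reval (RArr a e) s = rarr s a (nat (ieval e s))"

definition iset :: "nat \<Rightarrow> int \<Rightarrow> hstate \<Rightarrow> hstate" where
  "iset x v s = s\<lparr>ivar := (ivar s)(x := v)\<rparr>"

text \<open>The number of rounds of a \<open>For\<close> is fixed on entry, whereas its compiled
  form compares counter and limit anew in every round. The two agree because \<open>wf_cmd\<close>
  forbids the body to change either.\<close>

primrec sem :: "cmd \<Rightarrow> hstate \<Rightarrow> hstate" where
  "sem Skip s = s"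
| "sem (IAsg x e) s = iset x (ieval e s) s"
| "sem (RAsg x e) s = s\<lparr>rvar := (rvar s)(x := reval e s)\<rparr>"
| "sem (ISet a e f) s = s\<lparr>iarr := (iarr s)(a := (iarr s a)(nat (ieval e s) := ieval f s))\<rparr>"
| "sem (RSet a e f) s = s\<lparr>rarr := (rarr s)(a := (rarr s a)(nat (ieval e s) := reval f s))\<rparr>"
| "sem (Seq c d) s = sem d (sem c s)"
| "sem (IfI e f c d) s = (if ieval e s \<le> ieval f s then sem c s else sem d s)"
| "sem (IfR e f c d) s = (if reval e s \<le> reval f s then sem c s else sem d s)"
| "sem (For x l c) s =
     ((\<lambda>s. iset x (ivar (sem c s) x + 1) (sem c s)) ^^ nat (ivar s l)) (iset x 0 s)"

text \<open>Memory layout of a compiled program: registers 0 and 1 hold addresses, register 2 the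
  base \<open>B\<close> of the array area, integer variable \<open>r\<close> lives in register \<open>3 + r\<close>, registers 20 to 39
  form an evaluation stack, and the four arrays of each sort are interleaved from address \<open>B\<close> on,
  so that they never collide.\<close>

definition rel :: "nat \<Rightarrow> hstate \<Rightarrow> (nat \<Rightarrow> int) \<Rightarrow> (nat \<Rightarrow> real) \<Rightarrow> bool" where
  "rel B s I R \<longleftrightarrow> 40 \<le> B \<and> I 2 = int B \<and>
     (\<forall>r<17. I (3 + r) = ivar s r) \<and> (\<forall>r<20. R r = rvar s r) \<and>
     (\<forall>a<4. \<forall>i. I (B + 4 * i + a) = iarr s a i) \<and> (\<forall>a<4. \<forall>i. R (B + 4 * i + a) = rarr s a i)"

section \<open>Code generation\<close>

text \<open>The jump skips the addition if the index in \<open>d\<close> is at most 0, so that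
  register 0 receives the index clamped at 0, in accordance with \<open>nat\<close> in the
  semantics. Two doublings then give the stride 4 of the interleaved arrays.\<close>

definition address_code :: "nat \<Rightarrow> nat \<Rightarrow> nat \<Rightarrow> instr list" where
  "address_code a d p =
     [IConst 0 0, IJmpLe d 0 (p + 3), IAdd 0 0 d, IAdd 0 0 0, IAdd 0 0 0,
      IConst 1 (int a), IAdd 0 0 1, IAdd 0 0 2]"

primrec isize :: "iexp \<Rightarrow> nat" where
  "isize (IV x) = 2"
| "isize (IC c) = 1"
| "isize (IPlus e f) = isize e + isize f + 1"
| "isize (IMinus e f) = isize e + isize f + 1"
| "isize (IArr a e) = isize e + 9"

primrec rsize :: "rexp \<Rightarrow> nat" where
  "rsize (RV x) = 2"
| "rsize (RC c) = 1"
| "rsize (RPlus e f) = rsize e + rsize f + 1"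
| "rsize (RMinus e f) = rsize e + rsize f + 1"
| "rsize (RTimes e f) = rsize e + rsize f + 1"
| "rsize (RDivide e f) = rsize e + rsize f + 1"
| "rsize (RRoot e) = rsize e + 1"
| "rsize (RArr a e) = isize e + 9"

primrec csize :: "cmd \<Rightarrow> nat" where
  "csize Skip = 0"
| "csize (IAsg x e) = isize e + 2"
| "csize (RAsg x e) = rsize e + 2"
| "csize (ISet a e f) = isize e + isize f + 9"
| "csize (RSet a e f) = isize e + rsize f + 9"
| "csize (Seq c d) = csize c + csize d"
| "csize (IfI e f c d) = isize e + isize f + csize c + csize d + 2"
| "csize (IfR e f c d) = rsize e + rsize f + csize c + csize d + 2"
| "csize (For x l c) = csize c + 5"

primrec icode :: "iexp \<Rightarrow> nat \<Rightarrow> nat \<Rightarrow> instr list" where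
  "icode (IV x) d p = [IConst 0 0, IAdd d (3 + x) 0]"
| "icode (IC c) d p = [IConst d c]"
| "icode (IPlus e f) d p =
     icode e d p @ icode f (Suc d) (p + isize e) @ [IAdd d d (Suc d)]"
| "icode (IMinus e f) d p =
     icode e d p @ icode f (Suc d) (p + isize e) @ [ISub d d (Suc d)]"
| "icode (IArr a e) d p =
     icode e d p @ address_code a d (p + isize e) @ [ILoad d 0]"

text \<open>There is no move instruction, so a variable is fetched by adding zero. The real bank has
  no scratch register below the stack (register 0 is a variable), hence the zero is put into the
  target itself. An array index uses the integer stack from 20 on, which is free because no integer
  value is pending while a real expression is evaluated.\<close>

primrec rcode :: "rexp \<Rightarrow> nat \<Rightarrow> nat \<Rightarrow> instr list" where
  "rcode (RV x) d p = [RConst d 0, RAdd d x d]"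
| "rcode (RC c) d p = [RConst d c]"
| "rcode (RPlus e f) d p =
     rcode e d p @ rcode f (Suc d) (p + rsize e) @ [RAdd d d (Suc d)]"
| "rcode (RMinus e f) d p =
     rcode e d p @ rcode f (Suc d) (p + rsize e) @ [RSub d d (Suc d)]"
| "rcode (RTimes e f) d p =
     rcode e d p @ rcode f (Suc d) (p + rsize e) @ [RMul d d (Suc d)]"
| "rcode (RDivide e f) d p =
     rcode e d p @ rcode f (Suc d) (p + rsize e) @ [RDiv d d (Suc d)]"
| "rcode (RRoot e) d p = rcode e d p @ [RSqrt d d]"
| "rcode (RArr a e) d p =
     icode e 20 p @ address_code a 20 (p + isize e) @ [RLoad d 0]"

text \<open>\<open>RSet\<close> evaluates the value before the index: a real expression may
  overwrite the integer stack through its own array indices, while an integer expression leaves the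
  real bank alone. In a conditional the else-branch comes first, reached by falling through the
  test.\<close>

primrec code :: "cmd \<Rightarrow> nat \<Rightarrow> instr list" where
  "code Skip p = []"
| "code (IAsg x e) p = icode e 20 p @ [IConst 0 0, IAdd (3 + x) 20 0]"
| "code (RAsg x e) p = rcode e 20 p @ [RConst 21 0, RAdd x 20 21]"
| "code (ISet a e f) p =
     icode e 20 p @ icode f 21 (p + isize e) @
     address_code a 20 (p + isize e + isize f) @ [IStore 0 21]"
| "code (RSet a e f) p =
     rcode f 20 p @ icode e 20 (p + rsize f) @
     address_code a 20 (p + rsize f + isize e) @ [RStore 0 20]"
| "code (Seq c d) p = code c p @ code d (p + csize c)"
| "code (IfI e f c d) p = (let q = p + isize e + isize f; ld = csize d;
       lc = csize c in
     icode e 20 p @ icode f 21 (p + isize e) @ [IJmpLe 20 21 (q + ld + 2)] @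
     code d (q + 1) @ [Jmp (q + ld + 2 + lc)] @ code c (q + ld + 2))"
| "code (IfR e f c d) p = (let q = p + rsize e + rsize f; ld = csize d;
       lc = csize c in
     rcode e 20 p @ rcode f 21 (p + rsize e) @ [RJmpLe 20 21 (q + ld + 2)] @
     code d (q + 1) @ [Jmp (q + ld + 2 + lc)] @ code c (q + ld + 2))"
| "code (For x l c) p =
     [IConst (3 + x) 0, IJmpLe (3 + l) (3 + x) (p + 5 + csize c)] @ code c (p + 2) @
     [IConst 0 1, IAdd (3 + x) (3 + x) 0, Jmp (p + 1)]"

lemma length_address_code: "length (address_code a d p) = 8"
  by (simp add: address_code_def)

lemma length_icode [simp]: "length (icode e d p) = isize e"
  by (induction e arbitrary: d p) (auto simp: address_code_def)

lemma length_rcode [simp]: "length (rcode e d p) = rsize e"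
  by (induction e arbitrary: d p) (auto simp: address_code_def)

lemma length_code [simp]: "length (code c p) = csize c"
  by (induction c arbitrary: p) (auto simp: address_code_def Let_def)

section \<open>Well-formedness, modified variables and cost measures\<close>

text \<open>This bounds the evaluation stack that starts at \<open>d\<close>. Checking the leaves
  suffices, since an inner node uses no cell beyond those of its subexpressions.\<close>

primrec iwf :: "nat \<Rightarrow> iexp \<Rightarrow> bool" where
  "iwf d (IV x) \<longleftrightarrow> x < 17 \<and> d < 40"
| "iwf d (IC c) \<longleftrightarrow> d < 40"
| "iwf d (IPlus e f) \<longleftrightarrow> iwf d e \<and> iwf (Suc d) f"
| "iwf d (IMinus e f) \<longleftrightarrow> iwf d e \<and> iwf (Suc d) f"
| "iwf d (IArr a e) \<longleftrightarrow> a < 4 \<and> iwf d e"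

primrec rwf :: "nat \<Rightarrow> rexp \<Rightarrow> bool" where
  "rwf d (RV x) \<longleftrightarrow> x < 20 \<and> d < 40"
| "rwf d (RC c) \<longleftrightarrow> d < 40"
| "rwf d (RPlus e f) \<longleftrightarrow> rwf d e \<and> rwf (Suc d) f"
| "rwf d (RMinus e f) \<longleftrightarrow> rwf d e \<and> rwf (Suc d) f"
| "rwf d (RTimes e f) \<longleftrightarrow> rwf d e \<and> rwf (Suc d) f"
| "rwf d (RDivide e f) \<longleftrightarrow> rwf d e \<and> rwf (Suc d) f"
| "rwf d (RRoot e) \<longleftrightarrow> rwf d e"
| "rwf d (RArr a e) \<longleftrightarrow> a < 4 \<and> d < 40 \<and> iwf 20 e"

lemma iwf_less: "iwf d e \<Longrightarrow> d < 40"
  by (induction e) auto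

lemma rwf_less: "rwf d e \<Longrightarrow> d < 40"
  by (induction e) auto

primrec mods :: "cmd \<Rightarrow> nat set" where
  "mods Skip = {}"
| "mods (IAsg x e) = {x}"
| "mods (RAsg x e) = {}"
| "mods (ISet a e f) = {}"
| "mods (RSet a e f) = {}"
| "mods (Seq c d) = mods c \<union> mods d"
| "mods (IfI e f c d) = mods c \<union> mods d"
| "mods (IfR e f c d) = mods c \<union> mods d"
| "mods (For x l c) = {x} \<union> mods c"

text \<open>Integer variables 0, 1, 2 hold \<open>n\<close>, \<open>m\<close>, \<open>2m\<close> and are read-only; that they bound all loops
  makes the running time polynomial.\<close>

primrec wf_cmd :: "cmd \<Rightarrow> bool" where
  "wf_cmd Skip \<longleftrightarrow> True"
| "wf_cmd (IAsg x e) \<longleftrightarrow> 3 \<le> x \<and> x < 17 \<and> iwf 20 e"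
| "wf_cmd (RAsg x e) \<longleftrightarrow> x < 20 \<and> rwf 20 e"
| "wf_cmd (ISet a e f) \<longleftrightarrow> a < 4 \<and> iwf 20 e \<and> iwf 21 f"
| "wf_cmd (RSet a e f) \<longleftrightarrow> a < 4 \<and> iwf 20 e \<and> rwf 20 f"
| "wf_cmd (Seq c d) \<longleftrightarrow> wf_cmd c \<and> wf_cmd d"
| "wf_cmd (IfI e f c d) \<longleftrightarrow> iwf 20 e \<and> iwf 21 f \<and> wf_cmd c \<and> wf_cmd d"
| "wf_cmd (IfR e f c d) \<longleftrightarrow> rwf 20 e \<and> rwf 21 f \<and> wf_cmd c \<and> wf_cmd d"
| "wf_cmd (For x l c) \<longleftrightarrow> 3 \<le> x \<and> x < 17 \<and> l < 3 \<and> x \<notin> mods c \<and> wf_cmd c"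

text \<open>A loop is charged as if its body ran once; the number of rounds enters through the power
  \<open>Suc D ^ depth c\<close> in \<open>steps_code\<close>.\<close>

primrec time :: "cmd \<Rightarrow> nat" where
  "time Skip = 0"
| "time (IAsg x e) = isize e + 2"
| "time (RAsg x e) = rsize e + 2"
| "time (ISet a e f) = isize e + isize f + 9"
| "time (RSet a e f) = isize e + rsize f + 9"
| "time (Seq c d) = time c + time d"
| "time (IfI e f c d) = isize e + isize f + time c + time d + 2"
| "time (IfR e f c d) = rsize e + rsize f + time c + time d + 2"
| "time (For x l c) = time c + 6"

primrec depth :: "cmd \<Rightarrow> nat" where
  "depth Skip = 0"
| "depth (IAsg x e) = 0"
| "depth (RAsg x e) = 0"
| "depth (ISet a e f) = 0"
| "depth (RSet a e f) = 0"
| "depth (Seq c d) = max (depth c) (depth d)"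
| "depth (IfI e f c d) = max (depth c) (depth d)"
| "depth (IfR e f c d) = max (depth c) (depth d)"
| "depth (For x l c) = Suc (depth c)"

lemma ivar_iset: "ivar (iset x v s) = (ivar s)(x := v)"
  by (simp add: iset_def)

lemma ivar_sem: "x \<notin> mods c \<Longrightarrow> ivar (sem c s) x = ivar s x"
proof (induction c arbitrary: s)
  case (For y l c)
  have "ivar (((\<lambda>s. iset y (ivar (sem c s) y + 1) (sem c s)) ^^ k) s) x = ivar s x" for k s
    by (induction k) (use For in \<open>simp_all add: ivar_iset\<close>)
  then show ?case using For.prems by (simp add: ivar_iset)
qed (auto simp: ivar_iset)

lemma mods_wf: "wf_cmd c \<Longrightarrow> x \<in> mods c \<Longrightarrow> 3 \<le> x"
  by (induction c) auto

section \<open>Correctness of compiled expressions\<close>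

lemma rel_reg:
  assumes "rel B s I R" "r < 2 \<or> 20 \<le> r \<and> r < 40"
  shows "rel B s (I(r := v)) R"
  using assms unfolding rel_def by auto

lemma rel_rreg:
  assumes "rel B s I R" "20 \<le> r \<and> r < 40"
  shows "rel B s I (R(r := v))"
  using assms unfolding rel_def by auto

lemma rel_ivar:
  assumes "rel B s I R" "x < 17"
  shows "rel B (iset x v s) (I(3 + x := v)) R"
  using assms unfolding rel_def iset_def by auto

lemma rel_rvar:
  assumes "rel B s I R" "x < 20"
  shows "rel B (s\<lparr>rvar := (rvar s)(x := v)\<rparr>) I (R(x := v))"
  using assms unfolding rel_def by auto

lemma interleave_eq: "a < 4 \<Longrightarrow> b < 4 \<Longrightarrow> B + 4 * i + a = B + 4 * j + (b::nat) \<longleftrightarrow> i = j \<and> a = b"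
proof
  assume a: "a < 4" "b < 4" and e: "B + 4 * i + a = B + 4 * j + b"
  then have "(a + 4 * i) div 4 = (b + 4 * j) div 4" by (simp add: ac_simps)
  with a have "i = j" by simp
  with e show "i = j \<and> a = b" by simp
qed simp

lemma rel_iarr:
  assumes "rel B s I R" "a < 4"
  shows "rel B (s\<lparr>iarr := (iarr s)(a := (iarr s a)(i := v))\<rparr>) (I(B + 4 * i + a := v)) R"
  using assms unfolding rel_def by (auto simp: interleave_eq)

lemma rel_rarr:
  assumes "rel B s I R" "a < 4"
  shows "rel B (s\<lparr>rarr := (rarr s)(a := (rarr s a)(i := v))\<rparr>) I (R(B + 4 * i + a := v))"
  using assms unfolding rel_def by (auto simp: interleave_eq)

lemma steps_address:
  assumes "code_at P p (address_code a d p)" "rel B s I R" "20 \<le> d" "d < 40"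
  shows "\<exists>I'. steps P (p, I, R) 8 (p + 8, I', R) \<and> rel B s I' R \<and>
    nat (I' 0) = B + 4 * nat (I d) + a \<and> (\<forall>r\<ge>2. I' r = I r)"
proof -
  let ?m = "int (nat (I d))"
  let ?J = "I(0 := ?m)"
  let ?K = "?J(0 := int (B + 4 * nat (I d) + a), 1 := int a)"
  have c: "code_at P (p + 3) [IAdd 0 0 0, IAdd 0 0 0, IConst 1 (int a), IAdd 0 0 1, IAdd 0 0 2]"
    using assms(1) by (simp add: address_code_def eval_nat_numeral)
  have I2: "I 2 = int B" using assms(2) by (simp add: rel_def)
  have "exec_block [IAdd 0 0 0, IAdd 0 0 0, IConst 1 (int a), IAdd 0 0 1, IAdd 0 0 2] (?J, R) = (?K, R)"
    using I2 by (auto simp: fun_eq_iff)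
  with steps_block[OF c, of ?J R] have s: "steps P (p + 3, ?J, R) 5 (p + 8, ?K, R)"
    by (simp add: eval_nat_numeral)
  have p: "p < length P" "Suc p < length P" "Suc (Suc p) < length P" "P ! p = IConst 0 0"
    "P ! Suc p = IJmpLe d 0 (p + 3)" "P ! Suc (Suc p) = IAdd 0 0 d"
    using assms(1) by (simp_all add: address_code_def)
  have t: "steps P (Suc (Suc p), I(0 := 0), R) 1 (p + 3, ?J, R)" if "0 < I d"
    using steps_instr[OF p(3,6), of "I(0 := 0)" R 0] that assms(3) by (simp add: steps_refl eval_nat_numeral)
  \<comment> \<open>For a nonpositive index the jump reaches \<open>p + 3\<close> with 0 in register
    0, which is the clamped index; otherwise one more addition is executed.\<close>
  have "steps P (Suc p, I(0 := 0), R) 2 (p + 3, ?J, R)"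
    using steps_instr[OF p(2,5), of "I(0 := 0)" R 1] t steps_refl assms(3)
    by (cases "0 < I d") (auto simp: steps_def[of _ _ 0] steps_def[of _ _ 1] eval_nat_numeral elim: steps_mono)
  then have "steps P (p, I, R) 3 (p + 3, ?J, R)"
    using steps_instr[OF p(1,4), of I R 2] by (simp add: eval_nat_numeral)
  from steps_trans[OF this s] have "steps P (p, I, R) 8 (p + 8, ?K, R)" by simp
  moreover have "rel B s ?K R" by (intro rel_reg assms) auto
  moreover have "nat (?K 0) = B + 4 * nat (I d) + a"
    by (simp del: of_nat_add of_nat_mult int_nat_eq)
  moreover have "\<forall>r\<ge>2. ?K r = I r" by simp
  ultimately show ?thesis by blast
qed


text \<open>The last conjunct protects the stack below \<open>d\<close>: a binary operation relies
  on it to keep its left operand at \<open>d\<close> while the right one is computed at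
  \<open>Suc d\<close>.\<close>

lemma steps_icode:
  assumes "code_at P p (icode e d p)" "rel B s I R" "20 \<le> d" "iwf d e"
  shows "\<exists>I'. steps P (p, I, R) (isize e) (p + isize e, I', R) \<and> rel B s I' R \<and>
    I' d = ieval e s \<and> (\<forall>r. 20 \<le> r \<and> r < d \<longrightarrow> I' r = I r)"
  using assms
proof (induction e arbitrary: d p I)
  case (IV x)
  let ?I = "I(0 := 0, d := ivar s x)"
  have "I (3 + x) = ivar s x" using IV.prems by (simp add: rel_def)
  then have "steps P (p, I, R) (isize (IV x)) (p + isize (IV x), ?I, R)"
    using steps_block[OF IV.prems(1), of I R] by (simp add: eval_nat_numeral)
  moreover have "rel B s ?I R"
    using IV.prems by (intro rel_reg) auto
  moreover have "?I d = ieval (IV x) s" "\<forall>r. 20 \<le> r \<and> r < d \<longrightarrow> ?I r = I r" by auto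
  ultimately show ?case by blast
next
  case (IC c)
  let ?I = "I(d := c)"
  have "steps P (p, I, R) (isize (IC c)) (p + isize (IC c), ?I, R)"
    using steps_block[OF IC.prems(1), of I R] by simp
  moreover have "rel B s ?I R"
    using IC.prems by (intro rel_reg) auto
  moreover have "?I d = ieval (IC c) s" "\<forall>r. 20 \<le> r \<and> r < d \<longrightarrow> ?I r = I r" by auto
  ultimately show ?case by blast
next
  case (IPlus e f)
  from IPlus.prems have c: "code_at P p (icode e d p)" "code_at P (p + isize e) (icode f (Suc d) (p + isize e))"
    "code_at P (p + isize e + isize f) [IAdd d d (Suc d)]" by (simp_all add: code_at_append add_ac)
  from IPlus.IH(1)[OF c(1) IPlus.prems(2,3)] IPlus.prems obtain I1 where 1:
    "steps P (p, I, R) (isize e) (p + isize e, I1, R)" "rel B s I1 R" "I1 d = ieval e s"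
    "\<forall>r. 20 \<le> r \<and> r < d \<longrightarrow> I1 r = I r" by auto
  from IPlus.IH(2)[OF c(2) 1(2)] IPlus.prems obtain I2 where 2:
    "steps P (p + isize e, I1, R) (isize f) (p + isize e + isize f, I2, R)" "rel B s I2 R" "I2 (Suc d) = ieval f s"
    "\<forall>r. 20 \<le> r \<and> r < Suc d \<longrightarrow> I2 r = I1 r" by auto
  let ?I = "I2(d := I2 d + I2 (Suc d))"
  have 3: "steps P (p + isize e + isize f, I2, R) 1 (p + isize e + isize f + 1, ?I, R)"
    using steps_block[OF c(3), of I2 R] by simp
  have "d < 40" using iwf_less[of d e] IPlus.prems by simp
  then have "rel B s ?I R" using 2(2) IPlus.prems by (intro rel_reg) auto
  moreover have "steps P (p, I, R) (isize (IPlus e f)) (p + isize (IPlus e f), ?I, R)"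
    using steps_trans[OF steps_trans[OF 1(1) 2(1)] 3] by (simp add: add_ac)
  moreover have "?I d = ieval (IPlus e f) s" "\<forall>r. 20 \<le> r \<and> r < d \<longrightarrow> ?I r = I r"
    using 1 2 IPlus.prems by auto
  ultimately show ?case by blast
next
  case (IMinus e f)
  from IMinus.prems have c: "code_at P p (icode e d p)" "code_at P (p + isize e) (icode f (Suc d) (p + isize e))"
    "code_at P (p + isize e + isize f) [ISub d d (Suc d)]" by (simp_all add: code_at_append add_ac)
  from IMinus.IH(1)[OF c(1) IMinus.prems(2,3)] IMinus.prems obtain I1 where 1:
    "steps P (p, I, R) (isize e) (p + isize e, I1, R)" "rel B s I1 R" "I1 d = ieval e s"
    "\<forall>r. 20 \<le> r \<and> r < d \<longrightarrow> I1 r = I r" by auto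
  from IMinus.IH(2)[OF c(2) 1(2)] IMinus.prems obtain I2 where 2:
    "steps P (p + isize e, I1, R) (isize f) (p + isize e + isize f, I2, R)" "rel B s I2 R" "I2 (Suc d) = ieval f s"
    "\<forall>r. 20 \<le> r \<and> r < Suc d \<longrightarrow> I2 r = I1 r" by auto
  let ?I = "I2(d := I2 d - I2 (Suc d))"
  have 3: "steps P (p + isize e + isize f, I2, R) 1 (p + isize e + isize f + 1, ?I, R)"
    using steps_block[OF c(3), of I2 R] by simp
  have "d < 40" using iwf_less[of d e] IMinus.prems by simp
  then have "rel B s ?I R" using 2(2) IMinus.prems by (intro rel_reg) auto
  moreover have "steps P (p, I, R) (isize (IMinus e f)) (p + isize (IMinus e f), ?I, R)"
    using steps_trans[OF steps_trans[OF 1(1) 2(1)] 3] by (simp add: add_ac)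
  moreover have "?I d = ieval (IMinus e f) s" "\<forall>r. 20 \<le> r \<and> r < d \<longrightarrow> ?I r = I r"
    using 1 2 IMinus.prems by auto
  ultimately show ?case by blast
next
  case (IArr a e)
  from IArr.prems have c: "code_at P p (icode e d p)" "code_at P (p + isize e) (address_code a d (p + isize e))"
    "code_at P (p + isize e + 8) [ILoad d 0]" by (simp_all add: code_at_append length_address_code add_ac)
  from IArr.IH[OF c(1) IArr.prems(2,3)] IArr.prems obtain I1 where 1:
    "steps P (p, I, R) (isize e) (p + isize e, I1, R)" "rel B s I1 R" "I1 d = ieval e s"
    "\<forall>r. 20 \<le> r \<and> r < d \<longrightarrow> I1 r = I r" by auto
  have d: "d < 40" "a < 4" using iwf_less[of d e] IArr.prems by simp_all
  from steps_address[OF c(2) 1(2)] d IArr.prems obtain I2 where 2: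
    "steps P (p + isize e, I1, R) 8 (p + isize e + 8, I2, R)" "rel B s I2 R"
    "nat (I2 0) = B + 4 * nat (I1 d) + a" "\<forall>r\<ge>2. I2 r = I1 r" by auto
  let ?I = "I2(d := I2 (nat (I2 0)))"
  have 3: "steps P (p + isize e + 8, I2, R) 1 (p + isize e + 8 + 1, ?I, R)"
    using steps_block[OF c(3), of I2 R] by simp
  have "rel B s ?I R" using d 2(2) IArr.prems by (intro rel_reg) auto
  moreover have "I2 (nat (I2 0)) = iarr s a (nat (ieval e s))"
    using 2(2) d(2) unfolding 2(3) 1(3) rel_def by blast
  moreover have "steps P (p, I, R) (isize (IArr a e)) (p + isize (IArr a e), ?I, R)"
    using steps_trans[OF steps_trans[OF 1(1) 2(1)] 3] by (simp add: add_ac)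
  moreover have "\<forall>r. 20 \<le> r \<and> r < d \<longrightarrow> ?I r = I r"
    using 1 2 IArr.prems by auto
  ultimately show ?case by fastforce
qed

text \<open>The four arithmetic operations differ only in their last instruction, abstracted here as
  \<open>F\<close>. The assumptions on \<open>e\<close> and \<open>f\<close> have the form of
  induction hypotheses; the integer bank is known only up to \<open>rel\<close>, since array indices
  inside the operands use it.\<close>

lemma steps_rcode_binary:
  assumes ce: "code_at P p (rcode e d p)" and cf: "code_at P (p + rsize e) (rcode f (Suc d) (p + rsize e))"
    and ci: "code_at P (p + rsize e + rsize f) [i]" and d: "20 \<le> d" "d < 40" "rel B s I R"
    and e: "\<And>p I R. code_at P p (rcode e d p) \<Longrightarrow> rel B s I R \<Longrightarrow>
      \<exists>I' R'. steps P (p, I, R) (rsize e) (p + rsize e, I', R') \<and> rel B s I' R' \<and>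
        R' d = reval e s \<and> (\<forall>r. 20 \<le> r \<and> r < d \<longrightarrow> R' r = R r)"
    and f: "\<And>p I R. code_at P p (rcode f (Suc d) p) \<Longrightarrow> rel B s I R \<Longrightarrow>
      \<exists>I' R'. steps P (p, I, R) (rsize f) (p + rsize f, I', R') \<and> rel B s I' R' \<and>
        R' (Suc d) = reval f s \<and> (\<forall>r. 20 \<le> r \<and> r < Suc d \<longrightarrow> R' r = R r)"
    and i: "straight i" "\<And>I R. snd (exec_instr i (0, I, R)) = (I, R(d := F (R d) (R (Suc d))))"
  shows "\<exists>I' R'. steps P (p, I, R) (rsize e + rsize f + 1) (p + (rsize e + rsize f + 1), I', R') \<and> rel B s I' R' \<and>
    R' d = F (reval e s) (reval f s) \<and> (\<forall>r. 20 \<le> r \<and> r < d \<longrightarrow> R' r = R r)"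
proof -
  from e[OF ce d(3)] obtain I1 R1 where 1:
    "steps P (p, I, R) (rsize e) (p + rsize e, I1, R1)" "rel B s I1 R1" "R1 d = reval e s"
    "\<forall>r. 20 \<le> r \<and> r < d \<longrightarrow> R1 r = R r" by auto
  from f[OF cf 1(2)] obtain I2 R2 where 2:
    "steps P (p + rsize e, I1, R1) (rsize f) (p + rsize e + rsize f, I2, R2)" "rel B s I2 R2" "R2 (Suc d) = reval f s"
    "\<forall>r. 20 \<le> r \<and> r < Suc d \<longrightarrow> R2 r = R1 r" by auto
  let ?R = "R2(d := F (R2 d) (R2 (Suc d)))"
  have 3: "steps P (p + rsize e + rsize f, I2, R2) 1 (p + rsize e + rsize f + 1, I2, ?R)"
    using steps_block[OF ci, of I2 R2] i by simp
  have "rel B s I2 ?R" using 2(2) d by (intro rel_rreg) auto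
  moreover have "steps P (p, I, R) (rsize e + rsize f + 1) (p + (rsize e + rsize f + 1), I2, ?R)"
    using steps_trans[OF steps_trans[OF 1(1) 2(1)] 3] by (simp add: add_ac)
  moreover have "?R d = F (reval e s) (reval f s)" "\<forall>r. 20 \<le> r \<and> r < d \<longrightarrow> ?R r = R r"
    using 1 2 d by auto
  ultimately show ?thesis by blast
qed

lemma steps_rcode:
  assumes "code_at P p (rcode e d p)" "rel B s I R" "20 \<le> d" "rwf d e"
  shows "\<exists>I' R'. steps P (p, I, R) (rsize e) (p + rsize e, I', R') \<and> rel B s I' R' \<and>
    R' d = reval e s \<and> (\<forall>r. 20 \<le> r \<and> r < d \<longrightarrow> R' r = R r)"
  using assms
proof (induction e arbitrary: d p I R)
  case (RV x)
  let ?R = "R(d := rvar s x)"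
  have "R x = rvar s x" "x \<noteq> d" using RV.prems by (simp_all add: rel_def)
  then have "steps P (p, I, R) (rsize (RV x)) (p + rsize (RV x), I, ?R)"
    using steps_block[OF RV.prems(1), of I R] by (simp add: eval_nat_numeral)
  moreover have "rel B s I ?R"
    using RV.prems by (intro rel_rreg) auto
  moreover have "?R d = reval (RV x) s" "\<forall>r. 20 \<le> r \<and> r < d \<longrightarrow> ?R r = R r" by auto
  ultimately show ?case by blast
next
  case (RC c)
  let ?R = "R(d := c)"
  have "steps P (p, I, R) (rsize (RC c)) (p + rsize (RC c), I, ?R)"
    using steps_block[OF RC.prems(1), of I R] by simp
  moreover have "rel B s I ?R"
    using RC.prems by (intro rel_rreg) auto
  moreover have "?R d = reval (RC c) s" "\<forall>r. 20 \<le> r \<and> r < d \<longrightarrow> ?R r = R r" by auto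
  ultimately show ?case by blast
next
  case (RPlus e f)
  from RPlus.prems rwf_less[of d e] show ?case unfolding rsize.simps reval.simps
    by (intro steps_rcode_binary[where F = "(+)" and i = "RAdd d d (Suc d)"] RPlus.IH) (auto simp: code_at_append add_ac)
next
  case (RMinus e f)
  from RMinus.prems rwf_less[of d e] show ?case unfolding rsize.simps reval.simps
    by (intro steps_rcode_binary[where F = "(-)" and i = "RSub d d (Suc d)"] RMinus.IH) (auto simp: code_at_append add_ac)
next
  case (RTimes e f)
  from RTimes.prems rwf_less[of d e] show ?case unfolding rsize.simps reval.simps
    by (intro steps_rcode_binary[where F = "(*)" and i = "RMul d d (Suc d)"] RTimes.IH) (auto simp: code_at_append add_ac)
next
  case (RDivide e f)
  from RDivide.prems rwf_less[of d e] show ?case unfolding rsize.simps reval.simps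
    by (intro steps_rcode_binary[where F = "(/)" and i = "RDiv d d (Suc d)"] RDivide.IH) (auto simp: code_at_append add_ac)
next
  case (RRoot e)
  from RRoot.prems have c: "code_at P p (rcode e d p)" "code_at P (p + rsize e) [RSqrt d d]"
    by (simp_all add: code_at_append)
  from RRoot.IH[OF c(1) RRoot.prems(2,3)] RRoot.prems obtain I1 R1 where 1:
    "steps P (p, I, R) (rsize e) (p + rsize e, I1, R1)" "rel B s I1 R1" "R1 d = reval e s"
    "\<forall>r. 20 \<le> r \<and> r < d \<longrightarrow> R1 r = R r" by auto
  let ?R = "R1(d := sqrt (R1 d))"
  have 3: "steps P (p + rsize e, I1, R1) 1 (p + rsize e + 1, I1, ?R)"
    using steps_block[OF c(2), of I1 R1] by simp
  have "rel B s I1 ?R" using 1(2) RRoot.prems rwf_less[of d e] by (intro rel_rreg) auto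
  moreover have "steps P (p, I, R) (rsize (RRoot e)) (p + rsize (RRoot e), I1, ?R)"
    using steps_trans[OF 1(1) 3] by simp
  moreover have "?R d = reval (RRoot e) s" "\<forall>r. 20 \<le> r \<and> r < d \<longrightarrow> ?R r = R r"
    using 1 by auto
  ultimately show ?case by blast
next
  case (RArr a e)
  from RArr.prems have c: "code_at P p (icode e 20 p)" "code_at P (p + isize e) (address_code a 20 (p + isize e))"
    "code_at P (p + isize e + 8) [RLoad d 0]" by (simp_all add: code_at_append length_address_code add_ac)
  from steps_icode[OF c(1) RArr.prems(2)] RArr.prems obtain I1 where 1:
    "steps P (p, I, R) (isize e) (p + isize e, I1, R)" "rel B s I1 R" "I1 20 = ieval e s" by auto
  from steps_address[OF c(2) 1(2)] RArr.prems obtain I2 where 2: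
    "steps P (p + isize e, I1, R) 8 (p + isize e + 8, I2, R)" "rel B s I2 R"
    "nat (I2 0) = B + 4 * nat (I1 20) + a" by auto
  let ?R = "R(d := R (nat (I2 0)))"
  have 3: "steps P (p + isize e + 8, I2, R) 1 (p + isize e + 8 + 1, I2, ?R)"
    using steps_block[OF c(3), of I2 R] by simp
  have "rel B s I2 ?R" using 2(2) RArr.prems by (intro rel_rreg) auto
  moreover have "R (nat (I2 0)) = rarr s a (nat (ieval e s))"
    using 2(2) RArr.prems unfolding 2(3) 1(3) rel_def by simp
  moreover have "steps P (p, I, R) (rsize (RArr a e)) (p + rsize (RArr a e), I2, ?R)"
    using steps_trans[OF steps_trans[OF 1(1) 2(1)] 3] by (simp add: add_ac)
  moreover have "\<forall>r. 20 \<le> r \<and> r < d \<longrightarrow> ?R r = R r" by auto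
  ultimately show ?case by fastforce
qed


section \<open>Correctness and running time of compiled commands\<close>

lemma steps_icode_pair:
  assumes "code_at P p (icode e 20 p)" "code_at P (p + isize e) (icode f 21 (p + isize e))"
    "rel B s I R" "iwf 20 e" "iwf 21 f"
  shows "\<exists>I'. steps P (p, I, R) (isize e + isize f) (p + isize e + isize f, I', R) \<and> rel B s I' R \<and>
    I' 20 = ieval e s \<and> I' 21 = ieval f s"
proof -
  from steps_icode[OF assms(1,3)] assms obtain I1 where 1:
    "steps P (p, I, R) (isize e) (p + isize e, I1, R)" "rel B s I1 R" "I1 20 = ieval e s" by auto
  from steps_icode[OF assms(2) 1(2)] assms obtain I2 where 2:
    "steps P (p + isize e, I1, R) (isize f) (p + isize e + isize f, I2, R)" "rel B s I2 R"
    "I2 21 = ieval f s" "I2 20 = I1 20" by auto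
  from steps_trans[OF 1(1) 2(1)] 1 2 show ?thesis by auto
qed

lemma steps_rcode_pair:
  assumes "code_at P p (rcode e 20 p)" "code_at P (p + rsize e) (rcode f 21 (p + rsize e))"
    "rel B s I R" "rwf 20 e" "rwf 21 f"
  shows "\<exists>I' R'. steps P (p, I, R) (rsize e + rsize f) (p + rsize e + rsize f, I', R') \<and> rel B s I' R' \<and>
    R' 20 = reval e s \<and> R' 21 = reval f s"
proof -
  from steps_rcode[OF assms(1,3)] assms obtain I1 R1 where 1:
    "steps P (p, I, R) (rsize e) (p + rsize e, I1, R1)" "rel B s I1 R1" "R1 20 = reval e s" by auto
  from steps_rcode[OF assms(2) 1(2)] assms obtain I2 R2 where 2:
    "steps P (p + rsize e, I1, R1) (rsize f) (p + rsize e + rsize f, I2, R2)" "rel B s I2 R2"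
    "R2 21 = reval f s" "R2 20 = R1 20" by auto
  from steps_trans[OF 1(1) 2(1)] 1 2 show ?thesis by auto
qed

text \<open>Only the effect of the test instruction enters, so integer and real conditionals share
  this argument. The bound adds the costs of both branches, which makes it independent of the
  outcome.\<close>

lemma steps_branch:
  assumes j: "q < length P" "P ! q = i" "i \<noteq> Halt"
      "exec_instr i (q, I, R) = (if b then q + csize d + 2 else Suc q, I, R)"
    and d: "code_at P (q + 1) (code d (q + 1))"
    and j': "code_at P (q + 1 + csize d) [Jmp (q + csize d + 2 + csize c)]"
    and c: "code_at P (q + csize d + 2) (code c (q + csize d + 2))"
    and exc: "b \<Longrightarrow> \<exists>I' R'. steps P (q + csize d + 2, I, R) Tc (q + csize d + 2 + csize c, I', R') \<and> rel B s' I' R'"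
    and exd: "\<not> b \<Longrightarrow> \<exists>I' R'. steps P (q + 1, I, R) Td (q + 1 + csize d, I', R') \<and> rel B s' I' R'"
  shows "\<exists>I' R'. steps P (q, I, R) (Tc + Td + 2) (q + csize d + 2 + csize c, I', R') \<and> rel B s' I' R'"
proof (cases b)
  case True
  from exc[OF True] obtain I' R' where
    *: "steps P (q + csize d + 2, I, R) Tc (q + csize d + 2 + csize c, I', R')" "rel B s' I' R'" by blast
  have "steps P (q, I, R) (Suc Tc) (q + csize d + 2 + csize c, I', R')"
    using j True * by (intro steps_instr[where c = i]) auto
  then have "steps P (q, I, R) (Tc + Td + 2) (q + csize d + 2 + csize c, I', R')"
    by (rule steps_mono) simp
  then show ?thesis using *(2) by blast
next
  case False
  from exd[OF False] obtain I' R' where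
    *: "steps P (q + 1, I, R) Td (q + 1 + csize d, I', R')" "rel B s' I' R'" by blast
  have 1: "steps P (q, I, R) (Suc Td) (q + 1 + csize d, I', R')"
    using j False * by (intro steps_instr[where c = i]) auto
  have "steps P (q + 1 + csize d, I', R') (Suc 0) (q + csize d + 2 + csize c, I', R')"
    using j' by (intro steps_instr[where c = "Jmp (q + csize d + 2 + csize c)"]) (auto simp: steps_refl)
  from steps_trans[OF 1 this]
  have "steps P (q, I, R) (Tc + Td + 2) (q + csize d + 2 + csize c, I', R')"
    by (rule steps_mono) simp
  then show ?thesis using *(2) by blast
qed

lemma le_mult_Suc_power: "k \<le> k * Suc D ^ e"
  by simp

text \<open>All loop limits are read-only variables with values at most \<open>D\<close>, so the
  bound persists through the execution and every level of nesting costs at most one factor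
  \<open>Suc D\<close>.\<close>

theorem steps_code:
  assumes "code_at P p (code c p)" "rel B s I R" "wf_cmd c" "\<forall>l<3. ivar s l \<le> int D"
  shows "\<exists>I' R'. steps P (p, I, R) (time c * Suc D ^ depth c) (p + csize c, I', R') \<and> rel B (sem c s) I' R'"
  using assms
proof (induction c arbitrary: p s I R)
  case Skip
  then show ?case by (auto intro: steps_refl)
next
  case (IAsg x e)
  then have c: "code_at P p (icode e 20 p)" "code_at P (p + isize e) [IConst 0 0, IAdd (3 + x) 20 0]"
    by (auto simp: code_at_append)
  from steps_icode[OF c(1) IAsg.prems(2)] IAsg.prems obtain I1 where 1:
    "steps P (p, I, R) (isize e) (p + isize e, I1, R)" "rel B s I1 R" "I1 20 = ieval e s" by auto
  let ?I = "I1(0 := 0, 3 + x := ieval e s)"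
  have 2: "steps P (p + isize e, I1, R) 2 (p + isize e + 2, ?I, R)"
    using steps_block[OF c(2), of I1 R] 1(3) by (simp add: eval_nat_numeral)
  have "rel B (iset x (ieval e s) s) ?I R"
    using IAsg.prems 1 by (intro rel_ivar rel_reg) auto
  moreover have "steps P (p, I, R) (time (IAsg x e) * Suc D ^ depth (IAsg x e)) (p + csize (IAsg x e), ?I, R)"
    using steps_trans[OF 1(1) 2] by (simp add: add_ac)
  ultimately show ?case by auto
next
  case (RAsg x e)
  then have c: "code_at P p (rcode e 20 p)" "code_at P (p + rsize e) [RConst 21 0, RAdd x 20 21]"
    by (auto simp: code_at_append)
  from steps_rcode[OF c(1) RAsg.prems(2)] RAsg.prems obtain I1 R1 where 1:
    "steps P (p, I, R) (rsize e) (p + rsize e, I1, R1)" "rel B s I1 R1" "R1 20 = reval e s" by auto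
  let ?R = "R1(21 := 0, x := reval e s)"
  have 2: "steps P (p + rsize e, I1, R1) 2 (p + rsize e + 2, I1, ?R)"
    using steps_block[OF c(2), of I1 R1] 1(3) by (simp add: eval_nat_numeral)
  have "rel B (sem (RAsg x e) s) I1 ?R" unfolding sem.simps
    using RAsg.prems 1 by (intro rel_rvar rel_rreg) auto
  moreover have "steps P (p, I, R) (time (RAsg x e) * Suc D ^ depth (RAsg x e)) (p + csize (RAsg x e), I1, ?R)"
    using steps_trans[OF 1(1) 2] by (simp add: add_ac)
  ultimately show ?case by auto
next
  case (ISet a e f)
  then have c: "code_at P p (icode e 20 p)" "code_at P (p + isize e) (icode f 21 (p + isize e))"
    "code_at P (p + isize e + isize f) (address_code a 20 (p + isize e + isize f))"
    "code_at P (p + isize e + isize f + 8) [IStore 0 21]"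
    by (auto simp: code_at_append length_address_code add_ac)
  from steps_icode_pair[OF c(1,2) ISet.prems(2)] ISet.prems obtain I1 where 1:
    "steps P (p, I, R) (isize e + isize f) (p + isize e + isize f, I1, R)" "rel B s I1 R"
    "I1 20 = ieval e s" "I1 21 = ieval f s" by auto
  from steps_address[OF c(3) 1(2)] obtain I2 where 2:
    "steps P (p + isize e + isize f, I1, R) 8 (p + isize e + isize f + 8, I2, R)" "rel B s I2 R"
    "nat (I2 0) = B + 4 * nat (ieval e s) + a" "I2 21 = ieval f s" using 1 by auto
  let ?I = "I2(B + 4 * nat (ieval e s) + a := ieval f s)"
  have 3: "steps P (p + isize e + isize f + 8, I2, R) 1 (p + isize e + isize f + 8 + 1, ?I, R)"
    using steps_block[OF c(4), of I2 R] 2 by simp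
  have "rel B (sem (ISet a e f) s) ?I R" unfolding sem.simps
    using ISet.prems 2 by (intro rel_iarr) auto
  moreover have "steps P (p, I, R) (time (ISet a e f) * Suc D ^ depth (ISet a e f)) (p + csize (ISet a e f), ?I, R)"
    using steps_trans[OF steps_trans[OF 1(1) 2(1)] 3] by (simp add: add_ac)
  ultimately show ?case by blast
next
  case (RSet a e f)
  then have c: "code_at P p (rcode f 20 p)" "code_at P (p + rsize f) (icode e 20 (p + rsize f))"
    "code_at P (p + rsize f + isize e) (address_code a 20 (p + rsize f + isize e))"
    "code_at P (p + rsize f + isize e + 8) [RStore 0 20]"
    by (auto simp: code_at_append length_address_code add_ac)
  from steps_rcode[OF c(1) RSet.prems(2)] RSet.prems obtain I0 R0 where 0:
    "steps P (p, I, R) (rsize f) (p + rsize f, I0, R0)" "rel B s I0 R0" "R0 20 = reval f s" by auto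
  from steps_icode[OF c(2) 0(2)] RSet.prems obtain I1 where 1:
    "steps P (p + rsize f, I0, R0) (isize e) (p + rsize f + isize e, I1, R0)" "rel B s I1 R0"
    "I1 20 = ieval e s" by auto
  from steps_address[OF c(3) 1(2)] obtain I2 where 2:
    "steps P (p + rsize f + isize e, I1, R0) 8 (p + rsize f + isize e + 8, I2, R0)" "rel B s I2 R0"
    "nat (I2 0) = B + 4 * nat (ieval e s) + a" using 1 by auto
  let ?R = "R0(B + 4 * nat (ieval e s) + a := reval f s)"
  have 3: "steps P (p + rsize f + isize e + 8, I2, R0) 1 (p + rsize f + isize e + 8 + 1, I2, ?R)"
    using steps_block[OF c(4), of I2 R0] 2 0(3) by simp
  have "rel B (sem (RSet a e f) s) I2 ?R" unfolding sem.simps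
    using RSet.prems 2 by (intro rel_rarr) auto
  moreover have "steps P (p, I, R) (time (RSet a e f) * Suc D ^ depth (RSet a e f)) (p + csize (RSet a e f), I2, ?R)"
    using steps_trans[OF steps_trans[OF steps_trans[OF 0(1) 1(1)] 2(1)] 3] by (simp add: add_ac)
  ultimately show ?case by blast
next
  case (Seq c d)
  then have cd: "code_at P p (code c p)" "code_at P (p + csize c) (code d (p + csize c))"
    by (auto simp: code_at_append)
  from Seq.IH(1)[OF cd(1) Seq.prems(2)] Seq.prems obtain I1 R1 where 1:
    "steps P (p, I, R) (time c * Suc D ^ depth c) (p + csize c, I1, R1)" "rel B (sem c s) I1 R1" by auto
  have "\<forall>l<3. ivar (sem c s) l \<le> int D"
    using Seq.prems mods_wf[of c] ivar_sem[of _ c s] by (metis not_le wf_cmd.simps(6))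
  from Seq.IH(2)[OF cd(2) 1(2) _ this] Seq.prems obtain I2 R2 where 2:
    "steps P (p + csize c, I1, R1) (time d * Suc D ^ depth d) (p + csize c + csize d, I2, R2)"
    "rel B (sem d (sem c s)) I2 R2" by auto
  have "time c * Suc D ^ depth c + time d * Suc D ^ depth d \<le> time (Seq c d) * Suc D ^ depth (Seq c d)"
    unfolding time.simps depth.simps add_mult_distrib
    by (intro add_mono mult_le_mono2 power_increasing) auto
  with steps_mono[OF steps_trans[OF 1(1) 2(1)] this] 2(2) show ?case by (auto simp: add_ac)
next
  case (IfI e f c d)
  let ?q = "p + isize e + isize f"
  from IfI.prems(1) have k: "code_at P p (icode e 20 p)" "code_at P (p + isize e) (icode f 21 (p + isize e))"
    "code_at P ?q [IJmpLe 20 21 (?q + csize d + 2)]" "code_at P (?q + 1) (code d (?q + 1))"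
    "code_at P (?q + 1 + csize d) [Jmp (?q + csize d + 2 + csize c)]"
    "code_at P (?q + csize d + 2) (code c (?q + csize d + 2))"
    by (simp_all add: code_at_append Let_def add_ac)
  from steps_icode_pair[OF k(1,2) IfI.prems(2)] IfI.prems obtain I1 where 1:
    "steps P (p, I, R) (isize e + isize f) (p + isize e + isize f, I1, R)" "rel B s I1 R"
    "I1 20 = ieval e s" "I1 21 = ieval f s" by auto
  have "\<exists>I' R'. steps P (?q, I1, R) (time c * Suc D ^ depth c + time d * Suc D ^ depth d + 2)
      (?q + csize d + 2 + csize c, I', R') \<and> rel B (sem (IfI e f c d) s) I' R'"
  proof (rule steps_branch[where b = "ieval e s \<le> ieval f s", OF _ _ _ _ k(4-6)])
    show "?q < length P" "P ! ?q = IJmpLe 20 21 (?q + csize d + 2)" using k(3) by auto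
  qed (use IfI.IH(1)[OF k(6) 1(2)] IfI.IH(2)[OF k(4) 1(2)] IfI.prems 1 in auto)
  then obtain I' R' where 2: "steps P (?q, I1, R) (time c * Suc D ^ depth c + time d * Suc D ^ depth d + 2)
      (?q + csize d + 2 + csize c, I', R')" "rel B (sem (IfI e f c d) s) I' R'" by blast
  have "time c * Suc D ^ depth c + time d * Suc D ^ depth d \<le> (time c + time d) * Suc D ^ depth (IfI e f c d)"
    unfolding depth.simps add_mult_distrib
    by (intro add_mono mult_le_mono2 power_increasing) auto
  moreover have "isize e + isize f + 2 \<le> (isize e + isize f + 2) * Suc D ^ depth (IfI e f c d)"
    by (rule le_mult_Suc_power)
  ultimately have "isize e + isize f + (time c * Suc D ^ depth c + time d * Suc D ^ depth d + 2) \<le>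
      (isize e + isize f + 2) * Suc D ^ depth (IfI e f c d) + (time c + time d) * Suc D ^ depth (IfI e f c d)"
    by linarith
  also have "\<dots> = time (IfI e f c d) * Suc D ^ depth (IfI e f c d)"
    unfolding add_mult_distrib[symmetric] by (simp add: add_ac)
  finally show ?case using steps_mono[OF steps_trans[OF 1(1) 2(1)]] 2(2)
    by (intro exI[of _ I'] exI[of _ R']) (simp add: add_ac)
next
  case (IfR e f c d)
  let ?q = "p + rsize e + rsize f"
  from IfR.prems(1) have k: "code_at P p (rcode e 20 p)" "code_at P (p + rsize e) (rcode f 21 (p + rsize e))"
    "code_at P ?q [RJmpLe 20 21 (?q + csize d + 2)]" "code_at P (?q + 1) (code d (?q + 1))"
    "code_at P (?q + 1 + csize d) [Jmp (?q + csize d + 2 + csize c)]"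
    "code_at P (?q + csize d + 2) (code c (?q + csize d + 2))"
    by (simp_all add: code_at_append Let_def add_ac)
  from steps_rcode_pair[OF k(1,2) IfR.prems(2)] IfR.prems obtain I1 R1 where 1:
    "steps P (p, I, R) (rsize e + rsize f) (p + rsize e + rsize f, I1, R1)" "rel B s I1 R1"
    "R1 20 = reval e s" "R1 21 = reval f s" by auto
  have "\<exists>I' R'. steps P (?q, I1, R1) (time c * Suc D ^ depth c + time d * Suc D ^ depth d + 2)
      (?q + csize d + 2 + csize c, I', R') \<and> rel B (sem (IfR e f c d) s) I' R'"
  proof (rule steps_branch[where b = "reval e s \<le> reval f s", OF _ _ _ _ k(4-6)])
    show "?q < length P" "P ! ?q = RJmpLe 20 21 (?q + csize d + 2)" using k(3) by auto
  qed (use IfR.IH(1)[OF k(6) 1(2)] IfR.IH(2)[OF k(4) 1(2)] IfR.prems 1 in auto)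
  then obtain I' R' where 2: "steps P (?q, I1, R1) (time c * Suc D ^ depth c + time d * Suc D ^ depth d + 2)
      (?q + csize d + 2 + csize c, I', R')" "rel B (sem (IfR e f c d) s) I' R'" by blast
  have "time c * Suc D ^ depth c + time d * Suc D ^ depth d \<le> (time c + time d) * Suc D ^ depth (IfR e f c d)"
    unfolding depth.simps add_mult_distrib
    by (intro add_mono mult_le_mono2 power_increasing) auto
  moreover have "rsize e + rsize f + 2 \<le> (rsize e + rsize f + 2) * Suc D ^ depth (IfR e f c d)"
    by (rule le_mult_Suc_power)
  ultimately have "rsize e + rsize f + (time c * Suc D ^ depth c + time d * Suc D ^ depth d + 2) \<le>
      (rsize e + rsize f + 2) * Suc D ^ depth (IfR e f c d) + (time c + time d) * Suc D ^ depth (IfR e f c d)"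
    by linarith
  also have "\<dots> = time (IfR e f c d) * Suc D ^ depth (IfR e f c d)"
    unfolding add_mult_distrib[symmetric] by (simp add: add_ac)
  finally show ?case using steps_mono[OF steps_trans[OF 1(1) 2(1)]] 2(2)
    by (intro exI[of _ I'] exI[of _ R']) (simp add: add_ac)
next
  case (For x l c)
  let ?T = "time c * Suc D ^ depth c" and ?e = "p + 5 + csize c"
  let ?F = "\<lambda>s. iset x (ivar (sem c s) x + 1) (sem c s)"
  have w: "wf_cmd c" "3 \<le> x" "x < 17" "l < 3" "x \<notin> mods c" using For.prems by auto
  from For.prems(1) have k: "code_at P p [IConst (3 + x) 0]"
    "p + 1 < length P" "P ! (p + 1) = IJmpLe (3 + l) (3 + x) ?e"
    "code_at P (p + 2) (code c (p + 2))"
    "code_at P (p + 2 + csize c) [IConst 0 1, IAdd (3 + x) (3 + x) 0]"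
    "p + 4 + csize c < length P" "P ! (p + 4 + csize c) = Jmp (p + 1)"
    by (auto simp: code_at_append add_ac eval_nat_numeral)
  \<comment> \<open>Generalised to an arbitrary counter value, with \<open>k\<close> rounds
    remaining. Besides the body a round takes four steps: the test, two for the increment, and the
    jump back. The final 1 is the test that leaves the loop.\<close>
  have loop: "\<exists>I' R'. steps P (p + 1, I, R) (k * (?T + 4) + 1) (?e, I', R') \<and> rel B ((?F ^^ k) s) I' R'"
    if "rel B s I R" "k = nat (ivar s l - ivar s x)" "\<forall>l<3. ivar s l \<le> int D" for k s I R
    using that
  proof (induction k arbitrary: s I R)
    case 0
    then have "I (3 + l) \<le> I (3 + x)" using w by (simp add: rel_def)
    then have "steps P (p + 1, I, R) (Suc 0) (?e, I, R)"
      using k by (intro steps_instr[where c = "IJmpLe (3 + l) (3 + x) ?e"]) (auto simp: steps_refl)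
    then show ?case using 0 by auto
  next
    case (Suc k)
    have "\<not> I (3 + l) \<le> I (3 + x)" using w Suc.prems by (simp add: rel_def)
    then have 1: "steps P (p + 1, I, R) 1 (p + 2, I, R)"
      using steps_instr[OF k(2,3), of I R 0] by (simp add: steps_refl)
    from For.IH[OF k(4) Suc.prems(1) w(1) Suc.prems(3)] obtain I1 R1 where
      2: "steps P (p + 2, I, R) ?T (p + 2 + csize c, I1, R1)" "rel B (sem c s) I1 R1" by blast
    let ?I = "I1(0 := 1, 3 + x := ivar (sem c s) x + 1)"
    have "I1 (3 + x) = ivar (sem c s) x" using 2 w by (simp add: rel_def)
    then have 3: "steps P (p + 2 + csize c, I1, R1) 2 (p + 4 + csize c, ?I, R1)"
      using steps_block[OF k(5), of I1 R1] by (simp add: eval_nat_numeral)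
    have 4: "steps P (p + 4 + csize c, ?I, R1) 1 (p + 1, ?I, R1)"
      using steps_instr[OF k(6,7), of ?I R1 0] by (simp add: steps_refl)
    have r: "rel B (?F s) ?I R1" using 2 w by (intro rel_ivar rel_reg) auto
    have ro: "ivar (?F s) l' = ivar s l'" if "l' < 3" for l'
      using that w mods_wf[OF w(1), of l'] ivar_sem[of l' c s] by (auto simp: ivar_iset)
    have "ivar (?F s) x = ivar s x + 1"
      using ivar_sem[OF w(5)] by (simp add: ivar_iset)
    then have "k = nat (ivar (?F s) l - ivar (?F s) x)"
      using Suc.prems(2) ro[OF w(4)] by simp
    moreover have "\<forall>l<3. ivar (?F s) l \<le> int D" using ro Suc.prems(3) by simp
    ultimately obtain I' R' where
      5: "steps P (p + 1, ?I, R1) (k * (?T + 4) + 1) (?e, I', R')" "rel B ((?F ^^ k) (?F s)) I' R'"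
      using Suc.IH[OF r] by blast
    have "steps P (p + 1, I, R) (Suc k * (?T + 4) + 1) (?e, I', R')"
      using steps_trans[OF steps_trans[OF steps_trans[OF steps_trans[OF 1 2(1)] 3] 4] 5(1)] by (rule steps_mono) simp
    moreover have "rel B ((?F ^^ Suc k) s) I' R'" using 5(2) unfolding funpow_Suc_right o_apply .
    ultimately show ?case by blast
  qed
  have 1: "steps P (p, I, R) 1 (p + 1, I(3 + x := 0), R)"
    using steps_block[OF k(1), of I R] by simp
  have "nat (ivar s l) = nat (ivar (iset x 0 s) l - ivar (iset x 0 s) x)"
    using w by (auto simp: ivar_iset)
  moreover have "\<forall>l<3. ivar (iset x 0 s) l \<le> int D" using For.prems(4) w(2) by (simp add: ivar_iset)
  ultimately obtain I' R' where
    2: "steps P (p + 1, I(3 + x := 0), R) (nat (ivar s l) * (?T + 4) + 1) (?e, I', R')"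
      "rel B ((?F ^^ nat (ivar s l)) (iset x 0 s)) I' R'"
    using loop[OF rel_ivar[OF For.prems(2) w(3)]] by blast
  have "nat (ivar s l) \<le> D" using For.prems(4) w(4) by auto
  then have "1 + (nat (ivar s l) * (?T + 4) + 1) \<le> 1 + (D * (?T + 4) + 1)" by simp
  also have "\<dots> \<le> Suc D * ?T + 6 * Suc D" by (simp add: algebra_simps)
  also have "\<dots> \<le> Suc D * ?T + 6 * (Suc D * Suc D ^ depth c)"
    using le_mult_Suc_power[of "6 * Suc D" D "depth c"] by (simp only: mult.assoc add_le_cancel_left)
  also have "\<dots> = time (For x l c) * Suc D ^ depth (For x l c)" by (simp add: algebra_simps)
  finally have "steps P (p, I, R) (time (For x l c) * Suc D ^ depth (For x l c)) (p + csize (For x l c), I', R')"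
    using steps_mono[OF steps_trans[OF 1 2(1)]] by (simp add: add_ac)
  then show ?case using 2(2) by auto
qed

section \<open>Relocating the input and delivering the output\<close>

text \<open>One loop serves both directions: \<open>j\<close> advances by 1 and \<open>k\<close> by
  4, and \<open>x\<close>, \<open>y\<close> say which of them points to the source and which to the
  target. Real register 0 is the buffer and must be neither; disjointness of sources and targets
  makes every source intact when it is read.\<close>

lemma steps_copy_real:
  fixes src dst :: "nat \<Rightarrow> nat"
  assumes "code_at P q [IJmpLe l j (q + 6), RLoad 0 x, RStore y 0, IAdd j j u, IAdd k k v, Jmp q]"
    and "distinct [j, k, l, u, v]"
    and xy: "\<And>I i. I j = int i \<Longrightarrow> I k = int (c + 4 * i) \<Longrightarrow> nat (I x) = src i \<and> nat (I y) = dst i"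
    and sd: "\<And>t t'. i \<le> t \<Longrightarrow> t < L \<Longrightarrow> i \<le> t' \<Longrightarrow> t' < L \<Longrightarrow> src t \<noteq> dst t' \<and> src t \<noteq> 0 \<and> dst t \<noteq> 0"
    and inj: "inj dst"
    and "I j = int i" "I k = int (c + 4 * i)" "I l = int L" "I u = 1" "I v = 4"
  shows "\<exists>I' R'. steps P (q, I, R) ((L - i) * 6 + 1) (q + 6, I', R') \<and>
    (\<forall>r. r \<noteq> j \<longrightarrow> r \<noteq> k \<longrightarrow> I' r = I r) \<and>
    (\<forall>t. i \<le> t \<longrightarrow> t < L \<longrightarrow> R' (dst t) = R (src t)) \<and>
    (\<forall>a. a \<noteq> 0 \<longrightarrow> (\<forall>t. i \<le> t \<longrightarrow> t < L \<longrightarrow> a \<noteq> dst t) \<longrightarrow> R' a = R a)"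
  using assms(4,6-)
proof (induction "L - i" arbitrary: i I R)
  case 0
  then have "steps P (q, I, R) (Suc 0) (q + 6, I, R)"
    using assms(1) by (intro steps_instr[where c = "IJmpLe l j (q + 6)"]) (auto simp: steps_refl)
  then show ?case using 0 by (intro exI[of _ I] exI[of _ R]) simp
next
  case (Suc w)
  have c: "q < length P" "P ! q = IJmpLe l j (q + 6)"
    "code_at P (q + 1) [RLoad 0 x, RStore y 0, IAdd j j u, IAdd k k v]"
    "q + 5 < length P" "P ! (q + 5) = Jmp q"
    using assms(1) by (auto simp: eval_nat_numeral)
  let ?I = "I(j := int (Suc i), k := int (c + 4 * Suc i))"
  let ?R = "R(0 := R (src i), dst i := R (src i))"
  have iL: "i < L" using Suc.hyps(2) by simp
  have 1: "steps P (q, I, R) 1 (q + 1, I, R)"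
    using steps_instr[OF c(1,2), of I R 0] iL Suc.prems by (simp add: steps_refl)
  have "exec_block [RLoad 0 x, RStore y 0, IAdd j j u, IAdd k k v] (I, R) = (?I, ?R)"
    using xy[of I i] Suc.prems assms(2) by (auto simp: fun_eq_iff)
  with steps_block[OF c(3), of I R] have 2: "steps P (q + 1, I, R) 4 (q + 5, ?I, ?R)"
    by (simp add: eval_nat_numeral)
  have 3: "steps P (q + 5, ?I, ?R) 1 (q, ?I, ?R)"
    using steps_instr[OF c(4,5), of ?I ?R 0] by (simp add: steps_refl)
  have "w = L - Suc i" using Suc.hyps(2) by simp
  moreover have "\<And>t t'. Suc i \<le> t \<Longrightarrow> t < L \<Longrightarrow> Suc i \<le> t' \<Longrightarrow> t' < L \<Longrightarrow> src t \<noteq> dst t' \<and> src t \<noteq> 0 \<and> dst t \<noteq> 0"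
    by (meson Suc.prems(1) Suc_leD)
  moreover have "?I j = int (Suc i)" "?I k = int (c + 4 * Suc i)" "?I l = int L" "?I u = 1" "?I v = 4"
    using assms(2) Suc.prems by auto
  ultimately obtain I' R' where *: "steps P (q, ?I, ?R) ((L - Suc i) * 6 + 1) (q + 6, I', R')"
    "\<forall>r. r \<noteq> j \<longrightarrow> r \<noteq> k \<longrightarrow> I' r = ?I r"
    "\<forall>t. Suc i \<le> t \<longrightarrow> t < L \<longrightarrow> R' (dst t) = ?R (src t)"
    "\<forall>a. a \<noteq> 0 \<longrightarrow> (\<forall>t. Suc i \<le> t \<longrightarrow> t < L \<longrightarrow> a \<noteq> dst t) \<longrightarrow> R' a = ?R a"
    using Suc.hyps(1)[of "Suc i" ?I ?R] by blast
  have "R' (dst t) = R (src t)" if "i \<le> t" "t < L" for t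
  proof (cases "t = i")
    case True
    have "\<forall>t'. Suc i \<le> t' \<longrightarrow> t' < L \<longrightarrow> dst i \<noteq> dst t'"
      using injD[OF inj, of i] by fastforce
    with *(4) Suc.prems(1)[of i i] iL True show ?thesis by auto
  next
    case False
    with *(3) Suc.prems(1)[of t i] that iL show ?thesis by auto
  qed
  moreover have "R' a = R a" if "a \<noteq> 0" "\<forall>t. i \<le> t \<longrightarrow> t < L \<longrightarrow> a \<noteq> dst t" for a
    using that *(4) iL by auto
  moreover have "I' r = I r" if "r \<noteq> j" "r \<noteq> k" for r using *(2) that by auto
  moreover have "steps P (q, I, R) ((L - i) * 6 + 1) (q + 6, I', R')"
    using steps_trans[OF steps_trans[OF steps_trans[OF 1 2] 3] *(1)] iL
    by (elim steps_mono) arith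
  ultimately show ?case by blast
qed

text \<open>The registers that control this loop lie in the bank being copied, hence the start at
  40: lower addresses must have been saved before. Since \<open>L \<le> c\<close>, all targets lie
  beyond the sources, so nothing is overwritten before it is read.\<close>

lemma steps_copy_int:
  assumes "code_at P q [IJmpLe 6 5 (q + 6), ILoad 10 5, IStore 7 10, IAdd 5 5 8, IAdd 7 7 9, Jmp q]"
    and "I 5 = int i" "I 7 = int (c + 4 * i)" "I 6 = int L" "I 8 = 1" "I 9 = 4"
    and "40 \<le> i" "40 \<le> c" "L \<le> c"
  shows "\<exists>I'. steps P (q, I, R) ((L - i) * 6 + 1) (q + 6, I', R) \<and>
    (\<forall>r<40. r \<notin> {5, 7, 10} \<longrightarrow> I' r = I r) \<and>
    (\<forall>t. i \<le> t \<longrightarrow> t < L \<longrightarrow> I' (c + 4 * t) = I t) \<and>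
    (\<forall>a\<ge>40. (\<forall>t. i \<le> t \<longrightarrow> t < L \<longrightarrow> a \<noteq> c + 4 * t) \<longrightarrow> I' a = I a)"
  using assms(2-)
proof (induction "L - i" arbitrary: i I)
  case 0
  then have "steps P (q, I, R) (Suc 0) (q + 6, I, R)"
    using assms(1) by (intro steps_instr[where c = "IJmpLe 6 5 (q + 6)"]) (auto simp: steps_refl)
  then show ?case using 0 by (intro exI[of _ I]) simp
next
  case (Suc w)
  have c: "q < length P" "P ! q = IJmpLe 6 5 (q + 6)"
    "code_at P (q + 1) [ILoad 10 5, IStore 7 10, IAdd 5 5 8, IAdd 7 7 9]"
    "q + 5 < length P" "P ! (q + 5) = Jmp q"
    using assms(1) by (auto simp: eval_nat_numeral)
  let ?I = "I(10 := I i, c + 4 * i := I i, 5 := int (Suc i), 7 := int (c + 4 * Suc i))"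
  have iL: "i < L" using Suc.hyps(2) by simp
  have 1: "steps P (q, I, R) 1 (q + 1, I, R)"
    using steps_instr[OF c(1,2), of I R 0] iL Suc.prems by (simp add: steps_refl)
  have n: "nat (I 7) = c + 4 * i" "nat (I 5) = i" using Suc.prems by simp_all
  have "exec_block [ILoad 10 5, IStore 7 10, IAdd 5 5 8, IAdd 7 7 9] (I, R) = (?I, R)"
    using Suc.prems by (simp add: n fun_eq_iff del: of_nat_add of_nat_mult)
  with steps_block[OF c(3), of I R] have 2: "steps P (q + 1, I, R) 4 (q + 5, ?I, R)"
    by (simp add: eval_nat_numeral)
  have 3: "steps P (q + 5, ?I, R) 1 (q, ?I, R)"
    using steps_instr[OF c(4,5), of ?I R 0] by (simp add: steps_refl)
  have "w = L - Suc i" using Suc.hyps(2) by simp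
  moreover have "?I 5 = int (Suc i)" "?I 7 = int (c + 4 * Suc i)" "?I 6 = int L" "?I 8 = 1" "?I 9 = 4" "40 \<le> Suc i"
    using Suc.prems by simp_all
  ultimately obtain I' where *: "steps P (q, ?I, R) ((L - Suc i) * 6 + 1) (q + 6, I', R)"
    "\<forall>r<40. r \<notin> {5, 7, 10} \<longrightarrow> I' r = ?I r"
    "\<forall>t. Suc i \<le> t \<longrightarrow> t < L \<longrightarrow> I' (c + 4 * t) = ?I t"
    "\<forall>a\<ge>40. (\<forall>t. Suc i \<le> t \<longrightarrow> t < L \<longrightarrow> a \<noteq> c + 4 * t) \<longrightarrow> I' a = ?I a"
    using Suc.hyps(1)[of "Suc i" ?I] Suc.prems(7,8) by blast
  have "I' (c + 4 * t) = I t" if "i \<le> t" "t < L" for t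
  proof (cases "t = i")
    case True
    then show ?thesis using *(4)[rule_format, of "c + 4 * t"] Suc.prems by auto
  next
    case False
    with *(3) that Suc.prems show ?thesis by auto
  qed
  moreover have "I' a = I a" if "40 \<le> a" "\<forall>t. i \<le> t \<longrightarrow> t < L \<longrightarrow> a \<noteq> c + 4 * t" for a
    using that *(4) iL by auto
  moreover have "I' r = I r" if "r < 40" "r \<notin> {5, 7, 10}" for r using *(2) that Suc.prems by auto
  moreover have "steps P (q, I, R) ((L - i) * 6 + 1) (q + 6, I', R)"
    using steps_trans[OF steps_trans[OF steps_trans[OF 1 2] 3] *(1)] iL
    by (elim steps_mono) arith
  ultimately show ?case by blast
qed

section \<open>Creating free space and installing the memory layout\<close>

text \<open>Straight-line code, as no register is free yet to control a loop. Register 2 is a moving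
  pointer and register 3 holds its increment 4. Register \<open>r\<close> of the input stores the
  endpoint of half-edge \<open>r - 2\<close> and goes directly to its final place.\<close>

definition save_code :: "nat \<Rightarrow> instr list" where
  "save_code k = concat (map (\<lambda>r. [IAdd 2 2 3, IStore 2 r]) [4..<k])"

text \<open>The last conjunct keeps two things: the slots at \<open>B\<close> and
  \<open>B + 4\<close>, already filled from registers 2 and 3, and the input from register 40 on,
  which is still to be moved.\<close>

lemma exec_save_code:
  assumes "4 \<le> k" "k \<le> 40" "40 \<le> B" "I 2 = int (B + 4)" "I 3 = 4"
  shows "\<exists>I'. exec_block (save_code k) (I, R) = (I', R) \<and> I' 2 = int (B + 4 * (k - 3)) \<and>
    (\<forall>r<40. r \<noteq> 2 \<longrightarrow> I' r = I r) \<and> (\<forall>r. 4 \<le> r \<longrightarrow> r < k \<longrightarrow> I' (B + 4 * (r - 2)) = I r) \<and>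
    (\<forall>a\<ge>40. a < B + 5 \<longrightarrow> I' a = I a)"
  using assms
proof (induction k rule: dec_induct)
  case base
  then show ?case by (simp add: save_code_def)
next
  case (step k)
  then obtain I' where *: "exec_block (save_code k) (I, R) = (I', R)" "I' 2 = int (B + 4 * (k - 3))"
    "\<forall>r<40. r \<noteq> 2 \<longrightarrow> I' r = I r" "\<forall>r. 4 \<le> r \<longrightarrow> r < k \<longrightarrow> I' (B + 4 * (r - 2)) = I r"
    "\<forall>a\<ge>40. a < B + 5 \<longrightarrow> I' a = I a" by auto
  have a: "I' 2 + I' 3 = int (B + 4 * (k - 2))" using * step by simp
  let ?I = "I'(2 := int (B + 4 * (k - 2)), B + 4 * (k - 2) := I k)"
  have "save_code (Suc k) = save_code k @ [IAdd 2 2 3, IStore 2 k]"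
    using step by (simp add: save_code_def)
  moreover have "I' k = I k" using * step by simp
  ultimately have "exec_block (save_code (Suc k)) (I, R) = (?I, R)"
    using *(1) step(1) by (simp add: a del: of_nat_add of_nat_mult)
  moreover have "?I 2 = int (B + 4 * (Suc k - 3))" using step by (simp add: Suc_diff_le)
  moreover have "\<forall>r<40. r \<noteq> 2 \<longrightarrow> ?I r = I r" using * step by auto
  moreover have "?I (B + 4 * (r - 2)) = I r" if "4 \<le> r" "r < Suc k" for r
    using *(4) that step by (cases "r = k") auto
  moreover have "\<forall>a\<ge>40. a < B + 5 \<longrightarrow> ?I a = I a" using *(5) step by auto
  ultimately show ?case by blast
qed

text \<open>The input occupies every register that an instruction could name, so room has to be made
  before anything can be saved.  Eight unimodular steps turn the pair \<open>(n, m)\<close> in registers 0, 1 into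
  \<open>(13n + 21m, 21n + 34m)\<close> without destroying information; register 1 is then an address beyond the
  input.  An edgeless graph is recognised by registers 2 and 3 being equal, as there are no loops.\<close>

definition boot :: "instr list" where
  "boot = [IJmpLe 2 3 2, Jmp 3, IJmpLe 3 2 130] @
    [IAdd 0 0 1, IAdd 1 1 0, IAdd 0 0 1, IAdd 1 1 0, IAdd 0 0 1, IAdd 1 1 0, IAdd 0 0 1, IAdd 1 1 0,
     IStore 1 2, IConst 2 4, IAdd 2 2 1, IStore 2 3, IConst 3 4] @
    save_code 40 @
    [IConst 2 0, IAdd 2 2 1,
     ISub 1 1 0, ISub 0 0 1, ISub 1 1 0, ISub 0 0 1, ISub 1 1 0, ISub 0 0 1, ISub 1 1 0, ISub 0 0 1,
     IConst 3 0, IAdd 4 1 3, IAdd 3 0 3,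
     IConst 6 2, IAdd 6 6 4, IAdd 6 6 4, IConst 5 40, IConst 7 152, IAdd 7 7 2, IConst 8 1, IConst 9 4] @
    [IJmpLe 6 5 115, ILoad 10 5, IStore 7 10, IAdd 5 5 8, IAdd 7 7 9, Jmp 109] @
    [RStore 2 0, IConst 5 1, IConst 7 4, IAdd 7 7 2, IAdd 6 4 4, IAdd 6 6 6, IAdd 6 6 6, IAdd 6 6 4] @
    [IJmpLe 6 5 129, RLoad 0 5, RStore 7 0, IAdd 5 5 8, IAdd 7 7 9, Jmp 123] @
    [Jmp 137] @
    [IConst 2 40, IAdd 3 0 4, IAdd 0 0 0, IAdd 0 0 0, IAdd 0 0 0, IAdd 0 0 0, IAdd 2 2 0] @
    [IAdd 5 4 4]"

lemma length_save_code: "length (save_code 40) = 72"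
  by (simp add: save_code_def length_concat comp_def sum_list_triv)

lemma length_boot: "length boot = 138"
  by (simp add: boot_def length_save_code)

text \<open>The bound \<open>9 * n + 1 \<le> B\<close> looks ahead to the end: the result is
  delivered in real registers below \<open>9 * n\<close> and must be read from addresses beyond
  them.\<close>

definition relocated :: "nat \<Rightarrow> nat \<Rightarrow> nat \<Rightarrow> (nat \<Rightarrow> int) \<Rightarrow> (nat \<Rightarrow> real) \<Rightarrow> (nat \<Rightarrow> int) \<Rightarrow> (nat \<Rightarrow> real) \<Rightarrow> bool" where
  "relocated B n m I R I' R' \<longleftrightarrow> 40 \<le> B \<and> 9 * n + 1 \<le> B \<and> I' 2 = int B \<and> I' 3 = int n \<and> I' 4 = int m \<and>
     (\<forall>h<2 * m. I' (B + 4 * h) = I (2 + h)) \<and> (\<forall>j<9 * m. R' (B + 4 * j) = R j)"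

lemma steps_boot_nonempty:
  assumes P: "code_at P 0 boot" and I: "I 0 = int n" "I 1 = int m" and "1 \<le> m" "2 \<le> n"
  shows "\<exists>B I' R'. steps P (3, I, R) (66 * m + 140) (137, I', R') \<and> relocated B n m I R I' R'"
proof -
  \<comment> \<open>Alternating additions produce Fibonacci coefficients. With six of them register
    1 would hold \<open>8 * n + 13 * m\<close>, only 29 for the smallest case of two vertices and
    one edge; eight give 76, beyond all named registers.\<close>
  define B where "B = 21 * n + 34 * m"
  have B: "40 \<le> B" "9 * n + 1 \<le> B" "9 * m + 40 \<le> B" "2 * m + 2 + 8 \<le> B" using assms by (auto simp: B_def)
  define J where "J = I(0 := int (13 * n + 21 * m), 1 := int B, B := I 2, 2 := int (B + 4), B + 4 := I 3, 3 := 4)"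
  have code: "code_at P 3 [IAdd 0 0 1, IAdd 1 1 0, IAdd 0 0 1, IAdd 1 1 0, IAdd 0 0 1, IAdd 1 1 0, IAdd 0 0 1, IAdd 1 1 0,
     IStore 1 2, IConst 2 4, IAdd 2 2 1, IStore 2 3, IConst 3 4]" (is "code_at P 3 ?c1")
    "code_at P 16 (save_code 40)"
    "code_at P 88 [IConst 2 0, IAdd 2 2 1,
     ISub 1 1 0, ISub 0 0 1, ISub 1 1 0, ISub 0 0 1, ISub 1 1 0, ISub 0 0 1, ISub 1 1 0, ISub 0 0 1,
     IConst 3 0, IAdd 4 1 3, IAdd 3 0 3,
     IConst 6 2, IAdd 6 6 4, IAdd 6 6 4, IConst 5 40, IConst 7 152, IAdd 7 7 2, IConst 8 1, IConst 9 4]" (is "code_at P 88 ?c2")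
    "code_at P 109 [IJmpLe 6 5 115, ILoad 10 5, IStore 7 10, IAdd 5 5 8, IAdd 7 7 9, Jmp 109]"
    "code_at P 115 [RStore 2 0, IConst 5 1, IConst 7 4, IAdd 7 7 2, IAdd 6 4 4, IAdd 6 6 6, IAdd 6 6 6, IAdd 6 6 4]"
      (is "code_at P 115 ?c3")
    "code_at P 123 [IJmpLe 6 5 129, RLoad 0 5, RStore 7 0, IAdd 5 5 8, IAdd 7 7 9, Jmp 123]"
    "code_at P 129 [Jmp 137]"
    using P unfolding boot_def code_at_append by (simp_all add: length_save_code Suc_eq_plus1 del: code_at.simps One_nat_def)
  have e1: "exec_block ?c1 (I, R) = (J, R)"
  proof -
    let ?f = "[IAdd 0 0 1, IAdd 1 1 0, IAdd 0 0 1, IAdd 1 1 0, IAdd 0 0 1, IAdd 1 1 0, IAdd 0 0 1, IAdd 1 1 0]"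
    have f: "exec_block ?f (I, R) = (I(0 := int (13 * n + 21 * m), 1 := int B), R)"
      by (auto simp: I B_def fun_eq_iff simp del: One_nat_def)
    have "exec_block (?f @ [IStore 1 2, IConst 2 4, IAdd 2 2 1, IStore 2 3, IConst 3 4]) (I, R) = (J, R)"
      unfolding fold_append o_apply f using B by (auto simp: J_def fun_eq_iff nat_add_distrib)
    then show ?thesis by simp
  qed
  have 1: "steps P (3, I, R) 13 (16, J, R)"
    using steps_block[OF code(1), of I R] unfolding e1 by (simp add: Suc_eq_plus1 del: One_nat_def)
  obtain J1 where e2: "exec_block (save_code 40) (J, R) = (J1, R)" and
    J1: "\<forall>r<40. r \<noteq> 2 \<longrightarrow> J1 r = J r" "\<forall>r. 4 \<le> r \<longrightarrow> r < 40 \<longrightarrow> J1 (B + 4 * (r - 2)) = J r"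
    "\<forall>a\<ge>40. a < B + 5 \<longrightarrow> J1 a = J a"
    using exec_save_code[of 40 B J R] B by (auto simp: J_def)
  have "list_all straight (save_code 40)" by (auto simp: save_code_def list_all_iff)
  from steps_block[OF code(2) this, of J R] have 2: "steps P (16, J, R) 72 (88, J1, R)"
    unfolding e2 by (simp add: length_save_code)
  \<comment> \<open>The subtractions have undone the Fibonacci steps. Input register
    \<open>t\<close> belongs to half-edge \<open>t - 2\<close>, so its target is
    \<open>B + 4 * (t - 2)\<close>; at the loop start \<open>t = 40\<close> this is
    \<open>B + 152\<close>.\<close>
  define K where "K = J1(0 := int n, 1 := int m, 2 := int B, 3 := int n, 4 := int m, 6 := int (2 * m + 2), 5 := 40,
    7 := int (B - 8 + 4 * 40), 8 := 1, 9 := 4)"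
  have e3: "exec_block ?c2 (J1, R) = (K, R)"
  proof -
    have "J1 0 = int (13 * n + 21 * m)" "J1 1 = int B" using J1(1) B by (auto simp: J_def)
    then show ?thesis using B by (auto simp: K_def B_def fun_eq_iff)
  qed
  have 3: "steps P (88, J1, R) 21 (109, K, R)"
    using steps_block[OF code(3), of J1 R] unfolding e3 by (simp add: Suc_eq_plus1 del: One_nat_def)
  obtain K1 where 4: "steps P (109, K, R) ((2 * m + 2 - 40) * 6 + 1) (115, K1, R)" and
    K1: "\<forall>r<40. r \<notin> {5, 7, 10} \<longrightarrow> K1 r = K r" "\<forall>t. 40 \<le> t \<longrightarrow> t < 2 * m + 2 \<longrightarrow> K1 (B - 8 + 4 * t) = K t"
    "\<forall>a\<ge>40. (\<forall>t. 40 \<le> t \<longrightarrow> t < 2 * m + 2 \<longrightarrow> a \<noteq> B - 8 + 4 * t) \<longrightarrow> K1 a = K a"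
  proof -
    have "\<exists>K1. steps P (109, K, R) ((2 * m + 2 - 40) * 6 + 1) (109 + 6, K1, R) \<and>
      (\<forall>r<40. r \<notin> {5, 7, 10} \<longrightarrow> K1 r = K r) \<and>
      (\<forall>t. 40 \<le> t \<longrightarrow> t < 2 * m + 2 \<longrightarrow> K1 (B - 8 + 4 * t) = K t) \<and>
      (\<forall>a\<ge>40. (\<forall>t. 40 \<le> t \<longrightarrow> t < 2 * m + 2 \<longrightarrow> a \<noteq> B - 8 + 4 * t) \<longrightarrow> K1 a = K a)"
    proof (rule steps_copy_int)
      show "code_at P 109 [IJmpLe 6 5 (109 + 6), ILoad 10 5, IStore 7 10, IAdd 5 5 8, IAdd 7 7 9, Jmp 109]"
        using code(4) by simp
    qed (use B \<open>1 \<le> m\<close> \<open>2 \<le> n\<close> in \<open>auto simp: K_def B_def\<close>)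
    then show ?thesis using that by auto
  qed
  \<comment> \<open>Real register 0 becomes the buffer of the next loop, so its entry is stored
    beforehand and the loop starts at 1.\<close>
  define L where "L = K1(5 := 1, 7 := int (B + 4), 6 := int (9 * m))"
  have e4: "exec_block ?c3 (K1, R) = (L, R(B := R 0))"
    using K1(1) by (auto simp: L_def K_def fun_eq_iff)
  have 5: "steps P (115, K1, R) 8 (123, L, R(B := R 0))"
    using steps_block[OF code(5), of K1 R] unfolding e4 by (simp add: Suc_eq_plus1 del: One_nat_def)
  obtain L1 R1 where 6: "steps P (123, L, R(B := R 0)) ((9 * m - 1) * 6 + 1) (129, L1, R1)" and
    L1: "\<forall>r. r \<noteq> 5 \<longrightarrow> r \<noteq> 7 \<longrightarrow> L1 r = L r"
    and R1: "\<forall>t. 1 \<le> t \<longrightarrow> t < 9 * m \<longrightarrow> R1 (B + 4 * t) = (R(B := R 0)) t"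
    "\<forall>a. a \<noteq> 0 \<longrightarrow> (\<forall>t. 1 \<le> t \<longrightarrow> t < 9 * m \<longrightarrow> a \<noteq> B + 4 * t) \<longrightarrow> R1 a = (R(B := R 0)) a"
  proof -
    have "\<exists>L1 R1. steps P (123, L, R(B := R 0)) ((9 * m - 1) * 6 + 1) (123 + 6, L1, R1) \<and>
      (\<forall>r. r \<noteq> 5 \<longrightarrow> r \<noteq> 7 \<longrightarrow> L1 r = L r) \<and>
      (\<forall>t. 1 \<le> t \<longrightarrow> t < 9 * m \<longrightarrow> R1 (B + 4 * t) = (R(B := R 0)) t) \<and>
      (\<forall>a. a \<noteq> 0 \<longrightarrow> (\<forall>t. 1 \<le> t \<longrightarrow> t < 9 * m \<longrightarrow> a \<noteq> B + 4 * t) \<longrightarrow> R1 a = (R(B := R 0)) a)"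
    proof (rule steps_copy_real[where c = B])
      show "nat (I 5) = i \<and> nat (I 7) = B + 4 * i"
        if "I 5 = int i" "I 7 = int (B + 4 * i)" for I :: "nat \<Rightarrow> int" and i
        using that by (simp del: of_nat_add of_nat_mult)
      show "L 8 = 1" "L 9 = 4" using K1(1) by (auto simp: L_def K_def)
      show "code_at P 123 [IJmpLe 6 5 (123 + 6), RLoad 0 5, RStore 7 0, IAdd 5 5 8, IAdd 7 7 9, Jmp 123]"
        using code(6) by simp
    qed (use B in \<open>auto simp: L_def inj_def\<close>)
    then show ?thesis using that by auto
  qed
  have 7: "steps P (129, L1, R1) 1 (137, L1, R1)"
    using steps_instr[of 129 P "Jmp 137" L1 R1 0] code(7) by (simp add: steps_refl)
  have "steps P (3, I, R) (66 * m + 140) (137, L1, R1)"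
    using steps_trans[OF steps_trans[OF steps_trans[OF steps_trans[OF steps_trans[OF steps_trans[OF 1 2] 3] 4] 5] 6] 7]
    by (rule steps_mono) simp
  moreover have "relocated B n m I R L1 R1"
    unfolding relocated_def
  proof (intro conjI allI impI)
    have L: "L1 r = K1 r" if "r \<notin> {5, 6, 7}" for r using that L1 by (auto simp: L_def)
    show "L1 2 = int B" "L1 3 = int n" "L1 4 = int m" using L K1(1) by (auto simp: K_def)
    fix h assume h: "h < 2 * m"
    have "K1 (B + 4 * h) = I (2 + h)"
    \<comment> \<open>Half-edges below 38 come from the registers 2 to 39 that were saved one by
      one, the others from the copy loop, whose targets start at \<open>B + 152\<close>.\<close>
    proof (cases "h < 38")
      case True
      have "B + 4 * h \<noteq> B - 8 + 4 * t" if "40 \<le> t" for t using that True by linarith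
      then have "K1 (B + 4 * h) = J1 (B + 4 * h)" using K1(3) B by (auto simp: K_def)
      also have "\<dots> = I (2 + h)"
      proof (cases "2 \<le> h")
        case True
        have "J1 (B + 4 * (h + 2 - 2)) = J (h + 2)"
          by (rule J1(2)[rule_format]) (use \<open>h < 38\<close> True in auto)
        then show ?thesis using True \<open>h < 38\<close> B by (simp add: J_def)
      next
        case False
        then have "h = 0 \<or> h = 1" by auto
        then show ?thesis using J1(3) B by (auto simp: J_def eval_nat_numeral)
      qed
      finally show ?thesis .
    next
      case False
      then have "K1 (B - 8 + 4 * (h + 2)) = K (h + 2)"
        by (intro K1(2)[rule_format]) (use h in auto)
      also have "\<dots> = J1 (h + 2)" using False by (simp add: K_def)
      also have "\<dots> = I (h + 2)" using J1(3) False h B by (simp add: J_def)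
      finally show ?thesis using B by (simp add: add_ac)
    qed
    then show "L1 (B + 4 * h) = I (2 + h)" using L[of "B + 4 * h"] B by simp
  next
    fix j assume "j < 9 * m"
    then show "R1 (B + 4 * j) = R j" using R1 B by (cases "j = 0") auto
  qed (use B in auto)
  ultimately show ?thesis by blast
qed


lemma steps_boot:
  assumes P: "code_at P 0 boot" and I: "I 0 = int n" "I 1 = int m"
    and "1 \<le> m \<Longrightarrow> 2 \<le> n \<and> I 2 \<noteq> I 3" "m = 0 \<Longrightarrow> I 2 = 0 \<and> I 3 = 0 \<and> I 4 = 0"
  shows "\<exists>B I' R'. steps P (0, I, R) (66 * m + 150) (138, I', R') \<and> relocated B n m I R I' R' \<and> I' 5 = int (2 * m)"
proof -
  have "code_at P 0 [IJmpLe 2 3 2, Jmp 3, IJmpLe 3 2 130]"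
    and c: "code_at P 130 [IConst 2 40, IAdd 3 0 4, IAdd 0 0 0, IAdd 0 0 0, IAdd 0 0 0, IAdd 0 0 0, IAdd 2 2 0]"
    (is "code_at P 130 ?c") and c': "code_at P 137 [IAdd 5 4 4]"
    using P unfolding boot_def code_at_append
    by (simp_all add: length_save_code Suc_eq_plus1 del: code_at.simps One_nat_def)
  then have code: "0 < length P" "P ! 0 = IJmpLe 2 3 2" "1 < length P" "P ! 1 = Jmp 3" "2 < length P"
    "P ! 2 = IJmpLe 3 2 130" by (simp_all add: numeral_2_eq_2)
  obtain B I' R' where *: "steps P (0, I, R) (66 * m + 143) (137, I', R')" "relocated B n m I R I' R'"
  proof (cases "m = 0")
    case True
    \<comment> \<open>Without edges the registers 2 to 4 are zero and nothing needs saving: register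
      4 already holds \<open>m\<close> and serves as the zero for copying \<open>n\<close>, and four
      doublings give a base beyond the output.\<close>
    define J where "J = I(0 := int (16 * n), 2 := int (16 * n + 40), 3 := int n)"
    have "steps P (0, I, R) (Suc (Suc 0)) (130, I, R)"
      using code assms(5) True by (intro steps_instr[OF code(1,2)]) (auto intro!: steps_instr[OF code(5,6)] steps_refl)
    moreover have "exec_block ?c (I, R) = (J, R)"
      using I assms(5) True by (auto simp: J_def fun_eq_iff)
    with steps_block[OF c, of I R] have "steps P (130, I, R) 7 (137, J, R)"
      by (simp add: Suc_eq_plus1 del: One_nat_def)
    ultimately have "steps P (0, I, R) (Suc (Suc 0) + 7) (137, J, R)" by (rule steps_trans)
    then have "steps P (0, I, R) (66 * m + 143) (137, J, R)" by (rule steps_mono) simp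
    moreover have "relocated (16 * n + 40) n m I R J R"
      using True assms(5) by (simp add: relocated_def J_def)
    ultimately show ?thesis by (rule that)
  next
    case False
    have "steps P (0, I, R) (Suc (Suc 0)) (3, I, R)"
    proof (cases "I 2 \<le> I 3")
      case True
      then show ?thesis
        using assms(4) \<open>m \<noteq> 0\<close> by (intro steps_instr[OF code(1,2)]) (auto intro!: steps_instr[OF code(5,6)] simp: steps_refl)
    next
      case False
      then have "steps P (1, I, R) (Suc 0) (3, I, R)"
        by (intro steps_instr[OF code(3,4)]) (auto simp: steps_refl)
      then show ?thesis
        using False by (intro steps_instr[OF code(1,2)]) auto
    qed
    moreover obtain B I' R' where "steps P (3, I, R) (66 * m + 140) (137, I', R')" "relocated B n m I R I' R'"
      using steps_boot_nonempty[OF P I, of R] assms(4) False by auto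
    ultimately have "steps P (0, I, R) (Suc (Suc 0) + (66 * m + 140)) (137, I', R')" by (meson steps_trans)
    then have "steps P (0, I, R) (66 * m + 143) (137, I', R')" by (rule steps_mono) simp
    then show ?thesis using \<open>relocated B n m I R I' R'\<close> by (rule that)
  qed
  have 1: "steps P (137, I', R') 1 (138, I'(5 := int (2 * m)), R')"
    using steps_block[OF c', of I' R'] *(2) by (simp add: relocated_def)
  have "steps P (0, I, R) (66 * m + 150) (138, I'(5 := int (2 * m)), R')"
    using steps_trans[OF *(1) 1] by (rule steps_mono) simp
  moreover have "relocated B n m I R (I'(5 := int (2 * m))) R'"
    using *(2) by (auto simp: relocated_def)
  ultimately show ?thesis by (intro exI[of _ B]) (meson fun_upd_same)
qed

text \<open>Register 0 of the real bank serves as the buffer of the copy loop, so its own output entry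
  is fetched last.\<close>

definition finish :: "nat \<Rightarrow> instr list" where
  "finish p = [IAdd 21 3 3, IAdd 21 21 21, IAdd 21 21 21, IAdd 21 21 3, IConst 20 1, IConst 22 5, IAdd 22 22 2,
      IConst 23 1, IConst 24 4] @
    [IJmpLe 21 20 (p + 15), RLoad 0 22, RStore 20 0, IAdd 20 20 23, IAdd 22 22 24, Jmp (p + 9)] @
    [IConst 22 1, IAdd 22 22 2, RLoad 0 22, IConst 22 0, IAdd 0 6 22] @
    [Halt]"

text \<open>The offset 1 selects array 1, which holds the output, and register 6 is variable 3, the
  answer. By \<open>9 * n + 1 \<le> B\<close> the targets lie below all sources.\<close>

lemma steps_finish:
  assumes P: "code_at P p (finish p)" and I: "I 2 = int B" "I 3 = int n" and "9 * n + 1 \<le> B"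
  shows "\<exists>I' R'. steps P (p, I, R) (54 * n + 20) (p + 20, I', R') \<and> halted P (p + 20, I', R') \<and>
    I' 0 = I 6 \<and> (\<forall>j<9 * n. R' j = R (B + 4 * j + 1))"
proof -
  have code: "code_at P p [IAdd 21 3 3, IAdd 21 21 21, IAdd 21 21 21, IAdd 21 21 3, IConst 20 1, IConst 22 5, IAdd 22 22 2,
      IConst 23 1, IConst 24 4]" (is "code_at P p ?c1")
    "code_at P (p + 9) [IJmpLe 21 20 (p + 9 + 6), RLoad 0 22, RStore 20 0, IAdd 20 20 23, IAdd 22 22 24, Jmp (p + 9)]"
    "code_at P (p + 15) [IConst 22 1, IAdd 22 22 2, RLoad 0 22, IConst 22 0, IAdd 0 6 22]" (is "code_at P (p + 15) ?c2")
    "code_at P (p + 20) [Halt]"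
    using P unfolding finish_def code_at_append by (simp_all del: code_at.simps add: add_ac eval_nat_numeral)
  define J where "J = I(20 := 1, 21 := int (9 * n), 22 := int (B + 5), 23 := 1, 24 := 4)"
  have "exec_block ?c1 (I, R) = (J, R)" using I by (auto simp: J_def fun_eq_iff)
  with steps_block[OF code(1), of I R] have 1: "steps P (p, I, R) 9 (p + 9, J, R)"
    by (simp add: Suc_eq_plus1 del: One_nat_def)
  obtain J1 R1 where 2: "steps P (p + 9, J, R) ((9 * n - 1) * 6 + 1) (p + 9 + 6, J1, R1)" and
    J1: "\<forall>r. r \<noteq> 20 \<longrightarrow> r \<noteq> 22 \<longrightarrow> J1 r = J r"
    and R1: "\<forall>t. 1 \<le> t \<longrightarrow> t < 9 * n \<longrightarrow> R1 t = R (B + 1 + 4 * t)"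
    "\<forall>a. a \<noteq> 0 \<longrightarrow> (\<forall>t. 1 \<le> t \<longrightarrow> t < 9 * n \<longrightarrow> a \<noteq> t) \<longrightarrow> R1 a = R a"
  proof -
    have "\<exists>J1 R1. steps P (p + 9, J, R) ((9 * n - 1) * 6 + 1) (p + 9 + 6, J1, R1) \<and>
      (\<forall>r. r \<noteq> 20 \<longrightarrow> r \<noteq> 22 \<longrightarrow> J1 r = J r) \<and>
      (\<forall>t. 1 \<le> t \<longrightarrow> t < 9 * n \<longrightarrow> R1 t = R (B + 1 + 4 * t)) \<and>
      (\<forall>a. a \<noteq> 0 \<longrightarrow> (\<forall>t. 1 \<le> t \<longrightarrow> t < 9 * n \<longrightarrow> a \<noteq> t) \<longrightarrow> R1 a = R a)"
    proof (rule steps_copy_real[OF code(2), where c = "B + 1"])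
      show "nat (I 22) = B + 1 + 4 * i \<and> nat (I 20) = i"
        if "I 20 = int i" "I 22 = int (B + 1 + 4 * i)" for I :: "nat \<Rightarrow> int" and i
        using that by (simp del: of_nat_add of_nat_mult)
    qed (use assms(4) in \<open>auto simp: J_def inj_def\<close>)
    then show ?thesis using that by blast
  qed
  let ?K = "J1(22 := 0, 0 := I 6)" and ?R = "R1(0 := R1 (B + 1))"
  have "J1 2 = int B" "J1 6 = I 6" using J1 I by (auto simp: J_def)
  then have "exec_block ?c2 (J1, R1) = (?K, ?R)" by (auto simp: fun_eq_iff nat_add_distrib)
  with steps_block[OF code(3), of J1 R1] have 3: "steps P (p + 9 + 6, J1, R1) 5 (p + 20, ?K, ?R)"
    by (simp add: Suc_eq_plus1 add.commute[of p] del: One_nat_def)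
  have "steps P (p, I, R) (54 * n + 20) (p + 20, ?K, ?R)"
    using steps_trans[OF steps_trans[OF 1 2] 3] by (rule steps_mono) simp
  moreover have "halted P (p + 20, ?K, ?R)" using code(4) by (simp add: halted_def)
  moreover have "?R j = R (B + 4 * j + 1)" if "j < 9 * n" for j
  proof (cases "j = 0")
    case True
    have "R1 (B + 1) = R (B + 1)" using assms(4) by (intro R1(2)[rule_format]) auto
    with True show ?thesis by simp
  next
    case False
    then show ?thesis using R1(1) that by (simp add: add_ac)
  qed
  moreover have "?K 0 = I 6" by simp
  ultimately show ?thesis by blast
qed

section \<open>NLY bases and labellings of half-edges\<close>

abbreviation vec3 :: "real \<Rightarrow> real \<Rightarrow> real \<Rightarrow> real^3" where
  "vec3 a b c \<equiv> vector [a, b, c]"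

lemma inner_3: "x \<bullet> y = x$1 * y$1 + x$2 * y$2 + x$3 * (y$3)" for x y :: "real^3"
  by (simp add: inner_vec_def sum_3)

text \<open>Chained over several vectors this yields the last nonzero one, normalised, with no
  record of whether one has been found. The zero test has the form of a comparison available to the
  machine.\<close>

definition pick :: "real^3 \<Rightarrow> real^3 \<Rightarrow> real^3" where
  "pick v w = (if w \<bullet> w \<le> 0 then v else w /\<^sub>R norm w)"

lemma pick_multiple:
  assumes "norm a = 1" "w = t *\<^sub>R a" "v = a \<or> v = - a \<or> t \<noteq> 0"
  shows "pick v w = a \<or> pick v w = - a"
proof (cases "t = 0")
  case True
  then show ?thesis using assms by (auto simp: pick_def)
next
  case False
  then have "w /\<^sub>R norm w = (t / \<bar>t\<bar>) *\<^sub>R a" using assms by (simp add: field_simps)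
  moreover have "t / \<bar>t\<bar> = 1 \<or> t / \<bar>t\<bar> = -1" using False by (auto simp: abs_if)
  moreover have "w \<noteq> 0" using False assms by auto
  then have "\<not> w \<bullet> w \<le> 0" by (simp add: not_le)
  ultimately show ?thesis by (auto simp: pick_def)
qed

text \<open>A nonzero multiple of \<open>a\<close> sets the value to \<open>a\<close> or
  \<open>- a\<close>, and later multiples keep it there. As one coefficient is nonzero, the starting
  value \<open>v\<close> has no influence beyond the sign.\<close>

lemma pick_three:
  assumes "norm a = 1" "w1 = t1 *\<^sub>R a" "w2 = t2 *\<^sub>R a" "w3 = t3 *\<^sub>R a" "t1 \<noteq> 0 \<or> t2 \<noteq> 0 \<or> t3 \<noteq> 0"
  shows "pick (pick (pick v w1) w2) w3 = a \<or> pick (pick (pick v w1) w2) w3 = - a"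
proof -
  let ?A = "\<lambda>v. v = a \<or> v = - a"
  have keep: "?A (pick v w)" if "?A v" "w = t *\<^sub>R a" for v w t using pick_multiple[OF assms(1) that(2)] that by blast
  have set: "?A (pick v w)" if "t \<noteq> 0" "w = t *\<^sub>R a" for v w t using pick_multiple[OF assms(1) that(2)] that by blast
  show ?thesis using assms(2-) keep set by metis
qed

text \<open>The column space is a line; \<open>a\<close> is a unit vector spanning it and
  \<open>b\<close> lists the coefficients of the columns.\<close>

lemma rank_1_outer:
  fixes B :: "real^3^3"
  assumes "rank B = 1"
  obtains a b where "norm a = 1" "b \<noteq> 0" "\<And>i j. B $ i $ j = a $ i * b $ j"
proof -
  have "dim (columns B) = 1" using assms by (simp add: column_rank_def)
  then obtain S where S: "S \<subseteq> columns B" "independent S" "columns B \<subseteq> span S" "card S = 1"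
    using basis_exists[of "columns B"] by auto
  then obtain e where e: "S = {e}" by (auto simp: card_1_singleton_iff)
  have "e \<noteq> 0" using S(2) e dependent_zero by blast
  define a where "a = e /\<^sub>R norm e"
  have a: "norm a = 1" "e = norm e *\<^sub>R a" using \<open>e \<noteq> 0\<close> by (simp_all add: a_def)
  have "\<exists>t. column j B = t *\<^sub>R a" for j
  proof -
    have "column j B \<in> span {e}" using S(3) e by (auto simp: columns_def)
    then obtain t where "column j B = t *\<^sub>R e" by (auto simp: span_singleton)
    then have "column j B = (t * norm e) *\<^sub>R a" using a(2) by (metis scaleR_scaleR)
    then show ?thesis by blast
  qed
  then obtain t where t: "\<And>j. column j B = t j *\<^sub>R a" by metis
  have eq: "B $ i $ j = a $ i * (\<chi> j. t j) $ j" for i j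
    using arg_cong[OF t[of j], of "\<lambda>v. v $ i"] by (simp add: column_def)
  have "(\<chi> j. t j) \<noteq> 0"
  proof
    assume "(\<chi> j. t j) = 0"
    then have "B = 0" using eq by (simp add: vec_eq_iff)
    then show False using assms by simp
  qed
  with a(1) eq that show ?thesis by blast
qed

text \<open>The factor \<open>c\<close> is existential because only \<open>c \<noteq> 0\<close>
  matters; hence the property survives replacing \<open>a\<close> or \<open>b\<close> by its
  negative.\<close>

definition outer_edge :: "real^3^3 \<Rightarrow> real^3 \<Rightarrow> real^3 \<Rightarrow> bool" where
  "outer_edge B a b \<longleftrightarrow> norm a = 1 \<and> norm b = 1 \<and>
     (\<exists>c. c \<noteq> 0 \<and> (\<forall>x. B *v x = (c * (b \<bullet> x)) *\<^sub>R a) \<and> (\<forall>x. transpose B *v x = (c * (a \<bullet> x)) *\<^sub>R b))"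

text \<open>Columns of \<open>B\<close> are multiples of \<open>a\<close> and rows are multiples of
  \<open>b\<close>, so picking recovers both up to signs, and the signs \<open>s\<close>,
  \<open>t\<close> move into the factor.\<close>

lemma outer_edge_pick:
  assumes "rank B = 1"
  shows "outer_edge B (pick (pick (pick v (column 1 B)) (column 2 B)) (column 3 B))
    (pick (pick (pick w (row 1 B)) (row 2 B)) (row 3 B))" (is "outer_edge B ?a ?b")
proof -
  obtain a b where ab: "norm a = 1" "b \<noteq> 0" and B: "\<And>i j. B $ i $ j = a $ i * b $ j"
    using rank_1_outer[OF assms] by blast
  define b' where "b' = b /\<^sub>R norm b"
  have b': "norm b' = 1" "b = norm b *\<^sub>R b'" using ab by (simp_all add: b'_def)
  have c: "column j B = b $ j *\<^sub>R a" for j by (simp add: column_def vec_eq_iff B)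
  have r: "row i B = (a $ i * norm b) *\<^sub>R b'" for i
    using ab by (simp add: row_def vec_eq_iff B b'_def)
  have "b $ 1 \<noteq> 0 \<or> b $ 2 \<noteq> 0 \<or> b $ 3 \<noteq> 0" using ab(2) by (auto simp: vec_eq_iff forall_3)
  then have a: "?a = a \<or> ?a = - a" by (intro pick_three[OF ab(1) c c c])
  have "a \<noteq> 0" using ab(1) by auto
  then have "a $ 1 * norm b \<noteq> 0 \<or> a $ 2 * norm b \<noteq> 0 \<or> a $ 3 * norm b \<noteq> 0"
    using ab(2) by (auto simp: vec_eq_iff forall_3)
  then have b: "?b = b' \<or> ?b = - b'" by (intro pick_three[OF b'(1) r r r])
  obtain s where s: "?a = s *\<^sub>R a" "s * s = 1" using a
    by (metis scaleR_minus1_left scaleR_one mult_1 mult_minus1 minus_minus)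
  obtain t where t: "?b = t *\<^sub>R b'" "t * t = 1" using b
    by (metis scaleR_minus1_left scaleR_one mult_1 mult_minus1 minus_minus)
  have 1: "B *v x = (norm b * (b' \<bullet> x)) *\<^sub>R a" for x
  proof -
    have "B *v x = (b \<bullet> x) *\<^sub>R a"
      by (simp add: vec_eq_iff matrix_vector_mult_def B inner_vec_def sum_distrib_left mult_ac)
    then show ?thesis using b'(2) by (metis inner_scaleR_left)
  qed
  have 2: "transpose B *v x = (norm b * (a \<bullet> x)) *\<^sub>R b'" for x
  proof -
    have "transpose B *v x = (a \<bullet> x) *\<^sub>R b"
      by (simp add: vec_eq_iff matrix_vector_mult_def B inner_vec_def transpose_def sum_distrib_left mult_ac)
    then show ?thesis using b'(2) by (metis mult.commute scaleR_scaleR)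
  qed
  have "norm ?a = 1" "norm ?b = 1" using a b ab b' by auto
  moreover have "B *v x = (norm b * s * t * (?b \<bullet> x)) *\<^sub>R ?a" for x
    unfolding s t 1 using s(2) t(2) by (simp add: field_simps)
  moreover have "transpose B *v x = (norm b * s * t * (?a \<bullet> x)) *\<^sub>R ?b" for x
    unfolding s t 2 using s(2) t(2) by (simp add: field_simps)
  moreover have "norm b * s * t \<noteq> 0" using s(2) t(2) ab(2) by auto
  ultimately show ?thesis unfolding outer_edge_def by blast
qed

abbreviation parallel :: "real^3 \<Rightarrow> real^3 \<Rightarrow> bool" where
  "parallel v w \<equiv> v = w \<or> v = - w"

lemma unit_multiple: "norm v = 1 \<Longrightarrow> norm w = 1 \<Longrightarrow> v = t *\<^sub>R (w :: real^3) \<Longrightarrow> parallel v w"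
  by (cases "t \<ge> 0") auto

text \<open>The equality case of Cauchy-Schwarz: \<open>v - w\<close> and \<open>v + w\<close> have
  squared norms 2 minus and 2 plus twice the inner product.\<close>

lemma parallel_iff_inner:
  assumes "norm v = 1" "norm w = 1"
  shows "parallel v w \<longleftrightarrow> (v \<bullet> w)\<^sup>2 = 1"
proof
  assume "(v \<bullet> w)\<^sup>2 = 1"
  then have "v \<bullet> w = 1 \<or> v \<bullet> w = -1" by (simp add: power2_eq_1_iff)
  moreover have "(v - w) \<bullet> (v - w) = 2 - 2 * (v \<bullet> w)" "(v + w) \<bullet> (v + w) = 2 + 2 * (v \<bullet> w)"
    using assms by (simp_all add: algebra_simps inner_commute norm_eq_1)
  ultimately have "v - w = 0 \<or> v + w = 0" by (metis add.right_inverse diff_self inner_eq_zero_iff mult.right_neutral mult_minus_right)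
  then show "parallel v w" by (auto simp: eq_neg_iff_add_eq_0)
qed (use assms in \<open>auto simp: norm_eq_1\<close>)

section \<open>The NLY condition at a single edge\<close>

lemma orthonormal_bvec:
  assumes "orthogonal_matrix (Ob u)"
  shows "norm (bvec Ob u i) = 1" "i \<noteq> j \<Longrightarrow> bvec Ob u i \<bullet> bvec Ob u j = 0"
  using assms by (auto simp: bvec_def orthogonal_matrix_orthonormal_columns orthogonal_def)

lemma ex_bvec_inner_nonzero:
  assumes "orthogonal_matrix (Ob u)" "w \<noteq> 0"
  shows "\<exists>i. w \<bullet> bvec Ob u i \<noteq> 0"
proof (rule ccontr)
  assume "\<not> ?thesis"
  then have "transpose (Ob u) *v w = 0"
    by (auto simp: vec_eq_iff matrix_vector_mul_component transpose_def bvec_def column_def inner_commute)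
  then have "Ob u ** transpose (Ob u) *v w = 0" by (simp flip: matrix_vector_mul_assoc)
  then show False using assms by (simp add: orthogonal_matrix_def)
qed

lemma scaleR_eq_divide: "r \<noteq> 0 \<Longrightarrow> r *\<^sub>R v = s *\<^sub>R w \<Longrightarrow> v = (s / r) *\<^sub>R (w :: 'a::real_vector)"
  by (metis divide_inverse_commute left_inverse scaleR_one scaleR_scaleR)

definition NLY_edge :: "(nat \<Rightarrow> real^3^3) \<Rightarrow> nat \<Rightarrow> nat \<Rightarrow> real^3^3 \<Rightarrow> bool" where
  "NLY_edge Ob u v B \<longleftrightarrow> (\<forall>i::3. \<exists>\<sigma>::real.
        (B *v bvec Ob v i = \<sigma> *\<^sub>R bvec Ob u i \<or> B *v bvec Ob v i = (- \<sigma>) *\<^sub>R bvec Ob u i) \<and>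
        (transpose B *v bvec Ob u i = \<sigma> *\<^sub>R bvec Ob v i \<or>
         transpose B *v bvec Ob u i = (- \<sigma>) *\<^sub>R bvec Ob v i)) \<and>
        B *v bvec Ob v 2 = 0 \<and> transpose B *v bvec Ob u 2 = 0"

text \<open>Since \<open>b\<close> is orthogonal to the second basis vector at \<open>v\<close>, it
  has a nonzero product with the first or third one. For that index \<open>i\<close>,
  \<open>B\<close> maps the basis vector to a nonzero multiple of \<open>a\<close>, forcing
  \<open>a\<close> onto the \<open>i\<close>-th axis at \<open>u\<close>; the transpose then forces
  \<open>b\<close> onto the \<open>i\<close>-th axis at \<open>v\<close>. The index is the same at
  both ends, so an edge needs just one label.\<close>

lemma NLY_edge_iff:
  assumes "outer_edge B a b" "orthogonal_matrix (Ob u)" "orthogonal_matrix (Ob v)"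
  shows "NLY_edge Ob u v B \<longleftrightarrow> (\<exists>i\<in>{1, 3}. parallel a (bvec Ob u i) \<and> parallel b (bvec Ob v i))"
proof
  obtain c where c: "c \<noteq> 0" "\<And>x. B *v x = (c * (b \<bullet> x)) *\<^sub>R a" "\<And>x. transpose B *v x = (c * (a \<bullet> x)) *\<^sub>R b"
    and n: "norm a = 1" "norm b = 1"
    using assms(1) unfolding outer_edge_def by auto
  note ou = orthonormal_bvec[of Ob u, OF assms(2)] and ov = orthonormal_bvec[of Ob v, OF assms(3)]
  {
    assume e: "NLY_edge Ob u v B"
    have "b \<bullet> bvec Ob v 2 = 0" using e c n unfolding NLY_edge_def by auto
    moreover have "b \<noteq> 0" using n by auto
    then obtain i where i: "b \<bullet> bvec Ob v i \<noteq> 0" using ex_bvec_inner_nonzero[of Ob v, OF assms(3)] by blast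
    ultimately have "i \<noteq> 2" by auto
    then have i13: "i \<in> {1, 3}" using exhaust_3[of i] by auto
    obtain \<sigma> where \<sigma>: "B *v bvec Ob v i = \<sigma> *\<^sub>R bvec Ob u i \<or> B *v bvec Ob v i = (- \<sigma>) *\<^sub>R bvec Ob u i"
      "transpose B *v bvec Ob u i = \<sigma> *\<^sub>R bvec Ob v i \<or> transpose B *v bvec Ob u i = (- \<sigma>) *\<^sub>R bvec Ob v i"
      using e unfolding NLY_edge_def by blast
    from \<sigma>(1) obtain s where "(c * (b \<bullet> bvec Ob v i)) *\<^sub>R a = s *\<^sub>R bvec Ob u i" using c by metis
    then have "a = (s / (c * (b \<bullet> bvec Ob v i))) *\<^sub>R bvec Ob u i"
      using c(1) i by (intro scaleR_eq_divide) auto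
    then have a: "parallel a (bvec Ob u i)" using n ou by (metis unit_multiple)
    then have ai: "a \<bullet> bvec Ob u i \<noteq> 0" using ou(1)[of i] by (auto simp: norm_eq_1)
    from \<sigma>(2) obtain s where "(c * (a \<bullet> bvec Ob u i)) *\<^sub>R b = s *\<^sub>R bvec Ob v i" using c by metis
    then have "b = (s / (c * (a \<bullet> bvec Ob u i))) *\<^sub>R bvec Ob v i"
      using c(1) ai by (intro scaleR_eq_divide) auto
    then have "parallel b (bvec Ob v i)" using n ov by (metis unit_multiple)
    with a i13 show "\<exists>i\<in>{1, 3}. parallel a (bvec Ob u i) \<and> parallel b (bvec Ob v i)" by blast
  }
  {
    assume "\<exists>i\<in>{1, 3}. parallel a (bvec Ob u i) \<and> parallel b (bvec Ob v i)"
    then obtain i where i: "i = 1 \<or> i = 3" "parallel a (bvec Ob u i)" "parallel b (bvec Ob v i)" by auto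
    have 0: "a \<bullet> bvec Ob u j = 0" "b \<bullet> bvec Ob v j = 0" if "j \<noteq> i" for j
      using i ou(2)[of i j] ov(2)[of i j] that by auto
    have two: "(2::3) \<noteq> i" using i(1) by auto
    have "\<exists>\<sigma>. (B *v bvec Ob v j = \<sigma> *\<^sub>R bvec Ob u j \<or> B *v bvec Ob v j = (- \<sigma>) *\<^sub>R bvec Ob u j) \<and>
        (transpose B *v bvec Ob u j = \<sigma> *\<^sub>R bvec Ob v j \<or> transpose B *v bvec Ob u j = (- \<sigma>) *\<^sub>R bvec Ob v j)" for j
    proof (cases "j = i")
      case True
      \<comment> \<open>The same \<open>c\<close> serves as witness for \<open>B\<close> and its
        transpose: signs of \<open>a\<close> and \<open>b\<close> are absorbed by the alternatives
        with \<open>- \<sigma>\<close>. All other basis vectors are annihilated, with witness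
        0.\<close>
      have "bvec Ob u i \<bullet> bvec Ob u i = 1" "bvec Ob v i \<bullet> bvec Ob v i = 1" using ou ov by (auto simp: norm_eq_1)
      then show ?thesis using i(2,3) True unfolding c(2,3) by (intro exI[of _ c]) auto
    next
      case False
      then show ?thesis using 0[of j] unfolding c(2,3) by (intro exI[of _ 0]) auto
    qed
    moreover have "B *v bvec Ob v 2 = 0" "transpose B *v bvec Ob u 2 = 0"
      using 0[OF two] unfolding c(2,3) by auto
    ultimately show "NLY_edge Ob u v B" unfolding NLY_edge_def by blast
  }
qed

lemma ball_conj_guard:
  assumes "\<And>u v B. (u, v, B) \<in> S \<Longrightarrow> T B"
  shows "(\<forall>(u, v, B)\<in>S. P u v B \<and> Q u v B) \<longleftrightarrow>
    (\<forall>(u, v, B)\<in>S. P u v B) \<and> (\<forall>(u, v, B)\<in>S. T B \<longrightarrow> Q u v B)"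
  using assms by fast

lemma NLY_basis_iff:
  assumes "mw_graph n es" "all_rank_one es"
  shows "NLY_basis n es Ob \<longleftrightarrow> basis_assignment n Ob \<and>
    (\<forall>k<length es. NLY_edge Ob (fst (es ! k)) (fst (snd (es ! k))) (snd (snd (es ! k))))"
proof -
  have "(\<forall>k<length es. NLY_edge Ob (fst (es ! k)) (fst (snd (es ! k))) (snd (snd (es ! k)))) \<longleftrightarrow>
    (\<forall>(u, v, B)\<in>set es. NLY_edge Ob u v B)"
    by (force simp: all_set_conv_all_nth case_prod_beta)
  moreover have "rank B = 1" if "(u, v, B) \<in> set es" for u v B
    using that assms(2) by (auto simp: all_rank_one_def)
  ultimately show ?thesis
    unfolding NLY_basis_def NLY_edge_def by (simp only: ball_conj_guard[where T = "\<lambda>B. rank B = 1"])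
qed

section \<open>Labellings of half-edges\<close>

text \<open>The numbering follows the input, where half-edge \<open>h\<close> has its vertex in
  register \<open>2 + h\<close>.\<close>

definition half_edges :: "mwgraph_edges \<Rightarrow> (nat \<Rightarrow> nat) \<Rightarrow> (nat \<Rightarrow> real^3) \<Rightarrow> bool" where
  "half_edges es ep d \<longleftrightarrow> (\<forall>k<length es. ep (2 * k) = fst (es ! k) \<and> ep (2 * k + 1) = fst (snd (es ! k)) \<and>
     outer_edge (snd (snd (es ! k))) (d (2 * k)) (d (2 * k + 1)))"

text \<open>A label 1 or -1 of a half-edge says that its direction is the first or third basis vector.\<close>

definition compatible :: "(nat \<Rightarrow> nat) \<Rightarrow> (nat \<Rightarrow> real^3) \<Rightarrow> nat \<Rightarrow> nat \<Rightarrow> int \<Rightarrow> int \<Rightarrow> bool" where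
  "compatible ep d h h' x y \<longleftrightarrow>
     (ep h = ep h' \<longrightarrow> d h \<bullet> d h' = 0 \<and> x = - y \<or> (d h \<bullet> d h')\<^sup>2 = 1 \<and> x = y)"

definition labelling :: "nat \<Rightarrow> (nat \<Rightarrow> nat) \<Rightarrow> (nat \<Rightarrow> real^3) \<Rightarrow> (nat \<Rightarrow> int) \<Rightarrow> bool" where
  "labelling m ep d L \<longleftrightarrow> (\<forall>h<2 * m. L h = 1 \<or> L h = -1) \<and> (\<forall>k<m. L (2 * k) = L (2 * k + 1)) \<and>
     (\<forall>h<2 * m. \<forall>h'<2 * m. compatible ep d h h' (L h) (L h'))"

lemma half_edge_cases:
  assumes "h < 2 * (m::nat)"
  obtains k where "k < m" "h = 2 * k \<or> h = 2 * k + 1"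
proof -
  have "h div 2 < m" "h = 2 * (h div 2) \<or> h = 2 * (h div 2) + 1" using assms by presburger+
  then show ?thesis by (rule that)
qed

lemma half_edges_norm: "half_edges es ep d \<Longrightarrow> h < 2 * length es \<Longrightarrow> norm (d h) = 1"
  by (erule half_edge_cases) (auto simp: half_edges_def outer_edge_def)

lemma half_edges_vertex: "half_edges es ep d \<Longrightarrow> mw_graph n es \<Longrightarrow> h < 2 * length es \<Longrightarrow> ep h < n"
  by (erule half_edge_cases) (fastforce simp: half_edges_def mw_graph_def dest: nth_mem)+

text \<open>A half-edge is labelled by the axis, first or third, that carries it; it cannot lie on
  both. At a common vertex two such directions are members of one orthonormal pair up to sign, hence
  parallel or orthogonal.\<close>

lemma labelling_if_NLY_basis:
  assumes G: "mw_graph n es" "all_rank_one es" and he: "half_edges es ep d" and b: "NLY_basis n es Ob"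
  shows "\<exists>L. labelling (length es) ep d L"
proof -
  let ?m = "length es"
  note hv = half_edges_vertex[OF he G(1)] and hn = half_edges_norm[OF he]
  have o: "orthogonal_matrix (Ob u)" if "u < n" for u
    using b that by (simp add: NLY_basis_def basis_assignment_def)
  define L :: "nat \<Rightarrow> int" where "L h = (if parallel (d h) (bvec Ob (ep h) 1) then 1 else -1)" for h
  have excl: "\<not> (parallel (d h) (bvec Ob (ep h) 1) \<and> parallel (d h) (bvec Ob (ep h) 3))" if "h < 2 * ?m" for h
  proof
    assume "parallel (d h) (bvec Ob (ep h) 1) \<and> parallel (d h) (bvec Ob (ep h) 3)"
    moreover have "bvec Ob (ep h) 1 \<bullet> bvec Ob (ep h) 3 = 0"
      by (rule orthonormal_bvec[of Ob "ep h", OF o[OF hv[OF that]]]) simp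
    ultimately have "d h \<bullet> d h = 0" by (smt (verit) inner_minus_left inner_minus_right inner_commute)
    then show False using hn[OF that] by auto
  qed
  have edge: "\<exists>i\<in>{1, 3}. parallel (d (2 * k)) (bvec Ob (ep (2 * k)) i) \<and>
      parallel (d (2 * k + 1)) (bvec Ob (ep (2 * k + 1)) i)" if "k < ?m" for k
  proof -
    have v: "ep (2 * k) < n" "ep (2 * k + 1) < n" using hv that by auto
    have oe: "outer_edge (snd (snd (es ! k))) (d (2 * k)) (d (2 * k + 1))"
      "fst (es ! k) = ep (2 * k)" "fst (snd (es ! k)) = ep (2 * k + 1)"
      using he that by (auto simp: half_edges_def)
    have "NLY_edge Ob (ep (2 * k)) (ep (2 * k + 1)) (snd (snd (es ! k)))"
      using b that unfolding NLY_basis_iff[OF G] oe(2,3)[symmetric] by blast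
    then show ?thesis unfolding NLY_edge_iff[of _ _ _ Ob, OF oe(1) o[OF v(1)] o[OF v(2)]] .
  qed
  have lab: "L h = 1 \<and> parallel (d h) (bvec Ob (ep h) 1) \<or> L h = -1 \<and> parallel (d h) (bvec Ob (ep h) 3)"
    if "h < 2 * ?m" for h
    using that
  proof (rule half_edge_cases)
    fix k assume k: "k < ?m" "h = 2 * k \<or> h = 2 * k + 1"
    then have "\<exists>i\<in>{1, 3}. parallel (d h) (bvec Ob (ep h) i)" using edge[OF k(1)] by blast
    then show ?thesis unfolding L_def by auto
  qed
  have "L (2 * k) = L (2 * k + 1)" if "k < ?m" for k
    using edge[OF that] lab[of "2 * k"] lab[of "2 * k + 1"] excl[of "2 * k"] excl[of "2 * k + 1"] that by auto
  moreover have "compatible ep d h h' (L h) (L h')" if "h < 2 * ?m" "h' < 2 * ?m" for h h'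
    unfolding compatible_def
  proof
    assume eq: "ep h = ep h'"
    note on = orthonormal_bvec[of Ob "ep h", OF o[OF hv[OF that(1)]]]
    have "bvec Ob (ep h) 1 \<bullet> bvec Ob (ep h) 3 = 0" "bvec Ob (ep h) 3 \<bullet> bvec Ob (ep h) 1 = 0"
      by (intro on(2); simp)+
    moreover have "bvec Ob (ep h) i \<bullet> bvec Ob (ep h) i = 1" for i
      using on(1) by (simp add: norm_eq_1)
    ultimately show "d h \<bullet> d h' = 0 \<and> L h = - L h' \<or> (d h \<bullet> d h')\<^sup>2 = 1 \<and> L h = L h'"
      using lab[OF that(1)] lab[OF that(2)] unfolding eq[symmetric] by fastforce
  qed
  moreover have "L h = 1 \<or> L h = -1" for h by (simp add: L_def)
  ultimately show ?thesis unfolding labelling_def by blast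
qed

lemma NLY_basis_if_parallel:
  assumes G: "mw_graph n es" "all_rank_one es" and he: "half_edges es ep d"
    and o: "\<And>u. u < n \<Longrightarrow> orthogonal_matrix (Ob u)"
    and L: "\<And>k. k < length es \<Longrightarrow> L (2 * k) = L (2 * k + 1)"
    and p: "\<And>h. h < 2 * length es \<Longrightarrow> parallel (d h) (bvec Ob (ep h) (if L h then 1 else 3))"
  shows "NLY_basis n es Ob"
  unfolding NLY_basis_iff[OF G]
proof (intro conjI allI impI)
  show "basis_assignment n Ob" using o by (simp add: basis_assignment_def)
  fix k assume k: "k < length es"
  have v: "ep (2 * k) < n" "ep (2 * k + 1) < n" using half_edges_vertex[OF he G(1)] k by auto
  have oe: "outer_edge (snd (snd (es ! k))) (d (2 * k)) (d (2 * k + 1))"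
    "fst (es ! k) = ep (2 * k)" "fst (snd (es ! k)) = ep (2 * k + 1)"
    using he k by (auto simp: half_edges_def)
  have "\<exists>i\<in>{1, 3}. parallel (d (2 * k)) (bvec Ob (ep (2 * k)) i) \<and>
      parallel (d (2 * k + 1)) (bvec Ob (ep (2 * k + 1)) i)"
    using p[of "2 * k"] p[of "2 * k + 1"] L[OF k] k by (intro bexI[of _ "if L (2 * k) then 1 else 3"]) auto
  then show "NLY_edge Ob (fst (es ! k)) (fst (snd (es ! k))) (snd (snd (es ! k)))"
    unfolding oe(2,3) NLY_edge_iff[of _ _ _ Ob, OF oe(1) o[OF v(1)] o[OF v(2)]] .
qed

text \<open>Union-find with signs: half-edges whose labels are forced to agree (to differ) carry equal
  (opposite) nonzero integers, and every labelling is an odd function of these integers.\<close>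

definition signed_merge :: "int \<Rightarrow> int \<Rightarrow> int \<Rightarrow> int" where
  "signed_merge x y z = (if z + y = 0 then - x else if z = y then x else z)"

text \<open>\<open>Q\<close> collects the pairs treated so far. On these \<open>f\<close> itself
  solves the constraints, with nonzero integers in place of the labels 1 and -1; the last conjunct
  guarantees that no solution has been lost.\<close>

definition signed_classes :: "nat \<Rightarrow> (nat \<Rightarrow> nat) \<Rightarrow> (nat \<Rightarrow> real^3) \<Rightarrow> (nat \<times> nat) set \<Rightarrow> (nat \<Rightarrow> int) \<Rightarrow> bool" where
  "signed_classes m ep d Q f \<longleftrightarrow> (\<forall>h<2 * m. f h \<noteq> 0) \<and> (\<forall>k<m. f (2 * k) = f (2 * k + 1)) \<and>
     (\<forall>(h, h')\<in>Q. compatible ep d h h' (f h) (f h')) \<and>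
     (\<forall>L. labelling m ep d L \<longrightarrow> (\<exists>\<phi>. (\<forall>z. \<phi> (- z) = - \<phi> z) \<and> (\<forall>h<2 * m. L h = \<phi> (f h))))"

text \<open>Every edge starts as its own class. The shift by one avoids 0, the only integer that
  equals its negative; \<open>\<phi>\<close> is the odd extension of the labels.\<close>

lemma signed_classes_init: "signed_classes m ep d {} (\<lambda>h. int (h div 2) + 1)"
proof -
  have "\<exists>\<phi>. (\<forall>z. \<phi> (- z) = - \<phi> z) \<and> (\<forall>h<2 * m. L h = \<phi> (int (h div 2) + 1))" if "labelling m ep d L" for L
  proof -
    define \<phi> where "\<phi> z = (if z > 0 then L (2 * nat (z - 1)) else if z = 0 then 0 else - L (2 * nat (- z - 1)))" for z :: int
    have "\<phi> (- z) = - \<phi> z" for z by (auto simp: \<phi>_def)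
    moreover have "L h = \<phi> (int (h div 2) + 1)" if "h < 2 * m" for h
      using that
    proof (rule half_edge_cases)
      fix k assume "k < m" "h = 2 * k \<or> h = 2 * k + 1"
      then show ?thesis using \<open>labelling m ep d L\<close> by (auto simp: \<phi>_def labelling_def)
    qed
    ultimately show ?thesis by blast
  qed
  then show ?thesis by (simp add: signed_classes_def)
qed

lemma signed_classes_skip:
  "signed_classes m ep d Q f \<Longrightarrow> ep h \<noteq> ep h' \<Longrightarrow> signed_classes m ep d (insert (h, h') Q) f"
  by (simp add: signed_classes_def compatible_def)

text \<open>The pair forces \<open>y\<close>, which is \<open>f h'\<close> up to sign, to have the
  same label as \<open>f h\<close>. If they are opposite, oddness makes the label of
  \<open>h\<close> equal to its negative, hence 0. Otherwise \<open>y\<close> is renamed to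
  \<open>f h\<close> and \<open>- y\<close> to \<open>- f h\<close>; the renaming is odd on nonzero
  integers, so compatibilities established earlier survive.\<close>

lemma signed_classes_merge:
  assumes s: "signed_classes m ep d Q f" and h: "h < 2 * m" "h' < 2 * m" and eq: "ep h = ep h'"
    and Q: "Q \<subseteq> {..<2 * m} \<times> {..<2 * m}"
    and y: "d h \<bullet> d h' = 0 \<and> y = - f h' \<or> (d h \<bullet> d h')\<^sup>2 = 1 \<and> y = f h'"
  shows "f h + y \<noteq> 0 \<Longrightarrow> signed_classes m ep d (insert (h, h') Q) (\<lambda>g. signed_merge (f h) y (f g))"
    and "f h + y = 0 \<Longrightarrow> \<not> labelling m ep d L"
proof -
  have f0: "f g \<noteq> 0" if "g < 2 * m" for g using s that by (auto simp: signed_classes_def)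
  have y0: "y \<noteq> 0" using y f0 h by auto
  have phi: "\<phi> (f h) = \<phi> y" if "labelling m ep d L" "\<And>z. \<phi> (- z) = - \<phi> z" "\<And>h. h < 2 * m \<Longrightarrow> L h = \<phi> (f h)" for \<phi> L
  proof -
    have "compatible ep d h h' (L h) (L h')" using that(1) h by (simp add: labelling_def)
    then have "L h = L h' \<and> y = f h' \<or> L h = - L h' \<and> y = - f h'" using eq y by (auto simp: compatible_def)
    then show ?thesis using that(2)[of "f h'"] that(3)[OF h(1)] that(3)[OF h(2)] by auto
  qed
  {
    assume ne: "f h + y \<noteq> 0"
    have odd: "signed_merge (f h) y (- z) = - signed_merge (f h) y z" if "z \<noteq> 0" for z
      using y0 that by (auto simp: signed_merge_def)
    have "signed_merge (f h) y (f g) \<noteq> 0" if "g < 2 * m" for g using f0 h that by (auto simp: signed_merge_def)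
    moreover have "compatible ep d g g' (signed_merge (f h) y (f g)) (signed_merge (f h) y (f g'))" if "(g, g') \<in> Q" for g g'
      using s that Q f0[of g'] odd[of "f g'"] by (fastforce simp: signed_classes_def compatible_def)
    moreover have "compatible ep d h h' (signed_merge (f h) y (f h)) (signed_merge (f h) y (f h'))"
    proof -
      have "signed_merge (f h) y (f h) = f h" "signed_merge (f h) y y = f h" using ne y0 by (auto simp: signed_merge_def)
      then show ?thesis using y odd[OF y0] by (auto simp: compatible_def)
    qed
    moreover have "\<exists>\<phi>. (\<forall>z. \<phi> (- z) = - \<phi> z) \<and> (\<forall>g<2 * m. L g = \<phi> (signed_merge (f h) y (f g)))" if L: "labelling m ep d L" for L
    proof -
      obtain \<phi> where \<phi>: "\<And>z. \<phi> (- z) = - \<phi> z" "\<And>h. h < 2 * m \<Longrightarrow> L h = \<phi> (f h)"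
        using s L unfolding signed_classes_def by blast
      \<comment> \<open>The old \<open>\<phi>\<close> already agrees on the two values being
        identified, so it also factors the labelling through the renamed classes.\<close>
      have "\<phi> (signed_merge (f h) y z) = \<phi> z" for z
        using phi[OF L \<phi>] \<phi>(1)[of "f h"] \<phi>(1)[of y] by (auto simp: signed_merge_def add_eq_0_iff)
      then show ?thesis using \<phi> by metis
    qed
    ultimately show "signed_classes m ep d (insert (h, h') Q) (\<lambda>g. signed_merge (f h) y (f g))"
      using s by (auto simp: signed_classes_def)
  }
  {
    assume e: "f h + y = 0"
    show "\<not> labelling m ep d L"
    proof
      assume L: "labelling m ep d L"
      then obtain \<phi> where \<phi>: "\<And>z. \<phi> (- z) = - \<phi> z" "\<And>h. h < 2 * m \<Longrightarrow> L h = \<phi> (f h)"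
        using s unfolding signed_classes_def by blast
      have "\<phi> (f h) = 0" using phi[OF L \<phi>] \<phi>(1)[of y] e by (simp add: add_eq_0_iff)
      then have "L h = 0" using \<phi> h by auto
      then show False using L h by (auto simp: labelling_def)
    qed
  }
qed

section \<open>Completion to an orthonormal basis\<close>

text \<open>A quarter turn of the projection to the first two coordinates. If the projection
  vanishes, the first unit vector is orthogonal; this includes \<open>w = 0\<close>.\<close>

definition perp :: "real^3 \<Rightarrow> real^3" where
  "perp w = (let r = w$1 * w$1 + w$2 * w$2 in
     if r \<le> 0 then vec3 1 0 0 else vec3 ((0 - w$2) / sqrt r) (w$1 / sqrt r) 0)"

lemma perp: "norm (perp w) = 1" "w \<bullet> perp w = 0"
proof -
  define r where "r = w$1 * w$1 + w$2 * w$2"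
  have "norm (perp w) = 1 \<and> w \<bullet> perp w = 0"
  proof (cases "r \<le> 0")
    case True
    then have "w $ 1 = 0" unfolding r_def by (smt (verit) not_real_square_gt_zero zero_le_square)
    moreover have "perp w = vec3 1 0 0" using True by (simp add: perp_def Let_def flip: r_def)
    ultimately show ?thesis by (simp add: inner_3 norm_eq_1)
  next
    case False
    then have p: "perp w = vec3 ((0 - w$2) / sqrt r) (w$1 / sqrt r) 0" by (simp add: perp_def Let_def flip: r_def)
    have "sqrt r * sqrt r = r" "sqrt r \<noteq> 0" using False by simp_all
    then show ?thesis using False unfolding p
      by (simp add: inner_3 norm_eq_1 field_simps) (simp add: r_def)
  qed
  then show "norm (perp w) = 1" "w \<bullet> perp w = 0" by auto
qed

text \<open>The zero vector encodes a direction prescribed by no half-edge.\<close>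

definition fill_in :: "real^3 \<Rightarrow> real^3 \<Rightarrow> real^3" where
  "fill_in p q = (if p \<bullet> p \<le> 0 then perp q else p)"

text \<open>The second column may be any unit vector orthogonal to the other two; the cross product
  supplies one without divisions or roots.\<close>

definition frame :: "real^3 \<Rightarrow> real^3 \<Rightarrow> real^3^3" where
  "frame p q = (\<chi> i j. (if j = 1 then p else if j = 2 then cross3 p q else q) $ i)"

lemma column_frame: "column 1 (frame p q) = p" "column 2 (frame p q) = cross3 p q" "column 3 (frame p q) = q"
  by (simp_all add: column_def frame_def vec_eq_iff)

lemma orthogonal_frame:
  assumes "norm p = 1" "norm q = 1" "p \<bullet> q = 0"
  shows "orthogonal_matrix (frame p q)"
proof -
  have "(norm (cross3 p q))\<^sup>2 = 1" using norm_cross_dot[of p q] assms by simp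
  then have "norm (cross3 p q) = 1" using norm_ge_zero[of "cross3 p q"] by (auto simp: power2_eq_1_iff)
  then show ?thesis using assms dot_cross_self[of p q]
    unfolding orthogonal_matrix_orthonormal_columns forall_3 column_frame
    by (auto simp: orthogonal_def inner_commute)
qed

section \<open>The algorithm\<close>

primrec seqs :: "cmd list \<Rightarrow> cmd" where
  "seqs [] = Skip"
| "seqs (c # cs) = Seq c (seqs cs)"

text \<open>Multiplication by a constant, unfolded into additions. Nesting to the left lets two
  stack cells suffice for a variable, whatever the factor.\<close>

primrec itimes :: "nat \<Rightarrow> iexp \<Rightarrow> iexp" where
  "itimes 0 e = IC 0"
| "itimes (Suc k) e = IPlus (itimes k e) e"

definition idx :: "nat \<Rightarrow> nat \<Rightarrow> nat \<Rightarrow> iexp" where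
  "idx a x b = IPlus (itimes a (IV x)) (IC (int b))"

abbreviation IfEq :: "iexp \<Rightarrow> iexp \<Rightarrow> cmd \<Rightarrow> cmd" where
  "IfEq e f c \<equiv> IfI e f (IfI f e c Skip) Skip"

lemma ieval_itimes: "ieval (itimes k e) s = int k * ieval e s"
  by (induction k) (simp_all add: algebra_simps)

lemma nat_ieval_idx [simp]: "0 \<le> ivar s x \<Longrightarrow> nat (ieval (idx a x b) s) = a * nat (ivar s x) + b"
  by (simp add: idx_def ieval_itimes nat_add_distrib nat_mult_distrib)

lemma iwf_itimes: "iwf d e \<Longrightarrow> iwf (Suc d) e \<Longrightarrow> d < 40 \<Longrightarrow> iwf d (itimes k e)"
  by (induction k) simp_all

lemma iwf_idx [simp]: "x < 17 \<Longrightarrow> d < 39 \<Longrightarrow> iwf d (idx a x b)"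
  by (simp add: idx_def iwf_itimes)

lemma iset_sel [simp]:
  "rvar (iset x v s) = rvar s" "iarr (iset x v s) = iarr s" "rarr (iset x v s) = rarr s"
  by (simp_all add: iset_def)

declare ivar_iset [simp]

text \<open>Induction on the rounds. \<open>Inv k\<close> refers to the state with the counter
  already set to \<open>k\<close>, hence the \<open>iset\<close> around the body in the
  step.\<close>

lemma sem_For:
  assumes "Inv 0 (iset x 0 s)" "ivar s l = int N" "x \<notin> mods c"
    and step: "\<And>k t. k < N \<Longrightarrow> Inv k t \<Longrightarrow> ivar t x = int k \<Longrightarrow> Inv (Suc k) (iset x (int (Suc k)) (sem c t))"
  shows "Inv N (sem (For x l c) s)"
proof -
  have "k \<le> N \<Longrightarrow> Inv k (((\<lambda>s. iset x (ivar (sem c s) x + 1) (sem c s)) ^^ k) (iset x 0 s)) \<and>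
    ivar (((\<lambda>s. iset x (ivar (sem c s) x + 1) (sem c s)) ^^ k) (iset x 0 s)) x = int k" for k
  proof (induction k)
    case 0
    then show ?case using assms(1) by simp
  next
    case (Suc k)
    then show ?case
      using step[of k "((\<lambda>s. iset x (ivar (sem c s) x + 1) (sem c s)) ^^ k) (iset x 0 s)"] ivar_sem[OF assms(3)]
      by (simp add: add.commute)
  qed
  then show ?thesis using assms(2) by simp
qed

text \<open>Integer array 0 holds the vertices of the half-edges and integer array 1 their signed classes;
  real arrays 0, 1, 2 hold the edge weights, the output and the directions of the half-edges.
  Integer variable 3 is the answer.\<close>

definition dir_at :: "hstate \<Rightarrow> nat \<Rightarrow> real^3" where
  "dir_at s h = vec3 (rarr s 2 (3 * h)) (rarr s 2 (3 * h + 1)) (rarr s 2 (3 * h + 2))"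

definition rvec :: "hstate \<Rightarrow> nat \<Rightarrow> real^3" where
  "rvec s a = vec3 (rvar s a) (rvar s (a + 1)) (rvar s (a + 2))"

definition square_sum :: "nat \<Rightarrow> rexp" where
  "square_sum a = RPlus (RPlus (RTimes (RV a) (RV a)) (RTimes (RV (a + 1)) (RV (a + 1))))
     (RTimes (RV (a + 2)) (RV (a + 2)))"

lemma reval_square_sum: "reval (square_sum a) s = rvec s a \<bullet> rvec s a"
  by (simp add: square_sum_def rvec_def inner_3)

section \<open>Extracting the edge directions\<close>

text \<open>Variable 4 is the edge, \<open>e\<close> selects its end, and \<open>i\<close>,
  \<open>j\<close>, \<open>k\<close> are row-major positions of a column or row of the weight. Each
  half-edge owns three cells, so edge \<open>k\<close> starts at \<open>6 * k\<close>.\<close>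

definition pick_cmd :: "nat \<Rightarrow> nat \<Rightarrow> nat \<Rightarrow> nat \<Rightarrow> cmd" where
  "pick_cmd e i j k = seqs [RAsg 0 (RArr 0 (idx 9 4 i)), RAsg 1 (RArr 0 (idx 9 4 j)), RAsg 2 (RArr 0 (idx 9 4 k)),
     RAsg 3 (square_sum 0),
     IfR (RV 3) (RC 0) Skip (seqs [RAsg 3 (RRoot (RV 3)),
       RSet 2 (idx 6 4 (3 * e)) (RDivide (RV 0) (RV 3)),
       RSet 2 (idx 6 4 (3 * e + 1)) (RDivide (RV 1) (RV 3)),
       RSet 2 (idx 6 4 (3 * e + 2)) (RDivide (RV 2) (RV 3))])]"

lemma sem_pick_cmd:
  fixes e i0 i1 i2 :: nat
  assumes "ivar s 4 = int k"
  defines "t \<equiv> sem (pick_cmd e i0 i1 i2) s"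
  shows "ivar t = ivar s" "iarr t = iarr s" "rarr t 0 = rarr s 0"
    "dir_at t h = (if h = 2 * k + e
       then pick (dir_at s h) (vec3 (rarr s 0 (9 * k + i0)) (rarr s 0 (9 * k + i1)) (rarr s 0 (9 * k + i2)))
       else dir_at s h)"
proof -
  define w where "w = vec3 (rarr s 0 (9 * k + i0)) (rarr s 0 (9 * k + i1)) (rarr s 0 (9 * k + i2))"
  define u where "u = sem (seqs [RAsg 0 (RArr 0 (idx 9 4 i0)), RAsg 1 (RArr 0 (idx 9 4 i1)), RAsg 2 (RArr 0 (idx 9 4 i2)),
     RAsg 3 (square_sum 0)]) s"
  have u: "ivar u = ivar s" "iarr u = iarr s" "rarr u = rarr s" "rvar u 3 = w \<bullet> w"
    "rvar u 0 = w $ 1" "rvar u 1 = w $ 2" "rvar u 2 = w $ 3"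
    using assms(1) by (simp_all add: u_def w_def reval_square_sum rvec_def)
  have t: "t = sem (IfR (RV 3) (RC 0) Skip (seqs [RAsg 3 (RRoot (RV 3)),
       RSet 2 (idx 6 4 (3 * e)) (RDivide (RV 0) (RV 3)),
       RSet 2 (idx 6 4 (3 * e + 1)) (RDivide (RV 1) (RV 3)),
       RSet 2 (idx 6 4 (3 * e + 2)) (RDivide (RV 2) (RV 3))])) u"
    by (simp add: t_def u_def pick_cmd_def)
  show "ivar t = ivar s" "iarr t = iarr s" "rarr t 0 = rarr s 0" using u assms(1) by (auto simp: t)
  have d: "dir_at u h = dir_at s h" by (simp add: dir_at_def u)
  show "dir_at t h = (if h = 2 * k + e then pick (dir_at s h) w else dir_at s h)"
  proof (cases "w \<bullet> w \<le> 0")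
    case True
    then have "t = u" using u by (simp add: t)
    then show ?thesis using True d by (simp add: pick_def)
  next
    case False
    let ?i = "3 * (2 * k + e)"
    have "rarr t 2 = (rarr s 2)(?i := w $ 1 / norm w, ?i + 1 := w $ 2 / norm w, ?i + 2 := w $ 3 / norm w)"
      using False u assms(1) by (simp add: t norm_eq_sqrt_inner algebra_simps)
    moreover have "3 * h \<noteq> ?i + 1" "3 * h \<noteq> ?i + 2" "3 * h + 1 \<noteq> ?i" "3 * h + 1 \<noteq> ?i + 2"
      "3 * h + 2 \<noteq> ?i" "3 * h + 2 \<noteq> ?i + 1" by presburger+
    ultimately have "dir_at t h = (if h = 2 * k + e then vec3 (w $ 1 / norm w) (w $ 2 / norm w) (w $ 3 / norm w) else dir_at s h)"
      by (auto simp: dir_at_def)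
    moreover have "vec3 (w $ 1 / norm w) (w $ 2 / norm w) (w $ 3 / norm w) = w /\<^sub>R norm w"
      by (simp add: vec_eq_iff forall_3 field_simps)
    ultimately show ?thesis using False by (simp add: pick_def)
  qed
qed

definition dirs_body :: cmd where
  "dirs_body = seqs [pick_cmd 0 0 3 6, pick_cmd 0 1 4 7, pick_cmd 0 2 5 8,
     pick_cmd 1 0 1 2, pick_cmd 1 3 4 5, pick_cmd 1 6 7 8,
     ISet 1 (idx 2 4 0) (IPlus (IV 4) (IC 1)), ISet 1 (idx 2 4 1) (IPlus (IV 4) (IC 1))]"

definition input_state :: "nat \<Rightarrow> mwgraph_edges \<Rightarrow> hstate \<Rightarrow> bool" where
  "input_state n es s \<longleftrightarrow> ivar s 0 = int n \<and> ivar s 1 = int (length es) \<and> ivar s 2 = int (2 * length es) \<and>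
     (\<forall>k<length es. iarr s 0 (2 * k) = int (fst (es ! k)) \<and> iarr s 0 (2 * k + 1) = int (fst (snd (es ! k)))) \<and>
     (\<forall>k<length es. \<forall>i<9. rarr s 0 (9 * k + i) = snd (snd (es ! k)) $ ix3 (i div 3) $ ix3 (i mod 3))"

text \<open>Nothing is assumed about the previous content of the direction array: a rank-one matrix
  has a nonzero column and a nonzero row, so both directions are overwritten.\<close>

lemma sem_dirs_body:
  assumes s: "input_state n es s" "ivar s 4 = int k" "k < length es" "rank (snd (snd (es ! k))) = 1"
  defines "t \<equiv> sem dirs_body s"
  shows "ivar t = ivar s" "iarr t 0 = iarr s 0" "rarr t 0 = rarr s 0"
    "iarr t 1 = (iarr s 1)(2 * k := int k + 1, 2 * k + 1 := int k + 1)"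
    "outer_edge (snd (snd (es ! k))) (dir_at t (2 * k)) (dir_at t (2 * k + 1))"
    "h \<noteq> 2 * k \<Longrightarrow> h \<noteq> 2 * k + 1 \<Longrightarrow> dir_at t h = dir_at s h"
proof -
  define B where "B = snd (snd (es ! k))"
  define s1 where "s1 = sem (pick_cmd 0 0 3 6) s"
  define s2 where "s2 = sem (pick_cmd 0 1 4 7) s1"
  define s3 where "s3 = sem (pick_cmd 0 2 5 8) s2"
  define s4 where "s4 = sem (pick_cmd 1 0 1 2) s3"
  define s5 where "s5 = sem (pick_cmd 1 3 4 5) s4"
  define s6 where "s6 = sem (pick_cmd 1 6 7 8) s5"
  have t: "t = sem (seqs [ISet 1 (idx 2 4 0) (IPlus (IV 4) (IC 1)), ISet 1 (idx 2 4 1) (IPlus (IV 4) (IC 1))]) s6"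
    by (simp add: t_def dirs_body_def s1_def s2_def s3_def s4_def s5_def s6_def)
  have M: "rarr s 0 (9 * k + i) = B $ ix3 (i div 3) $ ix3 (i mod 3)" if "i < 9" for i
    using s(1,3) that by (simp add: input_state_def B_def)
  have M': "rarr s 0 (9 * k + 0) = B $ 1 $ 1" "rarr s 0 (9 * k + 1) = B $ 1 $ 2" "rarr s 0 (9 * k + 2) = B $ 1 $ 3"
    "rarr s 0 (9 * k + 3) = B $ 2 $ 1" "rarr s 0 (9 * k + 4) = B $ 2 $ 2" "rarr s 0 (9 * k + 5) = B $ 2 $ 3"
    "rarr s 0 (9 * k + 6) = B $ 3 $ 1" "rarr s 0 (9 * k + 7) = B $ 3 $ 2" "rarr s 0 (9 * k + 8) = B $ 3 $ 3"
    by (subst M; simp add: ix3_def)+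
  have C: "vec3 (B $ 1 $ j) (B $ 2 $ j) (B $ 3 $ j) = column j B" for j
    by (simp add: column_def vec_eq_iff forall_3)
  have R: "vec3 (B $ j $ 1) (B $ j $ 2) (B $ j $ 3) = row j B" for j
    by (simp add: row_def vec_eq_iff forall_3)
  note p1 = sem_pick_cmd[OF s(2), of 0 0 3 6, folded s1_def, unfolded M' C]
  have 1: "ivar s1 4 = int k" using p1 s by simp
  note p2 = sem_pick_cmd[OF 1, of 0 1 4 7, folded s2_def, unfolded p1(1,2,3) M' C]
  have 2: "ivar s2 4 = int k" using p2 s by simp
  note p3 = sem_pick_cmd[OF 2, of 0 2 5 8, folded s3_def, unfolded p2(1,2,3) M' C]
  have 3: "ivar s3 4 = int k" using p3 s by simp
  note p4 = sem_pick_cmd[OF 3, of 1 0 1 2, folded s4_def, unfolded p3(1,2,3) M' R]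
  have 4: "ivar s4 4 = int k" using p4 s by simp
  note p5 = sem_pick_cmd[OF 4, of 1 3 4 5, folded s5_def, unfolded p4(1,2,3) M' R]
  have 5: "ivar s5 4 = int k" using p5 s by simp
  note p6 = sem_pick_cmd[OF 5, of 1 6 7 8, folded s6_def, unfolded p5(1,2,3) M' R]
  have d: "dir_at t h = dir_at s6 h" for h by (simp add: t dir_at_def)
  show "ivar t = ivar s" "iarr t 0 = iarr s 0" "rarr t 0 = rarr s 0"
    "iarr t 1 = (iarr s 1)(2 * k := int k + 1, 2 * k + 1 := int k + 1)"
    using s(2) by (simp_all add: t p6)
  show "dir_at t h = dir_at s h" if "h \<noteq> 2 * k" "h \<noteq> 2 * k + 1"
    using that by (simp add: d p6 p5 p4 p3 p2 p1)
  have "dir_at t (2 * k) = pick (pick (pick (dir_at s (2 * k)) (column 1 B)) (column 2 B)) (column 3 B)"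
    "dir_at t (2 * k + 1) = pick (pick (pick (dir_at s (2 * k + 1)) (row 1 B)) (row 2 B)) (row 3 B)"
    by (simp_all add: d p6 p5 p4 p3 p2 p1)
  then show "outer_edge (snd (snd (es ! k))) (dir_at t (2 * k)) (dir_at t (2 * k + 1))"
    using outer_edge_pick[OF s(4)] by (simp add: B_def)
qed

lemma mods_pick_cmd [simp]: "mods (pick_cmd e i j k) = {}" "mods dirs_body = {}"
  by (simp_all add: pick_cmd_def dirs_body_def)

lemma sem_dirs:
  assumes "input_state n es s" "ivar s 3 = 1" "all_rank_one es"
  defines "t \<equiv> sem (For 4 1 dirs_body) s"
  shows "input_state n es t" "ivar t 3 = 1"
    "\<forall>k<length es. outer_edge (snd (snd (es ! k))) (dir_at t (2 * k)) (dir_at t (2 * k + 1))"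
    "\<forall>h<2 * length es. iarr t 1 h = int (h div 2) + 1"
proof -
  let ?Inv = "\<lambda>k t. input_state n es t \<and> ivar t 3 = 1 \<and>
    (\<forall>j<k. outer_edge (snd (snd (es ! j))) (dir_at t (2 * j)) (dir_at t (2 * j + 1)) \<and>
      iarr t 1 (2 * j) = int j + 1 \<and> iarr t 1 (2 * j + 1) = int j + 1)"
  have *: "?Inv (length es) t"
    unfolding t_def
  proof (rule sem_For[where Inv = ?Inv])
    show "?Inv 0 (iset 4 0 s)" using assms by (simp add: input_state_def)
    show "ivar s 1 = int (length es)" using assms by (simp add: input_state_def)
    show "4 \<notin> mods dirs_body" by simp
    fix k t assume k: "k < length es" and I: "?Inv k t" and "ivar t 4 = int k"
    then have s: "input_state n es t" "ivar t 4 = int k" "k < length es" "rank (snd (snd (es ! k))) = 1"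
      using assms(3) nth_mem[OF k] by (auto simp: all_rank_one_def case_prod_beta)
    note b = sem_dirs_body[OF s]
    let ?t = "iset 4 (int (Suc k)) (sem dirs_body t)"
    have d: "dir_at ?t h = dir_at (sem dirs_body t) h" for h by (simp add: dir_at_def)
    have "outer_edge (snd (snd (es ! j))) (dir_at ?t (2 * j)) (dir_at ?t (2 * j + 1)) \<and>
      iarr ?t 1 (2 * j) = int j + 1 \<and> iarr ?t 1 (2 * j + 1) = int j + 1" if "j < Suc k" for j
    proof (cases "j = k")
      case True
      then show ?thesis using b(4,5) unfolding d by simp
    next
      case False
      then have "j < k" "2 * j \<noteq> 2 * k" "2 * j \<noteq> 2 * k + 1" "2 * j + 1 \<noteq> 2 * k" "2 * j + 1 \<noteq> 2 * k + 1"
        using that by presburger+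
      then show ?thesis using I b(4) b(6)[of "2 * j"] b(6)[of "2 * j + 1"] unfolding d by simp
    qed
    then show "?Inv (Suc k) ?t" using I b(1-3) by (simp add: input_state_def)
  qed
  then show "input_state n es t" "ivar t 3 = 1"
    "\<forall>k<length es. outer_edge (snd (snd (es ! k))) (dir_at t (2 * k)) (dir_at t (2 * k + 1))" by auto
  show "\<forall>h<2 * length es. iarr t 1 h = int (h div 2) + 1"
  proof (intro allI impI)
    fix h assume "h < 2 * length es"
    then show "iarr t 1 h = int (h div 2) + 1"
      by (rule half_edge_cases) (use * in auto)
  qed
qed

section \<open>Solving the label constraints\<close>

definition env :: "nat \<Rightarrow> nat \<Rightarrow> (nat \<Rightarrow> nat) \<Rightarrow> (nat \<Rightarrow> real^3) \<Rightarrow> hstate \<Rightarrow> bool" where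
  "env n m ep d s \<longleftrightarrow> ivar s 0 = int n \<and> ivar s 1 = int m \<and> ivar s 2 = int (2 * m) \<and>
     (\<forall>h<2 * m. iarr s 0 h = int (ep h)) \<and> (\<forall>h<2 * m. dir_at s h = d h)"

lemma env_iset [simp]: "3 \<le> x \<Longrightarrow> env n m ep d (iset x v s) \<longleftrightarrow> env n m ep d s"
  by (simp add: env_def dir_at_def)

lemma env_rvar [simp]: "env n m ep d (s\<lparr>rvar := r\<rparr>) \<longleftrightarrow> env n m ep d s"
  by (simp add: env_def dir_at_def)

lemma env_iarr [simp]: "a 0 = iarr s 0 \<Longrightarrow> env n m ep d (s\<lparr>iarr := a\<rparr>) \<longleftrightarrow> env n m ep d s"
  by (simp add: env_def dir_at_def)

lemma env_cong:
  "ivar t = ivar s \<Longrightarrow> iarr t = iarr s \<Longrightarrow> rarr t 2 = rarr s 2 \<Longrightarrow> env n m ep d t \<longleftrightarrow> env n m ep d s"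
  by (simp add: env_def dir_at_def)

text \<open>Variable 10 caches the old class, so the second test does not see the update made by the
  first one.\<close>

definition merge_body :: cmd where
  "merge_body = seqs [IAsg 10 (IArr 1 (IV 6)), IfEq (IV 10) (IV 8) (ISet 1 (IV 6) (IV 7)),
     IfEq (IPlus (IV 10) (IV 8)) (IC 0) (ISet 1 (IV 6) (IMinus (IC 0) (IV 7)))]"

lemma sem_merge:
  assumes "env n m ep d s" "ivar s 7 = x" "ivar s 8 = y" "ivar s 3 = r"
  defines "t \<equiv> sem (For 6 2 merge_body) s"
  shows "env n m ep d t" "ivar t 3 = r" "\<forall>g<2 * m. iarr t 1 g = signed_merge x y (iarr s 1 g)"
proof -
  let ?Inv = "\<lambda>k t. env n m ep d t \<and> ivar t 7 = x \<and> ivar t 8 = y \<and> ivar t 3 = r \<and>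
    (\<forall>g. iarr t 1 g = (if g < k then signed_merge x y (iarr s 1 g) else iarr s 1 g))"
  have "?Inv (2 * m) t"
    unfolding t_def
  proof (rule sem_For[where Inv = ?Inv])
    show "?Inv 0 (iset 6 0 s)" using assms by simp
    show "ivar s 2 = int (2 * m)" using assms by (simp add: env_def)
    show "6 \<notin> mods merge_body" by (simp add: merge_body_def)
    fix k t assume k: "k < 2 * m" and I: "?Inv k t" and t: "ivar t 6 = int k"
    let ?t = "sem merge_body t"
    have "iarr ?t 1 = (iarr t 1)(k := signed_merge x y (iarr t 1 k))"
      using I t by (auto simp: merge_body_def signed_merge_def fun_eq_iff add_eq_0_iff)
    moreover have "env n m ep d ?t" "ivar ?t 7 = x" "ivar ?t 8 = y" "ivar ?t 3 = r"
      using I t by (auto simp: merge_body_def)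
    ultimately show "?Inv (Suc k) (iset 6 (int (Suc k)) ?t)"
      using I by (auto simp: less_Suc_eq)
  qed
  then show "env n m ep d t" "ivar t 3 = r" "\<forall>g<2 * m. iarr t 1 g = signed_merge x y (iarr s 1 g)" by auto
qed

definition dot_exp :: rexp where
  "dot_exp = RPlus (RPlus (RTimes (RArr 2 (idx 3 9 0)) (RArr 2 (idx 3 5 0)))
       (RTimes (RArr 2 (idx 3 9 1)) (RArr 2 (idx 3 5 1)))) (RTimes (RArr 2 (idx 3 9 2)) (RArr 2 (idx 3 5 2)))"

text \<open>The square of an inner product of unit vectors lies between 0 and 1, so two inequalities
  decide orthogonality and parallelism exactly. The answer is only ever changed to 0, which makes a
  failure permanent.\<close>

definition test_cmd :: cmd where
  "test_cmd = seqs [RAsg 0 dot_exp, IAsg 7 (IArr 1 (IV 9)), IAsg 8 (IArr 1 (IV 5)),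
     IfR (RTimes (RV 0) (RV 0)) (RC 0) (IAsg 8 (IMinus (IC 0) (IV 8)))
       (IfR (RC 1) (RTimes (RV 0) (RV 0)) Skip (IAsg 3 (IC 0))),
     IfEq (IPlus (IV 7) (IV 8)) (IC 0) (IAsg 3 (IC 0))]"

lemma sem_test:
  assumes "env n m ep d s" "ivar s 9 = int h" "ivar s 5 = int h'" "h < 2 * m" "h' < 2 * m"
  defines "t \<equiv> sem test_cmd s" and "c \<equiv> d h \<bullet> d h'"
  defines "y \<equiv> (if c * c \<le> 0 then - iarr s 1 h' else iarr s 1 h')"
  shows "env n m ep d t" "ivar t 7 = iarr s 1 h" "ivar t 8 = y" "iarr t = iarr s"
    "ivar t 3 = (if \<not> c * c \<le> 0 \<and> \<not> 1 \<le> c * c \<or> iarr s 1 h + y = 0 then 0 else ivar s 3)"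
proof -
  have "dir_at s h = d h" "dir_at s h' = d h'" using assms by (auto simp: env_def)
  then have c: "reval dot_exp s = c"
    unfolding c_def using assms(2,3) by (simp add: dot_exp_def inner_3 flip: \<open>dir_at s h = d h\<close> \<open>dir_at s h' = d h'\<close>)
      (simp add: dir_at_def)
  show "env n m ep d t" "ivar t 7 = iarr s 1 h" "ivar t 8 = y" "iarr t = iarr s"
    "ivar t 3 = (if \<not> c * c \<le> 0 \<and> \<not> 1 \<le> c * c \<or> iarr s 1 h + y = 0 then 0 else ivar s 3)"
    using assms(1-3) unfolding t_def test_cmd_def y_def by (simp_all add: c)
qed

lemma signed_classes_cong:
  assumes "signed_classes m ep d Q f" "Q \<subseteq> {..<2 * m} \<times> {..<2 * m}" "\<forall>g<2 * m. f g = f' g"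
  shows "signed_classes m ep d Q f'"
proof -
  have "f (2 * k) = f' (2 * k)" "f (2 * k + 1) = f' (2 * k + 1)" if "k < m" for k using assms(3) that by auto
  then show ?thesis using assms unfolding signed_classes_def by (fastforce simp: subset_iff)
qed

text \<open>There is no early exit. After a failure the loops run on, and the class array is then
  unconstrained.\<close>

definition search_state :: "nat \<Rightarrow> nat \<Rightarrow> (nat \<Rightarrow> nat) \<Rightarrow> (nat \<Rightarrow> real^3) \<Rightarrow> (nat \<times> nat) set \<Rightarrow> hstate \<Rightarrow> bool" where
  "search_state n m ep d Q s \<longleftrightarrow> env n m ep d s \<and>
     (ivar s 3 = 1 \<and> signed_classes m ep d Q (iarr s 1) \<or> ivar s 3 = 0 \<and> (\<nexists>L. labelling m ep d L))"

lemma search_state_iset [simp]: "3 < x \<Longrightarrow> search_state n m ep d Q (iset x v s) \<longleftrightarrow> search_state n m ep d Q s"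
  by (simp add: search_state_def)

definition pair_body :: cmd where
  "pair_body = IfEq (IArr 0 (IV 9)) (IArr 0 (IV 5)) (Seq test_cmd (For 6 2 merge_body))"

lemma sem_pair_body:
  assumes s: "search_state n m ep d Q s" and h: "ivar s 9 = int h" "ivar s 5 = int h'" "h < 2 * m" "h' < 2 * m"
    and Q: "Q \<subseteq> {..<2 * m} \<times> {..<2 * m}" and norm: "\<And>h. h < 2 * m \<Longrightarrow> norm (d h) = 1"
  shows "search_state n m ep d (insert (h, h') Q) (sem pair_body s)"
proof (cases "ep h = ep h'")
  case False
  have "iarr s 0 h = int (ep h)" "iarr s 0 h' = int (ep h')" using s h by (auto simp: search_state_def env_def)
  then have "sem pair_body s = s" using False h by (simp add: pair_body_def)
  then show ?thesis using s signed_classes_skip[where ep = ep, OF _ False] by (auto simp: search_state_def)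
next
  case True
  have e: "env n m ep d s" using s by (simp add: search_state_def)
  have "iarr s 0 h = int (ep h)" "iarr s 0 h' = int (ep h')" using e h by (auto simp: env_def)
  then have b: "sem pair_body s = sem (For 6 2 merge_body) (sem test_cmd s)"
    using True h by (simp add: pair_body_def del: sem.simps(9))
  let ?t = "sem pair_body s" and ?f = "iarr s 1"
  define c where "c = d h \<bullet> d h'"
  define y where "y = (if c * c \<le> 0 then - ?f h' else ?f h')"
  note a = sem_test[OF e h, folded c_def, folded y_def]
  note t = sem_merge[OF a(1,2,3) refl, folded b, unfolded a(4)]
  consider "\<not> c * c \<le> 0 \<and> \<not> 1 \<le> c * c" | "?f h + y = 0" "c * c \<le> 0 \<or> 1 \<le> c * c"
    | "?f h + y \<noteq> 0" "c * c \<le> 0 \<or> 1 \<le> c * c" by blast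
  then show ?thesis
  proof cases
    case 1
    then have "c \<noteq> 0" "c\<^sup>2 \<noteq> 1" by (auto simp: power2_eq_square)
    then have "\<not> labelling m ep d L" for L
      using h(3,4) True by (auto simp: labelling_def compatible_def c_def)
    moreover have "ivar ?t 3 = 0" using 1 t(2) a(5) by simp
    ultimately show ?thesis using t(1) by (simp add: search_state_def)
  next
    case 2
    \<comment> \<open>Cauchy-Schwarz turns the inequality tested by the program into the equality
      required for parallel directions.\<close>
    have cc: "c * c \<le> 1"
      using Cauchy_Schwarz_ineq[of "d h" "d h'"] norm h(3,4) by (simp add: c_def power2_eq_square norm_eq_1)
    have "c * c = 0 \<or> c * c = 1" using 2(2) cc zero_le_square[of c] by linarith
    then have y: "c = 0 \<and> y = - ?f h' \<or> c\<^sup>2 = 1 \<and> y = ?f h'" by (auto simp: y_def power2_eq_square)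
    have "\<nexists>L. labelling m ep d L"
      using s signed_classes_merge(2)[OF _ h(3,4) True Q y[unfolded c_def] 2(1)] by (auto simp: search_state_def)
    moreover have "ivar ?t 3 = 0" using 2 t(2) a(5) by simp
    ultimately show ?thesis using t(1) by (simp add: search_state_def)
  next
    case 3
    have cc: "c * c \<le> 1"
      using Cauchy_Schwarz_ineq[of "d h" "d h'"] norm h(3,4) by (simp add: c_def power2_eq_square norm_eq_1)
    have "c * c = 0 \<or> c * c = 1" using 3(2) cc zero_le_square[of c] by linarith
    then have y: "c = 0 \<and> y = - ?f h' \<or> c\<^sup>2 = 1 \<and> y = ?f h'" by (auto simp: y_def power2_eq_square)
    have r: "ivar ?t 3 = ivar s 3" using 3 t(2) a(5) by auto
    have "signed_classes m ep d (insert (h, h') Q) (iarr ?t 1)" if "signed_classes m ep d Q ?f"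
    proof (rule signed_classes_cong)
      show "signed_classes m ep d (insert (h, h') Q) (\<lambda>g. signed_merge (?f h) y (?f g))"
        by (rule signed_classes_merge(1)[OF that h(3,4) True Q y[unfolded c_def] 3(1)])
    qed (use Q h t(3) in auto)
    then show ?thesis using s t(1) r by (auto simp: search_state_def)
  qed
qed


lemma mods_pair_body: "mods pair_body = {3, 6, 7, 8, 10}"
  by (auto simp: pair_body_def test_cmd_def merge_body_def)

text \<open>Visiting all ordered pairs dispenses with adjacency lists. The pair of a half-edge with
  itself imposes a trivial constraint.\<close>

lemma sem_pairs:
  assumes "search_state n m ep d {} s" "\<And>h. h < 2 * m \<Longrightarrow> norm (d h) = 1"
  shows "search_state n m ep d ({..<2 * m} \<times> {..<2 * m}) (sem (For 9 2 (For 5 2 pair_body)) s)"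
proof (rule sem_For[where Inv = "\<lambda>k. search_state n m ep d ({..<k} \<times> {..<2 * m})"])
  show "search_state n m ep d ({..<0} \<times> {..<2 * m}) (iset 9 0 s)" using assms by simp
  show "ivar s 2 = int (2 * m)" using assms by (simp add: search_state_def env_def)
  show "9 \<notin> mods (For 5 2 pair_body)" by (simp add: mods_pair_body)
  fix k t
  assume k: "k < 2 * m" and t: "search_state n m ep d ({..<k} \<times> {..<2 * m}) t" "ivar t 9 = int k"
  let ?Q = "\<lambda>j. {..<k} \<times> {..<2 * m} \<union> {k} \<times> {..<j}"
  have "search_state n m ep d (?Q (2 * m)) (sem (For 5 2 pair_body) t) \<and> ivar (sem (For 5 2 pair_body) t) 9 = int k"
  proof (rule sem_For[where Inv = "\<lambda>j t. search_state n m ep d (?Q j) t \<and> ivar t 9 = int k"])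
    show "search_state n m ep d (?Q 0) (iset 5 0 t) \<and> ivar (iset 5 0 t) 9 = int k" using t by simp
    show "ivar t 2 = int (2 * m)" using t by (simp add: search_state_def env_def)
    show "5 \<notin> mods pair_body" by (simp add: mods_pair_body)
    fix j r
    assume j: "j < 2 * m" and r: "search_state n m ep d (?Q j) r \<and> ivar r 9 = int k" "ivar r 5 = int j"
    have "search_state n m ep d (insert (k, j) (?Q j)) (sem pair_body r)"
      using r j k assms(2) by (intro sem_pair_body) auto
    moreover have "insert (k, j) (?Q j) = ?Q (Suc j)" by auto
    moreover have "ivar (sem pair_body r) 9 = int k" using r ivar_sem[of 9 pair_body r] by (simp add: mods_pair_body)
    ultimately show "search_state n m ep d (?Q (Suc j)) (iset 5 (int (Suc j)) (sem pair_body r)) \<and>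
        ivar (iset 5 (int (Suc j)) (sem pair_body r)) 9 = int k" by simp
  qed
  moreover have "?Q (2 * m) = {..<Suc k} \<times> {..<2 * m}" by auto
  ultimately show "search_state n m ep d ({..<Suc k} \<times> {..<2 * m}) (iset 9 (int (Suc k)) (sem (For 5 2 pair_body) t))"
    by simp
qed

section \<open>Writing the basis at each vertex\<close>

definition perp_cmd :: "nat \<Rightarrow> nat \<Rightarrow> cmd" where
  "perp_cmd a b = seqs [RAsg 6 (RPlus (RTimes (RV b) (RV b)) (RTimes (RV (b + 1)) (RV (b + 1)))),
     IfR (RV 6) (RC 0) (seqs [RAsg a (RC 1), RAsg (a + 1) (RC 0), RAsg (a + 2) (RC 0)])
      (seqs [RAsg 6 (RRoot (RV 6)), RAsg a (RDivide (RMinus (RC 0) (RV (b + 1))) (RV 6)),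
         RAsg (a + 1) (RDivide (RV b) (RV 6)), RAsg (a + 2) (RC 0)])]"

definition fill_in_cmd :: "nat \<Rightarrow> nat \<Rightarrow> cmd" where
  "fill_in_cmd a b = IfR (square_sum a) (RC 0) (perp_cmd a b) Skip"

lemma sem_fill_in:
  fixes s :: hstate
  assumes "a = 0 \<and> b = 3 \<or> a = 3 \<and> b = 0"
  defines "t \<equiv> sem (fill_in_cmd a b) s"
  shows "ivar t = ivar s" "iarr t = iarr s" "rarr t = rarr s" "rvec t b = rvec s b"
    "rvec t a = fill_in (rvec s a) (rvec s b)"
proof -
  show "ivar t = ivar s" "iarr t = iarr s" "rarr t = rarr s"
    by (simp_all add: t_def fill_in_cmd_def perp_cmd_def)
  define r where "r = rvar s b * rvar s b + rvar s (b + 1) * rvar s (b + 1)"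
  have p: "perp (rvec s b) = (if r \<le> 0 then vec3 1 0 0
      else vec3 ((0 - rvar s (b + 1)) / sqrt r) (rvar s b / sqrt r) 0)"
    by (simp add: perp_def rvec_def r_def Let_def)
  have "rvar (sem (perp_cmd a b) s) = (if r \<le> 0 then (rvar s)(6 := r, a := 1, a + 1 := 0, a + 2 := 0)
      else (rvar s)(6 := sqrt r, a := (0 - rvar s (b + 1)) / sqrt r, a + 1 := rvar s b / sqrt r, a + 2 := 0))"
  proof -
    have n: "a \<noteq> 6" "b \<noteq> 6" "b + 1 \<noteq> 6" "b + 1 \<noteq> a" "b \<noteq> a" "b \<noteq> a + 1" using assms(1) by auto
    then show ?thesis by (simp add: perp_cmd_def r_def)
  qed
  then have q: "rvec (sem (perp_cmd a b) s) a = perp (rvec s b)" "rvec (sem (perp_cmd a b) s) b = rvec s b"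
    using assms(1) unfolding p by (auto simp: rvec_def)
  have "t = (if rvec s a \<bullet> rvec s a \<le> 0 then sem (perp_cmd a b) s else s)"
    by (simp add: t_def fill_in_cmd_def reval_square_sum)
  then show "rvec t b = rvec s b" "rvec t a = fill_in (rvec s a) (rvec s b)"
    using q by (simp_all add: fill_in_def)
qed

definition load_cmd :: "nat \<Rightarrow> cmd" where
  "load_cmd a = seqs [RAsg a (RArr 2 (idx 3 5 0)), RAsg (a + 1) (RArr 2 (idx 3 5 1)), RAsg (a + 2) (RArr 2 (idx 3 5 2))]"

definition collect_body :: cmd where
  "collect_body = IfEq (IArr 0 (IV 5)) (IV 9) (IfI (IC 1) (IArr 1 (IV 5)) (load_cmd 0) (load_cmd 3))"

definition write_list :: "(nat \<times> rexp) list \<Rightarrow> cmd" where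
  "write_list cs = seqs (map (\<lambda>(c, e). RSet 1 (idx 9 9 c) e) cs)"

primrec overwrite :: "nat \<Rightarrow> hstate \<Rightarrow> (nat \<times> rexp) list \<Rightarrow> (nat \<Rightarrow> real) \<Rightarrow> nat \<Rightarrow> real" where
  "overwrite u s [] f = f"
| "overwrite u s (x # cs) f = overwrite u s cs (f(9 * u + fst x := reval (snd x) s))"

lemma overwrite_cong:
  "(\<And>e. e \<in> snd ` set cs \<Longrightarrow> reval e s' = reval e s) \<Longrightarrow> overwrite u s' cs f = overwrite u s cs f"
  by (induction cs arbitrary: f) simp_all

text \<open>The values depend on the real variables only, which array writes leave alone; all of
  them may therefore be evaluated in the initial state.\<close>

lemma sem_write_list:
  assumes "ivar s 9 = int u" "\<And>e s'. e \<in> snd ` set cs \<Longrightarrow> rvar s' = rvar s \<Longrightarrow> reval e s' = reval e s"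
  defines "t \<equiv> sem (write_list cs) s"
  shows "ivar t = ivar s \<and> iarr t = iarr s \<and> rarr t 2 = rarr s 2 \<and> rarr t 1 = overwrite u s cs (rarr s 1)"
  using assms(1,2) unfolding t_def
proof (induction cs arbitrary: s)
  case Nil
  then show ?case by (simp add: write_list_def)
next
  case (Cons x cs)
  define s' where "s' = sem (RSet 1 (idx 9 9 (fst x)) (snd x)) s"
  have s': "ivar s' = ivar s" "iarr s' = iarr s" "rvar s' = rvar s" "rarr s' 2 = rarr s 2"
    "rarr s' 1 = (rarr s 1)(9 * u + fst x := reval (snd x) s)"
    using Cons.prems(1) by (simp_all add: s'_def)
  have e: "reval e s'' = reval e s'" if "e \<in> snd ` set cs" "rvar s'' = rvar s'" for e s''
  proof -
    have "e \<in> snd ` set (x # cs)" using that by auto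
    from Cons.prems(2)[OF this, of s''] Cons.prems(2)[OF this, of s'] that s'(3) show ?thesis by simp
  qed
  have "ivar s' 9 = int u" using Cons.prems(1) s' by simp
  note IH = Cons.IH[OF this e]
  have "reval e s' = reval e s" if "e \<in> snd ` set cs" for e
    using Cons.prems(2)[of e s'] that s'(3) by simp
  from overwrite_cong[OF this] have "overwrite u s' cs f = overwrite u s cs f" for f .
  moreover have "sem (write_list (x # cs)) s = sem (write_list cs) s'"
    by (simp add: write_list_def s'_def case_prod_beta)
  ultimately show ?case using IH s' by simp
qed

definition frame_entries :: "(nat \<times> rexp) list" where
  "frame_entries = [(0, RV 0), (3, RV 1), (6, RV 2),
     (1, RMinus (RTimes (RV 1) (RV 5)) (RTimes (RV 2) (RV 4))),
     (4, RMinus (RTimes (RV 2) (RV 3)) (RTimes (RV 0) (RV 5))),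
     (7, RMinus (RTimes (RV 0) (RV 4)) (RTimes (RV 1) (RV 3))),
     (2, RV 3), (5, RV 4), (8, RV 5)]"

definition write_cmd :: cmd where
  "write_cmd = write_list frame_entries"

definition out_frame :: "hstate \<Rightarrow> nat \<Rightarrow> real^3^3" where
  "out_frame s u = (\<chi> i j. rarr s 1 (9 * u + 3 * (if i = 1 then 0 else if i = 2 then 1 else 2)
      + (if j = 1 then 0 else if j = 2 then 1 else 2)))"

lemma sem_write:
  assumes "ivar s 9 = int u"
  defines "t \<equiv> sem write_cmd s"
  shows "ivar t = ivar s" "iarr t = iarr s" "rarr t 2 = rarr s 2" "out_frame t u = frame (rvec s 0) (rvec s 3)"
    "u' \<noteq> u \<Longrightarrow> out_frame t u' = out_frame s u'"
proof -
  have w: "ivar t = ivar s \<and> iarr t = iarr s \<and> rarr t 2 = rarr s 2 \<and>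
    rarr t 1 = (rarr s 1)(9 * u + 0 := rvar s 0, 9 * u + 3 := rvar s 1, 9 * u + 6 := rvar s 2,
        9 * u + 1 := rvar s 1 * rvar s 5 - rvar s 2 * rvar s 4,
        9 * u + 4 := rvar s 2 * rvar s 3 - rvar s 0 * rvar s 5,
        9 * u + 7 := rvar s 0 * rvar s 4 - rvar s 1 * rvar s 3,
        9 * u + 2 := rvar s 3, 9 * u + 5 := rvar s 4, 9 * u + 8 := rvar s 5)" (is "_ \<and> _ \<and> _ \<and> _ = ?f")
  proof -
    have "reval e s' = reval e s" if "e \<in> snd ` set frame_entries" "rvar s' = rvar s" for e s'
      using that by (auto simp: frame_entries_def)
    then have "ivar t = ivar s \<and> iarr t = iarr s \<and> rarr t 2 = rarr s 2 \<and>
        rarr t 1 = overwrite u s frame_entries (rarr s 1)"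
      unfolding t_def write_cmd_def by (intro sem_write_list assms(1))
    moreover have "overwrite u s frame_entries (rarr s 1) = ?f"
      by (simp add: frame_entries_def)
    ultimately show ?thesis by metis
  qed
  then show "ivar t = ivar s" "iarr t = iarr s" "rarr t 2 = rarr s 2" by blast+
  have f: "rarr t 1 = ?f" using w by blast
  have "rarr t 1 (9 * u + 0) = rvar s 0" "rarr t 1 (9 * u + 3) = rvar s 1" "rarr t 1 (9 * u + 6) = rvar s 2"
    "rarr t 1 (9 * u + 1) = rvar s 1 * rvar s 5 - rvar s 2 * rvar s 4"
    "rarr t 1 (9 * u + 4) = rvar s 2 * rvar s 3 - rvar s 0 * rvar s 5"
    "rarr t 1 (9 * u + 7) = rvar s 0 * rvar s 4 - rvar s 1 * rvar s 3"
    "rarr t 1 (9 * u + 2) = rvar s 3" "rarr t 1 (9 * u + 5) = rvar s 4" "rarr t 1 (9 * u + 8) = rvar s 5"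
    unfolding f by simp_all
  moreover have "rvec s 0 = vec3 (rvar s 0) (rvar s 1) (rvar s 2)" "rvec s 3 = vec3 (rvar s 3) (rvar s 4) (rvar s 5)"
    by (simp_all add: rvec_def eval_nat_numeral)
  ultimately show "out_frame t u = frame (rvec s 0) (rvec s 3)"
    by (simp add: out_frame_def frame_def cross_components vec_eq_iff forall_3 add_ac mult_ac)
  show "out_frame t u' = out_frame s u'" if "u' \<noteq> u"
  proof -
    have ne: "9 * u' + i \<noteq> 9 * u + j" if "i < 9" "j < 9" for i j
      using that \<open>u' \<noteq> u\<close> by presburger
    have "rarr t 1 (9 * u' + i) = rarr s 1 (9 * u' + i)" if "i < 9" for i
      using ne[OF that, of 0] ne[OF that, of 1] ne[OF that, of 2] ne[OF that] unfolding f by simp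
    then show ?thesis by (simp add: out_frame_def vec_eq_iff add.assoc)
  qed
qed

definition frame_body :: cmd where
  "frame_body = seqs [RAsg 0 (RC 0), RAsg 1 (RC 0), RAsg 2 (RC 0), RAsg 3 (RC 0), RAsg 4 (RC 0), RAsg 5 (RC 0),
     For 5 2 collect_body, fill_in_cmd 0 3, fill_in_cmd 3 0, write_cmd]"

text \<open>A relation, not a function: which half-edge is chosen does not matter, because equally
  labelled ones at a vertex are parallel.\<close>

definition selected :: "(nat \<Rightarrow> real^3) \<Rightarrow> (nat \<Rightarrow> bool) \<Rightarrow> nat \<Rightarrow> real^3 \<Rightarrow> bool" where
  "selected d P H v \<longleftrightarrow> v = 0 \<and> (\<forall>h<H. \<not> P h) \<or> (\<exists>h<H. P h \<and> v = d h)"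

lemma selected_Suc: "selected d P H v \<Longrightarrow> selected d P (Suc H) (if P H then d H else v)"
  by (auto simp: selected_def less_Suc_eq)

text \<open>Positive classes supply the first axis and the others the third. Filling
  \<open>p\<close> before \<open>q\<close> lets the second completion start from a unit vector, even
  if no half-edge meets the vertex.\<close>

definition frame_at :: "nat \<Rightarrow> (nat \<Rightarrow> nat) \<Rightarrow> (nat \<Rightarrow> real^3) \<Rightarrow> (nat \<Rightarrow> int) \<Rightarrow> nat \<Rightarrow> real^3^3 \<Rightarrow> bool" where
  "frame_at m ep d f u M \<longleftrightarrow> (\<exists>p q. selected d (\<lambda>h. ep h = u \<and> 1 \<le> f h) (2 * m) p \<and>
     selected d (\<lambda>h. ep h = u \<and> \<not> 1 \<le> f h) (2 * m) q \<and> M = frame (fill_in p q) (fill_in q (fill_in p q)))"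

lemma mods_frame:
  "mods collect_body = {}" "mods (fill_in_cmd a b) = {}" "mods write_cmd = {}" "mods frame_body = {5}"
  by (simp_all add: frame_body_def collect_body_def load_cmd_def fill_in_cmd_def perp_cmd_def write_cmd_def
      write_list_def frame_entries_def)

lemma sem_frame_body:
  assumes e: "env n m ep d s" and u: "ivar s 9 = int u"
  defines "t \<equiv> sem frame_body s"
  shows "env n m ep d t" "iarr t = iarr s" "ivar t 3 = ivar s 3" "frame_at m ep d (iarr s 1) u (out_frame t u)"
    "u' \<noteq> u \<Longrightarrow> out_frame t u' = out_frame s u'"
proof -
  define s0 where "s0 = s\<lparr>rvar := (rvar s)(0 := 0, 1 := 0, 2 := 0, 3 := 0, 4 := 0, 5 := 0)\<rparr>"
  define s1 where "s1 = sem (For 5 2 collect_body) s0"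
  define s2 where "s2 = sem (fill_in_cmd 0 3) s1"
  define s3 where "s3 = sem (fill_in_cmd 3 0) s2"
  have t: "t = sem write_cmd s3"
    by (simp add: t_def frame_body_def s0_def s1_def s2_def s3_def del: sem.simps(9))
  let ?P = "\<lambda>h. ep h = u \<and> 1 \<le> iarr s 1 h" and ?N = "\<lambda>h. ep h = u \<and> \<not> 1 \<le> iarr s 1 h"
  let ?Inv = "\<lambda>k t. env n m ep d t \<and> ivar t 9 = int u \<and> ivar t 3 = ivar s 3 \<and> iarr t = iarr s \<and> rarr t = rarr s \<and>
    selected d ?P k (rvec t 0) \<and> selected d ?N k (rvec t 3)"
  have "vec3 0 0 0 = 0" by (simp add: vec_eq_iff forall_3)
  then have z: "rvec s0 0 = 0" "rvec s0 3 = 0" by (simp_all add: s0_def rvec_def)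
  have 1: "?Inv (2 * m) s1"
    unfolding s1_def
  proof (rule sem_For[where Inv = ?Inv])
    show "?Inv 0 (iset 5 0 s0)"
      using e u z by (simp add: s0_def selected_def rvec_def)
    show "ivar s0 2 = int (2 * m)" using e by (simp add: s0_def env_def)
    show "5 \<notin> mods collect_body" by (simp add: mods_frame)
    fix k r assume k: "k < 2 * m" and I: "?Inv k r" and r: "ivar r 5 = int k"
    let ?r = "sem collect_body r"
    have k': "iarr s 0 k = int (ep k)" "dir_at r k = d k" using I k by (auto simp: env_def)
    have same: "ivar ?r = ivar r" "iarr ?r = iarr r" "rarr ?r = rarr r"
      by (simp_all add: collect_body_def load_cmd_def)
    have "rvec ?r 0 = (if ?P k then d k else rvec r 0)" "rvec ?r 3 = (if ?N k then d k else rvec r 3)"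
      using I r k' by (auto simp: collect_body_def load_cmd_def rvec_def dir_at_def)
    then have "selected d ?P (Suc k) (rvec ?r 0)" "selected d ?N (Suc k) (rvec ?r 3)"
      using I selected_Suc[of d ?P k] selected_Suc[of d ?N k] by simp_all
    moreover have "rvec (iset 5 (int (Suc k)) ?r) = rvec ?r" by (simp add: rvec_def fun_eq_iff)
    moreover have "env n m ep d ?r" using I env_cong[OF same(1,2)] same(3) by simp
    ultimately show "?Inv (Suc k) (iset 5 (int (Suc k)) ?r)" using I same by simp
  qed
  note 2 = sem_fill_in[of 0 3 s1, folded s2_def, simplified]
  note 3 = sem_fill_in[of 3 0 s2, folded s3_def, simplified]
  have "ivar s3 9 = int u" using 1 2 3 by simp
  note 4 = sem_write[OF this, folded t]
  have i: "ivar t = ivar s1" "iarr t = iarr s" "rarr t 2 = rarr s 2" using 1 2 3 4 by simp_all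
  show "env n m ep d t" using 1 env_cong[of t s1 n m ep d] i by simp
  show "iarr t = iarr s" "ivar t 3 = ivar s 3" using 1 i by simp_all
  have "out_frame t u = frame (fill_in (rvec s1 0) (rvec s1 3)) (fill_in (rvec s1 3) (fill_in (rvec s1 0) (rvec s1 3)))"
    using 2 3 4(4) by simp
  then show "frame_at m ep d (iarr s 1) u (out_frame t u)" using 1 unfolding frame_at_def by blast
  show "out_frame t u' = out_frame s u'" if "u' \<noteq> u"
    using 4(5)[OF that] 1 2 3 by (simp add: out_frame_def)
qed

lemma sem_frames:
  assumes "env n m ep d s"
  defines "t \<equiv> sem (For 9 0 frame_body) s"
  shows "\<forall>u<n. frame_at m ep d (iarr s 1) u (out_frame t u)" "ivar t 3 = ivar s 3"
proof -
  let ?Inv = "\<lambda>k t. env n m ep d t \<and> iarr t = iarr s \<and> ivar t 3 = ivar s 3 \<and>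
    (\<forall>u<k. frame_at m ep d (iarr s 1) u (out_frame t u))"
  have "?Inv n t"
    unfolding t_def
  proof (rule sem_For[where Inv = ?Inv])
    show "?Inv 0 (iset 9 0 s)" using assms by simp
    show "ivar s 0 = int n" using assms by (simp add: env_def)
    show "9 \<notin> mods frame_body" by (simp add: mods_frame)
    fix k r assume k: "k < n" and I: "?Inv k r" and r: "ivar r 9 = int k"
    have e: "env n m ep d r" using I by simp
    note f = sem_frame_body[OF e r]
    have "out_frame (iset 9 (int (Suc k)) (sem frame_body r)) = out_frame (sem frame_body r)"
      by (simp add: out_frame_def fun_eq_iff)
    moreover have "frame_at m ep d (iarr s 1) u (out_frame (sem frame_body r) u)" if "u < Suc k" for u
      using I f(4) f(5)[of u] that by (cases "u = k") auto
    ultimately show "?Inv (Suc k) (iset 9 (int (Suc k)) (sem frame_body r))"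
      using I f(1-3) by simp
  qed
  then show "\<forall>u<n. frame_at m ep d (iarr s 1) u (out_frame t u)" "ivar t 3 = ivar s 3" by auto
qed

section \<open>Correctness of the whole program\<close>

text \<open>Once all pairs are treated, the signs of \<open>f\<close> form a labelling: at a common
  vertex equal signs rule out \<open>f h = - f h'\<close> and leave the parallel case, and opposite
  signs leave the orthogonal one. Hence \<open>p\<close> and \<open>q\<close> represent all
  directions at the vertex.\<close>

lemma NLY_basis_if_frames:
  assumes G: "mw_graph n es" "all_rank_one es" and he: "half_edges es ep d"
    and f: "signed_classes (length es) ep d ({..<2 * length es} \<times> {..<2 * length es}) f"
    and O: "\<And>u. u < n \<Longrightarrow> frame_at (length es) ep d f u (Ob u)"
  shows "NLY_basis n es Ob"
proof -
  let ?m = "length es"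
  note hv = half_edges_vertex[OF he G(1)] and hn = half_edges_norm[OF he]
  have comp: "compatible ep d h h' (f h) (f h')" if "h < 2 * ?m" "h' < 2 * ?m" for h h'
    using f that by (auto simp: signed_classes_def)
  have f0: "f h \<noteq> 0" if "h < 2 * ?m" for h using f that by (simp add: signed_classes_def)
  have main: "orthogonal_matrix (Ob u) \<and>
      (\<forall>h<2 * ?m. ep h = u \<longrightarrow> parallel (d h) (bvec Ob u (if 1 \<le> f h then 1 else 3)))" if u: "u < n" for u
  proof -
    obtain p q where p: "selected d (\<lambda>h. ep h = u \<and> 1 \<le> f h) (2 * ?m) p"
      and q: "selected d (\<lambda>h. ep h = u \<and> \<not> 1 \<le> f h) (2 * ?m) q"
      and fr: "Ob u = frame (fill_in p q) (fill_in q (fill_in p q))"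
      using O[OF u] unfolding frame_at_def by blast
    have p1: "p = 0 \<or> norm p = 1" and q1: "q = 0 \<or> norm q = 1" using p q hn by (auto simp: selected_def)
    have pq: "p \<bullet> q = 0"
    proof (cases "p = 0 \<or> q = 0")
      case False
      then obtain h h' where h: "h < 2 * ?m" "ep h = u" "1 \<le> f h" "p = d h" "h' < 2 * ?m" "ep h' = u" "\<not> 1 \<le> f h'" "q = d h'"
        using p q unfolding selected_def by blast
      then show ?thesis using comp[OF h(1) h(5)] by (auto simp: compatible_def)
    qed auto
    have le0: "v \<bullet> v \<le> 0 \<longleftrightarrow> v = 0" for v :: "real^3"
      by (metis inner_eq_zero_iff inner_gt_zero_iff not_le order_refl)
    define p' where "p' = fill_in p q"
    define q' where "q' = fill_in q p'"
    have p': "norm p' = 1" "q = 0 \<or> p' \<bullet> q = 0" "p \<noteq> 0 \<Longrightarrow> p' = p"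
      using p1 q1 pq perp[of q] by (auto simp: p'_def fill_in_def inner_commute le0)
    have q': "norm q' = 1" "p' \<bullet> q' = 0" "q \<noteq> 0 \<Longrightarrow> q' = q"
      using q1 p' perp[of p'] by (auto simp: q'_def fill_in_def inner_commute le0)
    have O: "Ob u = frame p' q'" by (simp add: fr p'_def q'_def)
    have b: "bvec Ob u 1 = p'" "bvec Ob u 3 = q'" by (simp_all add: bvec_def O column_frame)
    have "parallel (d h) (bvec Ob u (if 1 \<le> f h then 1 else 3))" if h: "h < 2 * ?m" "ep h = u" for h
    proof (cases "1 \<le> f h")
      case True
      then obtain h' where h': "h' < 2 * ?m" "ep h' = u" "1 \<le> f h'" "p = d h'"
        using p h unfolding selected_def by blast
      have "p \<noteq> 0" using hn[OF h'(1)] h'(4) by auto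
      have "(d h \<bullet> d h')\<^sup>2 = 1"
        using comp[OF h(1) h'(1)] True h h' by (auto simp: compatible_def)
      then show ?thesis using parallel_iff_inner hn h h' p'(3)[OF \<open>p \<noteq> 0\<close>] b True by auto
    next
      case False
      then obtain h' where h': "h' < 2 * ?m" "ep h' = u" "\<not> 1 \<le> f h'" "q = d h'"
        using q h unfolding selected_def by blast
      have "q \<noteq> 0" using hn[OF h'(1)] h'(4) by auto
      \<comment> \<open>Nonzero classes turn the failed test into a strict sign, which excludes the
        orthogonal alternative.\<close>
      have "f h < 0" "f h' < 0" using False h'(3) f0[OF h(1)] f0[OF h'(1)] by auto
      then have "(d h \<bullet> d h')\<^sup>2 = 1"
        using comp[OF h(1) h'(1)] h h' by (auto simp: compatible_def)
      then show ?thesis using parallel_iff_inner hn h h' q'(3)[OF \<open>q \<noteq> 0\<close>] b False by auto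
    qed
    then show ?thesis using orthogonal_frame[OF p'(1) q'(1,2)] O by simp
  qed
  show ?thesis
  proof (rule NLY_basis_if_parallel[OF G he, where L = "\<lambda>h. 1 \<le> f h"])
    show "orthogonal_matrix (Ob u)" if "u < n" for u using main[OF that] by blast
    show "(1 \<le> f (2 * k)) = (1 \<le> f (2 * k + 1))" if "k < ?m" for k
      using f that by (simp add: signed_classes_def)
    show "parallel (d h) (bvec Ob (ep h) (if 1 \<le> f h then 1 else 3))" if "h < 2 * ?m" for h
      using main[OF hv[OF that]] that by blast
  qed
qed

text \<open>The loop depth is 3, from merging inside the double loop over half-edges. The frames are
  computed even after a failure and leave the answer unchanged.\<close>

definition program :: cmd where
  "program = seqs [IAsg 3 (IC 1), For 4 1 dirs_body, For 9 2 (For 5 2 pair_body), For 9 0 frame_body]"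

lemma wf_program: "wf_cmd program"
  by (simp add: program_def dirs_body_def pick_cmd_def pair_body_def test_cmd_def dot_exp_def merge_body_def
      frame_body_def collect_body_def load_cmd_def fill_in_cmd_def perp_cmd_def write_cmd_def write_list_def frame_entries_def square_sum_def)

text \<open>The result is stated for every \<open>Ob\<close> that agrees with the output on actual
  vertices, since the decoded assignment is a function on all natural numbers and is unknown beyond
  \<open>n\<close>.\<close>

lemma sem_program:
  assumes G: "mw_graph n es" "all_rank_one es" and s: "input_state n es s"
  defines "t \<equiv> sem program s"
  shows "ivar t 0 = int n"
    "ivar t 3 = 1 \<and> (\<forall>Ob. (\<forall>u<n. Ob u = out_frame t u) \<longrightarrow> NLY_basis n es Ob) \<or>
     ivar t 3 = 0 \<and> (\<nexists>Ob. NLY_basis n es Ob)"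
proof -
  let ?m = "length es"
  define s1 where "s1 = sem (For 4 1 dirs_body) (iset 3 1 s)"
  define s2 where "s2 = sem (For 9 2 (For 5 2 pair_body)) s1"
  have t: "t = sem (For 9 0 frame_body) s2"
    by (simp add: t_def program_def s1_def s2_def del: sem.simps(9))
  have "0 \<notin> mods program"
    using mods_wf[OF wf_program, of 0] by auto
  then show "ivar t 0 = int n" using s ivar_sem by (simp add: t_def input_state_def)
  have "input_state n es (iset 3 1 s)" "ivar (iset 3 1 s) 3 = 1" using s by (simp_all add: input_state_def)
  note 1 = sem_dirs[OF this G(2), folded s1_def]
  define ep where "ep h = nat (iarr s1 0 h)" for h
  define d where "d = dir_at s1"
  have he: "half_edges es ep d" using 1 by (auto simp: half_edges_def ep_def d_def input_state_def)
  have "iarr s1 0 h = int (ep h)" if "h < 2 * ?m" for h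
    using that by (rule half_edge_cases) (use 1(1) in \<open>auto simp: ep_def input_state_def\<close>)
  then have "env n ?m ep d s1" using 1(1) by (simp add: env_def input_state_def d_def)
  moreover have "signed_classes ?m ep d {} (iarr s1 1)"
    by (rule signed_classes_cong[OF signed_classes_init]) (use 1(4) in auto)
  ultimately have "search_state n ?m ep d {} s1" using 1(2) by (simp add: search_state_def)
  from sem_pairs[OF this half_edges_norm[OF he]] have
    2: "search_state n ?m ep d ({..<2 * ?m} \<times> {..<2 * ?m}) s2" by (simp add: s2_def)
  then have "env n ?m ep d s2" by (simp add: search_state_def)
  note 3 = sem_frames[OF this, folded t]
  show "ivar t 3 = 1 \<and> (\<forall>Ob. (\<forall>u<n. Ob u = out_frame t u) \<longrightarrow> NLY_basis n es Ob) \<or>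
     ivar t 3 = 0 \<and> (\<nexists>Ob. NLY_basis n es Ob)"
  proof (cases "ivar s2 3 = 1")
    case True
    then have "signed_classes ?m ep d ({..<2 * ?m} \<times> {..<2 * ?m}) (iarr s2 1)"
      using 2 by (simp add: search_state_def)
    then have "NLY_basis n es Ob" if "\<forall>u<n. Ob u = out_frame t u" for Ob
      by (rule NLY_basis_if_frames[OF G he]) (use 3 that in auto)
    then show ?thesis using True 3 by auto
  next
    case False
    then have "ivar s2 3 = 0" "\<nexists>L. labelling ?m ep d L" using 2 by (auto simp: search_state_def)
    then show ?thesis using labelling_if_NLY_basis[OF G he] 3 by auto
  qed
qed

definition ram_program :: "instr list" where
  "ram_program = boot @ code program 138 @ finish (138 + csize program)"

theorem theorem6p7:
  "\<exists>(P :: instr list) (c :: nat) (k :: nat).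
     \<forall>n es. mw_graph n es \<and> all_rank_one es \<longrightarrow>
       (\<exists>t. t \<le> c * (n + length es + 1) ^ k \<and>
            halted P ((ram_step P ^^ t) (init_state n es)) \<and>
            correct_output n es ((ram_step P ^^ t) (init_state n es)))"
proof (rule exI[of _ ram_program], rule exI[of _ "170 + time program * 2 ^ depth program"],
    rule exI[of _ "Suc (depth program)"], intro allI impI)
  let ?P = ram_program
  fix n es
  assume "mw_graph n es \<and> all_rank_one es"
  then have G: "mw_graph n es" "all_rank_one es" by auto
  let ?m = "length es"
  obtain I R where init: "init_state n es = (0, I, R)" by (simp add: init_state_def)
  have I: "I r = (if r = 0 then int n
           else if r = 1 then int ?m
           else if r < 2 + 2 * ?m then
             (if even r then int (fst (es ! ((r - 2) div 2)))
              else int (fst (snd (es ! ((r - 2) div 2)))))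
           else 0)" for r
    using init by (auto simp: init_state_def)
  have R: "R r = (if r < 9 * ?m then
             snd (snd (es ! (r div 9))) $ ix3 ((r mod 9) div 3) $ ix3 (r mod 3) else 0)" for r
    using init by (auto simp: init_state_def)
  have code: "code_at ?P 0 boot" "code_at ?P 138 (code program 138)"
    "code_at ?P (138 + csize program) (finish (138 + csize program))"
    using code_at_self[of "[]" boot "code program 138 @ finish (138 + csize program)"]
      code_at_self[of boot "code program 138" "finish (138 + csize program)"]
      code_at_self[of "boot @ code program 138" "finish (138 + csize program)" "[]"]
    by (simp_all add: ram_program_def length_boot)
  have ne: "2 \<le> n \<and> I 2 \<noteq> I 3" if "1 \<le> ?m"
  proof -
    have "es ! 0 \<in> set es" using that by (intro nth_mem) linarith
    then have "fst (es ! 0) < n" "fst (snd (es ! 0)) < n" "fst (es ! 0) \<noteq> fst (snd (es ! 0))"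
      using G(1) by (auto simp: mw_graph_def case_prod_beta)
    moreover have "I 2 = int (fst (es ! 0))" "I 3 = int (fst (snd (es ! 0)))" using that by (cases es; simp add: I)+
    ultimately show ?thesis by auto
  qed
  obtain B I1 R1 where 1: "steps ?P (0, I, R) (66 * ?m + 150) (138, I1, R1)" "relocated B n ?m I R I1 R1"
    "I1 5 = int (2 * ?m)"
    using steps_boot[OF code(1), of I n ?m R] ne by (auto simp: I)
  \<comment> \<open>The abstract state is read off the memory; cells outside the relocated input
    have whatever content was left there.\<close>
  define s where "s = \<lparr>ivar = \<lambda>r. I1 (3 + r), rvar = R1, iarr = \<lambda>a i. I1 (B + 4 * i + a), rarr = \<lambda>a i. R1 (B + 4 * i + a)\<rparr>"
  have rel: "rel B s I1 R1" using 1(2) by (simp add: rel_def s_def relocated_def)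
  have inp: "input_state n es s"
    unfolding input_state_def
  proof (intro conjI allI impI)
    show "ivar s 0 = int n" "ivar s 1 = int ?m" "ivar s 2 = int (2 * ?m)"
      using 1(2,3) by (simp_all add: s_def relocated_def)
    fix k assume k: "k < ?m"
    have "iarr s 0 h = I (2 + h)" if "h < 2 * ?m" for h using 1(2) that by (simp add: s_def relocated_def)
    then show "iarr s 0 (2 * k) = int (fst (es ! k))" "iarr s 0 (2 * k + 1) = int (fst (snd (es ! k)))"
      using k by (simp_all add: I)
    fix i :: nat assume i: "i < 9"
    have "9 * k + i < 9 * ?m" using k i by simp
    then have "R1 (B + 4 * (9 * k + i)) = R (9 * k + i)" using 1(2) unfolding relocated_def by blast
    then have "rarr s 0 (9 * k + i) = R (9 * k + i)" by (simp add: s_def)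
    moreover have "(9 * k + i) div 9 = k" "(9 * k + i) mod 9 = i" using i by simp_all
    moreover have "(9 * k + i) mod 3 = i mod 3" by presburger
    ultimately show "rarr s 0 (9 * k + i) = snd (snd (es ! k)) $ ix3 (i div 3) $ ix3 (i mod 3)"
      using k i by (simp add: R)
  qed
  note res = sem_program[OF G inp]
  let ?D = "n + 2 * ?m" and ?t = "sem program s"
  have "ivar s 0 = int n" "ivar s 1 = int ?m" "ivar s 2 = int (2 * ?m)" using inp by (auto simp: input_state_def)
  moreover have "l = 0 \<or> l = 1 \<or> l = 2" if "l < 3" for l :: nat using that by linarith
  ultimately have "ivar s l \<le> int ?D" if "l < 3" for l using that by fastforce
  then have "\<forall>l<3. ivar s l \<le> int ?D" by blast
  from steps_code[OF code(2) rel wf_program this] obtain I2 R2 where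
    2: "steps ?P (138, I1, R1) (time program * Suc ?D ^ depth program) (138 + csize program, I2, R2)" "rel B ?t I2 R2"
    by blast
  have v: "I2 (3 + r) = ivar ?t r" if "r < 17" for r using 2(2) that by (simp add: rel_def)
  have "I2 2 = int B" "I2 3 = int n" "9 * n + 1 \<le> B"
    using 2(2) 1(2) v[of 0] res(1) by (simp_all add: rel_def relocated_def)
  from steps_finish[OF code(3) this, of R2] obtain I3 R3 where
    3: "steps ?P (138 + csize program, I2, R2) (54 * n + 20) (138 + csize program + 20, I3, R3)"
      "halted ?P (138 + csize program + 20, I3, R3)" "I3 0 = I2 6" "\<forall>j<9 * n. R3 j = R2 (B + 4 * j + 1)"
    by blast
  let ?f = "(138 + csize program + 20, I3, R3)" and ?S = "n + ?m + 1"
  have "I3 0 = ivar ?t 3" using 3(3) v[of 3] by simp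
  moreover have "decode_basis ?f u = out_frame ?t u" if "u < n" for u
  proof -
    have "R3 (9 * u + j) = rarr ?t 1 (9 * u + j)" if "j < 9" for j
    proof -
      have "R2 (B + 4 * (9 * u + j) + 1) = rarr ?t 1 (9 * u + j)"
        using 2(2) unfolding rel_def by (metis one_less_numeral_iff semiring_norm(76))
      moreover have "9 * u + j < 9 * n" using that \<open>u < n\<close> by simp
      ultimately show ?thesis using 3(4) by metis
    qed
    then show ?thesis by (simp add: decode_basis_def out_frame_def vec_eq_iff add.assoc)
  qed
  ultimately have "correct_output n es ?f"
    using res(2) by (auto simp: correct_output_def)
  moreover obtain t where t: "t \<le> 66 * ?m + 150 + time program * Suc ?D ^ depth program + (54 * n + 20)"
    "(ram_step ?P ^^ t) (init_state n es) = ?f"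
    using steps_trans[OF steps_trans[OF 1(1) 2(1)] 3(1)] unfolding steps_def init by blast
  \<comment> \<open>The 170 covers the linear cost of moving input and output. The power of 2 comes
    from \<open>Suc (n + 2 * m)\<close> being at most twice the input size, and the extra exponent
    accommodates the linear terms.\<close>
  have "t \<le> (170 + time program * 2 ^ depth program) * ?S ^ Suc (depth program)"
  proof -
    have "Suc ?D ^ depth program \<le> (2 * ?S) ^ depth program" by (intro power_mono) auto
    also have "\<dots> \<le> 2 ^ depth program * ?S ^ Suc (depth program)"
      unfolding power_mult_distrib by (intro mult_le_mono2 power_increasing) auto
    finally have "time program * Suc ?D ^ depth program \<le> time program * (2 ^ depth program * ?S ^ Suc (depth program))"
      by (rule mult_le_mono2)
    moreover have "66 * ?m + 150 + (54 * n + 20) \<le> 170 * ?S" by simp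
    moreover have "?S \<le> ?S ^ Suc (depth program)"
      using power_increasing[of 1 "Suc (depth program)" ?S] by simp
    ultimately show ?thesis unfolding add_mult_distrib mult.assoc using t(1) by linarith
  qed
  ultimately show "\<exists>t. t \<le> (170 + time program * 2 ^ depth program) * (n + ?m + 1) ^ Suc (depth program) \<and>
      halted ?P ((ram_step ?P ^^ t) (init_state n es)) \<and> correct_output n es ((ram_step ?P ^^ t) (init_state n es))"
    using t(2) 3(2) by auto
qed

end
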